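(* Let $t\geq 1$ and $k\geq 1$ be integers, let $a_{1}\geq a_{2}\geq\cdots\geq a_{t}\geq 3$ be integers, and let $F=\left(\bigcup_{1\leq i\leq t}K_{1,a_{i}}\right)\cup P_{2k+3}$ (disjoint union). Then for all sufficiently large $n$ (i.e. for all $n\geq n_0$ for some $n_0$ depending only on $F$), each graph in $\mathrm{EX}(n,F)$ is (up to isomorphism) either a graph in $\mathrm{EX}\left(n,\bigcup_{1\leq i\leq t}K_{1,a_{i}}\right)$, or of the form $K_{t}\vee H_{n-t,k}$, where $H_{n-t,k}$ is a graph of order $n-t$ satisfying the following: (i) if $a_{t}\leq 2k$, then $H_{n-t,k}=K_{k}\vee\left(K_{2}\cup\overline{K_{n-t-k-2}}\right)$; (ii) if $a_{t}=2k+1$, then $H_{n-t,k}$ is a $2k$-regular and $P_{2k+3}$-free graph of order $n-t$, or $k=1$ and $H_{n-t,k}=K_{1}\vee\left(K_{2}\cup\overline{K_{n-t-3}}\right)$; (iii) if $a_{t}\geq 2k+2$, then $H_{n-t,k}\in\mathrm{EX}(n-t,P_{2k+3})$.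
   Context: All graphs are finite, undirected and simple. $K_n$ and $P_n$ denote the complete graph and the path on $n$ vertices; $K_{1,d}$ is the star on $d+1$ vertices; $\overline{G}$ is the complement of $G$ (so $\overline{K_m}$ is the edgeless graph on $m$ vertices). $G_1\cup G_2$ denotes the disjoint union, and $G_1\vee G_2$ denotes the join, obtained from the disjoint union by connecting each vertex of $G_1$ to each vertex of $G_2$. A graph $G$ is $F$-free if it does not contain $F$ as a (not necessarily induced) subgraph. $\mathrm{EX}(n,F)$ denotes the set of $F$-free graphs of order $n$ with the maximum number of edges; its members are called the extremal graphs of order $n$ for $F$. *)

theory Defs
  imports Main
begin

record 'a ugraph =
  verts :: "'a set"
  edges :: "'a set set"

definition all_pairs :: "'a set \<Rightarrow> 'a set set" where
  "all_pairs V = {e. e \<subseteq> V \<and> card e = 2}"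

text \<open>Finite, undirected, simple: edges are two-element sets of vertices.\<close>

definition simple_graph :: "'a ugraph \<Rightarrow> bool" where
  "simple_graph G \<longleftrightarrow> finite (verts G) \<and> edges G \<subseteq> all_pairs (verts G)"

definition degree :: "'a ugraph \<Rightarrow> 'a \<Rightarrow> nat" where
  "degree G v = card {e \<in> edges G. v \<in> e}"

definition regular :: "nat \<Rightarrow> 'a ugraph \<Rightarrow> bool" where
  "regular d G \<longleftrightarrow> (\<forall>v \<in> verts G. degree G v = d)"

definition isomorphic :: "'a ugraph \<Rightarrow> 'b ugraph \<Rightarrow> bool" (infix "\<simeq>" 50) where
  "G \<simeq> H \<longleftrightarrow> (\<exists>f. bij_betw f (verts G) (verts H) \<and> edges H = (\<lambda>e. f ` e) ` edges G)"

definition subgraph :: "'a ugraph \<Rightarrow> 'a ugraph \<Rightarrow> bool" where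
  "subgraph S G \<longleftrightarrow> simple_graph S \<and> verts S \<subseteq> verts G \<and> edges S \<subseteq> edges G"

text \<open>The subgraph need not be induced.\<close>

definition is_free :: "'b ugraph \<Rightarrow> 'a ugraph \<Rightarrow> bool" where
  "is_free F G \<longleftrightarrow> \<not> (\<exists>S. subgraph S G \<and> F \<simeq> S)"

definition complete_graph :: "nat \<Rightarrow> nat ugraph" where
  "complete_graph n = \<lparr>verts = {..<n}, edges = all_pairs {..<n}\<rparr>"

definition path_graph :: "nat \<Rightarrow> nat ugraph" where
  "path_graph n = \<lparr>verts = {..<n}, edges = {{i, Suc i} |i. Suc i < n}\<rparr>"

text \<open>\<open>star_graph d\<close> is the star with \<open>d\<close> leaves; its centre is \<open>0\<close>.\<close>

definition star_graph :: "nat \<Rightarrow> nat ugraph" where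
  "star_graph d = \<lparr>verts = {0..d}, edges = {{0, i} |i. i \<in> {1..d}}\<rparr>"

definition complement :: "'a ugraph \<Rightarrow> 'a ugraph" where
  "complement G = \<lparr>verts = verts G, edges = all_pairs (verts G) - edges G\<rparr>"

definition disj_union :: "'a ugraph \<Rightarrow> 'b ugraph \<Rightarrow> ('a + 'b) ugraph" (infixr "\<squnion>\<^sub>G" 65) where
  "G \<squnion>\<^sub>G H = \<lparr>verts = Inl ` verts G \<union> Inr ` verts H,
            edges = (\<lambda>e. Inl ` e) ` edges G \<union> (\<lambda>e. Inr ` e) ` edges H\<rparr>"

definition join :: "'a ugraph \<Rightarrow> 'b ugraph \<Rightarrow> ('a + 'b) ugraph" (infixr "\<or>\<^sub>G" 65) where
  "G \<or>\<^sub>G H = \<lparr>verts = verts (G \<squnion>\<^sub>G H),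
            edges = edges (G \<squnion>\<^sub>G H) \<union> {{Inl u, Inr v} |u v. u \<in> verts G \<and> v \<in> verts H}\<rparr>"

definition disj_Union :: "'i set \<Rightarrow> ('i \<Rightarrow> 'a ugraph) \<Rightarrow> ('i \<times> 'a) ugraph" where
  "disj_Union I G = \<lparr>verts = (SIGMA i:I. verts (G i)),
                     edges = (\<Union>i\<in>I. (\<lambda>e. Pair i ` e) ` edges (G i))\<rparr>"

text \<open>
  Vertices of the host graphs are natural numbers, which covers every finite graph up to
  isomorphism. Any \<open>n\<close>-element set of naturals is allowed as vertex set, so \<open>extremal n F\<close> is closed
  under isomorphism of graphs over the naturals.
\<close>

definition extremal :: "nat \<Rightarrow> 'b ugraph \<Rightarrow> nat ugraph set" where
  "extremal n F = {G. simple_graph G \<and> card (verts G) = n \<and> is_free F G \<and>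
     (\<forall>G' :: nat ugraph. simple_graph G' \<and> card (verts G') = n \<and> is_free F G'
        \<longrightarrow> card (edges G') \<le> card (edges G))}"

definition star_forest :: "nat \<Rightarrow> (nat \<Rightarrow> nat) \<Rightarrow> (nat \<times> nat) ugraph" where
  "star_forest t a = disj_Union {1..t} (\<lambda>i. star_graph (a i))"

end

theory Submission
  imports Defs
begin

text \<open>
  Let \<open>G\<close> be extremal for the disjoint union of the stars and \<open>P\<^bsub>2k+3\<^esub>\<close>, and suppose that it
  contains the star forest. Call a vertex large if its degree is at least a constant \<open>M\<close>; such a vertex
  can host any of the stars greedily, away from any small set. With fewer than \<open>t\<close> large vertices, the
  stars that avoid them stay in place, and the rest of \<open>G\<close> without the large vertices contains no
  \<open>P\<^bsub>2k+3\<^esub>\<close>, which leaves too few edges. Otherwise removing any \<open>t\<close> large vertices destroys all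
  copies of \<open>P\<^bsub>2k+3\<^esub>\<close>. For \<open>a\<^sub>t \<ge> 2k+2\<close> the exact Faudree--Schelp bound finishes the proof. For
  \<open>a\<^sub>t \<le> 2k+1\<close> a further star outside \<open>t - 1\<close> large vertices frees one large vertex for the path, so
  the large vertices see no component \<open>K\<^bsub>2k+2\<^esub>\<close> and, by edge counting, miss only a bounded number of
  vertices. Long paths through them then force either exactly \<open>t\<close> large vertices and a \<open>2k\<close>-regular
  rest, or exactly \<open>t + k\<close> large vertices and a single remaining edge.

  The Faudree--Schelp bound is proved by induction. In a minimal counterexample with
  \<open>n = 2mq + r\<close> vertices the minimum degree is at least \<open>r\<close>, and the \<open>m\<close>-core is Hamiltonian on
  \<open>s < 2m\<close> vertices. Peeling off the vertices outside the core settles \<open>s \<le> 2m - r\<close>. In the remaining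
  case a longest cycle through the core has an ear whose two ends are adjacent to predecessors of core
  vertices, and rotating along the ear gives a Hamiltonian path of cycle and ear between two core
  vertices; Ore's argument closes it to a longer cycle.
\<close>

section \<open>Degrees, edge counts, paths and cycles\<close>

text \<open>Write P = n - t. Three fillings of the P vertices outside t fully joined ones compete.
  Twice their edge numbers are about (2k+1)P for copies of K_{2k+2}, 2kP for 2k-regular blocks, and
  2kP - k^2 - k + 2 for K_k joined to one edge and isolated vertices. The first two must have
  degrees below a_t, whence the thresholds 2k + 2 and 2k + 1. The last two differ by a constant
  only, so for a_t <= 2k + 1 the final counts must be exact, and k^2 + k <= 2 is what singles out k
  = 1 as the tie. The obstacle is that a graph without P_{2k+3} may have (2k+1)/2 edges per vertex,
  more than the last two fillings. The excess sits in components on 2k + 2 vertices. Each gains k +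
  1 edges over k per vertex, but costs 2k + 2 edges at a joined vertex that misses it, and this
  imbalance bounds the number of missing edges. Afterwards only boundedly many vertices are
  exceptional; deleting them costs O(1) edges since degrees outside the large vertices are bounded,
  so Erdos-Gallai still yields the short paths from which the long ones are assembled.\<close>

lemma card_Diff_int:
  assumes "finite V" "T \<subseteq> V" shows "int (card (V - T)) = int (card V) - int (card T)"
  using assms by (metis card_Diff_subset card_mono finite_subset of_nat_diff)

locale two_graph =
  fixes E :: "'a set set"
  assumes card2: "e \<in> E \<Longrightarrow> card e = 2"
begin

definition adj :: "'a \<Rightarrow> 'a \<Rightarrow> bool" where "adj u v \<longleftrightarrow> {u, v} \<in> E"
text \<open>Neighbourhoods, degrees and edge counts are relative to a vertex set \<open>W\<close>.
  Deleting vertices then only shrinks \<open>W\<close>, and one edge set serves all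
  subgraphs.\<close>

definition nb :: "'a set \<Rightarrow> 'a \<Rightarrow> 'a set" where "nb W v = {u \<in> W. adj v u}"
definition dg :: "'a set \<Rightarrow> 'a \<Rightarrow> nat" where "dg W v = card (nb W v)"
definition ne :: "'a set \<Rightarrow> nat" where "ne W = card {e \<in> E. e \<subseteq> W}"
definition pth :: "'a list \<Rightarrow> bool" where "pth xs \<longleftrightarrow> distinct xs \<and> successively adj xs"
definition cyc :: "'a list \<Rightarrow> bool" where "cyc xs \<longleftrightarrow> xs \<noteq> [] \<and> pth xs \<and> adj (last xs) (hd xs)"
definition no_path :: "nat \<Rightarrow> 'a set \<Rightarrow> bool" where
  "no_path l W \<longleftrightarrow> (\<forall>xs. pth xs \<longrightarrow> set xs \<subseteq> W \<longrightarrow> length xs < l)"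

lemma adj_sym: "adj u v \<longleftrightarrow> adj v u"
  by (simp add: adj_def insert_commute)

lemma adj_irrefl [simp]: "\<not> adj u u"
  using card2[of "{u}"] by (auto simp: adj_def)

lemma edgeE:
  assumes "e \<in> E" obtains u v where "e = {u, v}" "u \<noteq> v" "adj u v"
  using card2[OF assms] assms unfolding card_2_iff adj_def by auto

lemma nb_subset: "nb W v \<subseteq> W" by (auto simp: nb_def)

lemma finite_nb [simp]: "finite W \<Longrightarrow> finite (nb W v)"
  by (simp add: nb_def)

lemma nb_mono: "W \<subseteq> W' \<Longrightarrow> nb W v \<subseteq> nb W' v" by (auto simp: nb_def)

lemma dg_mono: "W \<subseteq> W' \<Longrightarrow> finite W' \<Longrightarrow> dg W v \<le> dg W' v"
  unfolding dg_def by (intro card_mono nb_mono) auto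

lemma dg_insert: "finite W \<Longrightarrow> x \<notin> W \<Longrightarrow> dg (insert x W) v = dg W v + (if adj v x then 1 else 0)"
proof -
  assume a: "finite W" "x \<notin> W"
  have "nb (insert x W) v = (if adj v x then insert x (nb W v) else nb W v)"
    by (auto simp: nb_def)
  moreover have "x \<notin> nb W v" using a by (auto simp: nb_def)
  ultimately show ?thesis using a by (simp add: dg_def)
qed

lemma dg_minus_self: "dg (W - {v}) v = dg W v"
proof -
  have "nb (W - {v}) v = nb W v" by (auto simp: nb_def)
  then show ?thesis by (simp add: dg_def)
qed

lemma dg_less_card: "finite W \<Longrightarrow> v \<in> W \<Longrightarrow> dg W v < card W"
proof -
  assume a: "finite W" "v \<in> W"
  have "v \<notin> nb W v" by (simp add: nb_def)
  then have "nb W v \<subset> W" using a nb_subset by blast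
  then show ?thesis using a unfolding dg_def by (simp add: psubset_card_mono)
qed

lemma finite_edges_in [simp]: "finite W \<Longrightarrow> finite {e \<in> E. e \<subseteq> W}"
  by (rule finite_subset[of _ "Pow W"]) auto

lemma ne_mono: "W \<subseteq> W' \<Longrightarrow> finite W' \<Longrightarrow> ne W \<le> ne W'"
  unfolding ne_def by (intro card_mono) auto

lemma ne_insert:
  assumes "finite W" "x \<notin> W" shows "ne (insert x W) = ne W + dg W x"
proof -
  let ?f = "\<lambda>u. {x, u}"
  have "{e \<in> E. e \<subseteq> insert x W} = {e \<in> E. e \<subseteq> W} \<union> ?f ` nb W x" (is "?A = ?B")
  proof
    show "?A \<subseteq> ?B"
    proof
      fix e assume e: "e \<in> ?A"
      then obtain u v where "e = {u, v}" "u \<noteq> v" "adj u v" using edgeE by blast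
      then show "e \<in> ?B" using e adj_sym[of u v]
        by (cases "u = x"; cases "v = x") (auto simp: nb_def insert_commute)
    qed
    show "?B \<subseteq> ?A" by (auto simp: nb_def adj_def)
  qed
  moreover have "{e \<in> E. e \<subseteq> W} \<inter> ?f ` nb W x = {}" using assms by auto
  moreover have "inj_on ?f (nb W x)" using assms by (auto simp: inj_on_def nb_def doubleton_eq_iff)
  ultimately show ?thesis using assms
    by (simp add: ne_def dg_def card_Un_disjoint card_image)
qed

lemma ne_remove:
  assumes "finite W" "x \<in> W" shows "ne W = ne (W - {x}) + dg W x"
  using ne_insert[of "W - {x}" x] assms by (simp add: insert_absorb dg_minus_self)

lemma empty_notin [simp]: "{} \<notin> E"
  using card2[of "{}"] by auto

lemma ne_empty [simp]: "ne {} = 0"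
  by (auto simp: ne_def)

lemma handshake: "finite W \<Longrightarrow> (\<Sum>v\<in>W. dg W v) = 2 * ne W"
proof (induction W rule: finite_induct)
  case (insert x W)
  have "(\<Sum>v\<in>W. dg (insert x W) v) = (\<Sum>v\<in>W. dg W v + (if adj v x then 1 else 0))"
    using insert by (intro sum.cong refl) (simp add: dg_insert)
  also have "\<dots> = 2 * ne W + card {v \<in> W. adj v x}"
    using insert by (simp add: sum.distrib sum.If_cases Int_def)
  also have "{v \<in> W. adj v x} = nb W x" by (auto simp: nb_def adj_sym)
  finally show ?case using insert by (simp add: ne_insert dg_insert dg_def[symmetric])
qed simp

lemma ne_bound_dg:
  assumes "finite W" "\<And>v. v \<in> W \<Longrightarrow> dg W v \<le> d" shows "2 * ne W \<le> d * card W"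
proof -
  have "(\<Sum>v\<in>W. dg W v) \<le> (\<Sum>v\<in>W. d)" using assms by (intro sum_mono) auto
  then show ?thesis using handshake[OF assms(1)] by (simp add: mult.commute)
qed

lemma ne_bound_card: "finite W \<Longrightarrow> 2 * ne W \<le> (card W - 1) * card W"
  by (intro ne_bound_dg) (auto dest: dg_less_card)

lemma ne_closed:
  assumes "finite W" "X \<subseteq> W" "\<And>x y. x \<in> X \<Longrightarrow> y \<in> W - X \<Longrightarrow> \<not> adj x y"
  shows "ne W = ne X + ne (W - X)"
proof -
  have "{e \<in> E. e \<subseteq> W} = {e \<in> E. e \<subseteq> X} \<union> {e \<in> E. e \<subseteq> W - X}" (is "?A = ?B")
  proof
    show "?A \<subseteq> ?B"
    proof
      fix e assume e: "e \<in> ?A"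
      then obtain u v where "e = {u, v}" "u \<noteq> v" "adj u v" using edgeE by blast
      then show "e \<in> ?B" using e assms(3)[of u v] assms(3)[of v u] adj_sym[of u v] by auto
    qed
  qed (use assms in auto)
  moreover have "{e \<in> E. e \<subseteq> X} \<inter> {e \<in> E. e \<subseteq> W - X} = {}"
  proof -
    have "e = {}" if "e \<subseteq> X" "e \<subseteq> W - X" for e using that by auto
    then show ?thesis using empty_notin by blast
  qed
  moreover have "finite X" using assms finite_subset by blast
  ultimately show ?thesis using assms by (simp add: ne_def card_Un_disjoint)
qed

lemma ne_delete_le:
  assumes "finite X" "finite W" "\<And>x. x \<in> X \<inter> W \<Longrightarrow> dg W x \<le> d"
  shows "ne W \<le> ne (W - X) + d * card X"
  using assms
proof (induction X arbitrary: W rule: finite_induct)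
  case (insert x X)
  have i: "dg (W - {x}) y \<le> d" if "y \<in> X \<inter> (W - {x})" for y
    using insert.prems(2)[of y] dg_mono[of "W - {x}" W y] insert.prems(1) that by force
  have a: "ne (W - {x}) \<le> ne (W - {x} - X) + d * card X"
    using i insert.prems by (intro insert.IH) auto
  have b: "W - {x} - X = W - insert x X" by auto
  show ?case
  proof (cases "x \<in> W")
    case True
    then show ?thesis using a ne_remove[of W x] insert.prems(1) insert.prems(2)[of x] insert.hyps by (simp add: b)
  next
    case False
    then have "W - {x} = W" "W - insert x X = W - X" by auto
    then show ?thesis using a insert.hyps by simp
  qed
qed simp

section \<open>Paths and cycles as vertex lists\<close>

lemma pth_simps [simp]: "pth []" "pth [x]" by (auto simp: pth_def)

lemma pth_Cons: "pth (x # xs) \<longleftrightarrow> x \<notin> set xs \<and> (xs = [] \<or> adj x (hd xs)) \<and> pth xs"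
  by (auto simp: pth_def successively_Cons)

lemma pth_append: "pth (xs @ ys) \<longleftrightarrow> pth xs \<and> pth ys \<and> set xs \<inter> set ys = {} \<and>
   (xs = [] \<or> ys = [] \<or> adj (last xs) (hd ys))"
  by (auto simp: pth_def successively_append_iff)

lemma pth_rev [simp]: "pth (rev xs) \<longleftrightarrow> pth xs"
  using adj_sym by (simp add: pth_def)

lemma no_pathD: "no_path l W \<Longrightarrow> pth xs \<Longrightarrow> set xs \<subseteq> W \<Longrightarrow> length xs < l"
  by (auto simp: no_path_def)

lemma no_path_mono: "no_path l W \<Longrightarrow> W' \<subseteq> W \<Longrightarrow> no_path l W'"
  by (auto simp: no_path_def)

lemma pth_take: "pth xs \<Longrightarrow> pth (take n xs)"
  by (metis append_take_drop_id pth_append)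

lemma no_path_iff: "no_path l W \<longleftrightarrow> \<not> (\<exists>xs. pth xs \<and> set xs \<subseteq> W \<and> length xs = l)"
proof -
  have "\<exists>ys. pth ys \<and> set ys \<subseteq> W \<and> length ys = l" if "pth xs" "set xs \<subseteq> W" "\<not> length xs < l" for xs
    using that by (intro exI[of _ "take l xs"]) (auto simp: pth_take dest: in_set_takeD)
  then show ?thesis unfolding no_path_def by (meson less_irrefl)
qed

lemma pth_card: "pth xs \<Longrightarrow> card (set xs) = length xs"
  by (simp add: pth_def distinct_card)

lemma pth_length_le: "finite W \<Longrightarrow> pth xs \<Longrightarrow> set xs \<subseteq> W \<Longrightarrow> length xs \<le> card W"
  by (metis card_mono pth_card)

lemma cyc_rotate1: "cyc xs \<Longrightarrow> cyc (rotate1 xs)"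
  by (cases xs) (auto simp: cyc_def pth_append pth_Cons split: if_splits)

lemma cyc_rotate: "cyc xs \<Longrightarrow> cyc (rotate n xs)"
  by (induction n) (auto simp: cyc_rotate1)

lemma cyc_hd_at:
  assumes "cyc xs" "x \<in> set xs"
  obtains ys where "cyc ys" "set ys = set xs" "length ys = length xs" "hd ys = x"
proof -
  obtain i where i: "i < length xs" "xs ! i = x" using assms by (auto simp: in_set_conv_nth)
  have "hd (rotate i xs) = x" using i by (subst hd_rotate_conv_nth) (use assms in \<open>auto simp: cyc_def\<close>)
  then show ?thesis using that[of "rotate i xs"] cyc_rotate[OF assms(1)] by simp
qed

lemma cyc_extend:
  assumes "cyc xs" "x \<in> set xs" "adj x y" "y \<notin> set xs"
  obtains ys where "pth ys" "set ys = insert y (set xs)" "length ys = Suc (length xs)" "hd ys = y"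
proof -
  obtain zs where "cyc zs" "set zs = set xs" "length zs = length xs" "hd zs = x"
    using cyc_hd_at assms by metis
  then show ?thesis using that[of "y # zs"] assms(3,4) by (auto simp: cyc_def pth_Cons adj_sym)
qed

lemma cyc_pth: "cyc xs \<Longrightarrow> pth xs" by (simp add: cyc_def)

lemma cyc_closed:
  assumes "cyc xs" "no_path (Suc (length xs)) W" "set xs \<subseteq> W" "x \<in> set xs" "y \<in> W - set xs"
  shows "\<not> adj x y"
proof
  assume "adj x y"
  then obtain ys where "pth ys" "set ys = insert y (set xs)" "length ys = Suc (length xs)" "hd ys = y"
    using cyc_extend assms by (metis Diff_iff)
  then show False using no_pathD[OF assms(2), of ys] assms by auto
qed

text \<open>By pigeonhole, some neighbour of the first end immediately follows a neighbour of the last end.\<close>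

lemma ore_cycle:
  assumes p: "pth xs" and ne: "xs \<noteq> []"
    and deg: "length xs \<le> dg (set xs) (hd xs) + dg (set xs) (last xs)"
  obtains ys where "cyc ys" "set ys = set xs" "length ys = length xs"
proof -
  let ?L = "length xs"
  define I where "I = {i. i < ?L - 1 \<and> adj (hd xs) (xs ! Suc i)}"
  define J where "J = {i. i < ?L - 1 \<and> adj (last xs) (xs ! i)}"
  have h: "hd xs = xs ! 0" "last xs = xs ! (?L - 1)" using ne by (auto simp: hd_conv_nth last_conv_nth)
  have "nb (set xs) (hd xs) \<subseteq> (\<lambda>i. xs ! Suc i) ` I"
  proof
    fix u assume u: "u \<in> nb (set xs) (hd xs)"
    then obtain i where i: "i < ?L" "u = xs ! i" by (auto simp: nb_def in_set_conv_nth)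
    then obtain j where "i = Suc j" using u h(1) by (cases i) (auto simp: nb_def)
    then show "u \<in> (\<lambda>i. xs ! Suc i) ` I" using u i by (auto simp: I_def nb_def)
  qed
  moreover have fI: "finite I" unfolding I_def by auto
  ultimately have cI: "dg (set xs) (hd xs) \<le> card I" unfolding dg_def
    by (meson card_image_le card_mono finite_imageI le_trans)
  have "nb (set xs) (last xs) \<subseteq> (\<lambda>i. xs ! i) ` J"
  proof
    fix u assume u: "u \<in> nb (set xs) (last xs)"
    then obtain i where i: "i < ?L" "u = xs ! i" by (auto simp: nb_def in_set_conv_nth)
    then have "i \<noteq> ?L - 1" using u h(2) by (auto simp: nb_def)
    then show "u \<in> (\<lambda>i. xs ! i) ` J" using u i by (auto simp: J_def nb_def)
  qed
  moreover have fJ: "finite J" unfolding J_def by auto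
  ultimately have cJ: "dg (set xs) (last xs) \<le> card J" unfolding dg_def
    by (meson card_image_le card_mono finite_imageI le_trans)
  have "I \<inter> J \<noteq> {}"
  proof
    assume "I \<inter> J = {}"
    then have "card I + card J = card (I \<union> J)" using fI fJ by (simp add: card_Un_disjoint)
    also have "\<dots> \<le> card {..<?L - 1}" by (intro card_mono) (auto simp: I_def J_def)
    finally show False using cI cJ deg ne by (cases xs) auto
  qed
  then obtain i where i: "i < ?L - 1" "adj (hd xs) (xs ! Suc i)" "adj (last xs) (xs ! i)"
    by (auto simp: I_def J_def)
  define a b where "a = take (Suc i) xs" and "b = drop (Suc i) xs"
  have ab: "xs = a @ b" "a \<noteq> []" "b \<noteq> []" using i by (auto simp: a_def b_def)
  have la: "last a = xs ! i" using i by (simp add: a_def take_Suc_conv_app_nth)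
  have hb: "hd b = xs ! Suc i" using i by (simp add: b_def hd_drop_conv_nth)
  have lb: "last b = last xs" "hd a = hd xs" using ab by auto
  have "pth a" "pth b" "set a \<inter> set b = {}" using p unfolding ab(1) pth_append by auto
  moreover have "adj (last a) (last b)" using i la lb adj_sym by metis
  ultimately have "pth (a @ rev b)" using ab by (auto simp: pth_append hd_rev)
  moreover have "adj (last (a @ rev b)) (hd (a @ rev b))"
    using ab(2,3) i(2) hb lb(2) adj_sym by (simp add: last_rev)
  ultimately have "cyc (a @ rev b)" using ab by (simp add: cyc_def)
  then show ?thesis using that[of "a @ rev b"] ab(1) by auto
qed

text \<open>Paths in a finite set have bounded length. All choices of longest paths, cycles and ears
  below go through this lemma.\<close>

lemma longest_list:
  assumes "finite W" "P xs0" "\<And>xs. P xs \<Longrightarrow> pth xs \<and> set xs \<subseteq> W"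
  obtains xs where "P xs" "\<And>ys. P ys \<Longrightarrow> length ys \<le> length xs"
proof -
  have "\<exists>xs. P xs \<and> (\<forall>ys. P ys \<longrightarrow> length ys \<le> length xs)"
    using assms pth_length_le[OF assms(1)]
    by (intro ex_has_greatest_nat[of P _ length "Suc (card W)"]) (auto simp: less_Suc_eq_le)
  then show ?thesis using that by blast
qed

text \<open>All neighbours of the ends of a longest path lie on it, so the two end degrees sum to at
  least \<open>2 * m\<close>, hence to at least the number of its vertices, and
  \<open>ore_cycle\<close> applies. An edge leaving the cycle would give a longer path, so the cycle
  spans a component.\<close>

lemma min_degree_cycle:
  assumes W: "finite W" "W \<noteq> {}" and d: "\<And>v. v \<in> W \<Longrightarrow> m \<le> dg W v" and np: "no_path (2 * m + 1) W"
  obtains xs where "cyc xs" "set xs \<subseteq> W" "\<And>x y. x \<in> set xs \<Longrightarrow> y \<in> W - set xs \<Longrightarrow> \<not> adj x y"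
    "m + 1 \<le> length xs" "length xs \<le> 2 * m"
proof -
  obtain w where w: "w \<in> W" using W by auto
  obtain xs where xs: "pth xs \<and> set xs \<subseteq> W \<and> xs \<noteq> []"
    and mx: "\<And>ys. pth ys \<and> set ys \<subseteq> W \<and> ys \<noteq> [] \<Longrightarrow> length ys \<le> length xs"
    using longest_list[OF W(1), of "\<lambda>xs. pth xs \<and> set xs \<subseteq> W \<and> xs \<noteq> []" "[w]"] w by auto
  \<comment> \<open>Stated for every path on the same vertices, so that it also covers the reversed
    path, whose head is the other end.\<close>
  have ends: "dg (set ys) (hd ys) \<ge> m" if "pth ys" "set ys = set xs" for ys
  proof -
    have ne: "ys \<noteq> []" using that xs by auto
    have len: "length ys = length xs" using that xs pth_card by metis
    have "nb W (hd ys) \<subseteq> nb (set ys) (hd ys)"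
    proof
      fix u assume u: "u \<in> nb W (hd ys)"
      have "u \<in> set ys"
      proof (rule ccontr)
        assume "u \<notin> set ys"
        then have "length (u # ys) \<le> length xs" using that u xs
          by (intro mx) (auto simp: pth_Cons nb_def adj_sym)
        then show False using len by simp
      qed
      then show "u \<in> nb (set ys) (hd ys)" using u by (auto simp: nb_def)
    qed
    then have "dg W (hd ys) \<le> dg (set ys) (hd ys)" unfolding dg_def by (intro card_mono) auto
    moreover have "hd ys \<in> W" using that xs ne by (metis hd_in_set subsetD)
    ultimately show ?thesis using d by force
  qed
  have "m \<le> dg (set xs) (hd xs)" "m \<le> dg (set xs) (last xs)"
    using ends[of xs] ends[of "rev xs"] xs by (auto simp: hd_rev)
  moreover have "length xs \<le> 2 * m" using np xs unfolding no_path_def by force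
  ultimately have "length xs \<le> dg (set xs) (hd xs) + dg (set xs) (last xs)" by linarith
  then obtain ys where ys: "cyc ys" "set ys = set xs" "length ys = length xs"
    using ore_cycle[of xs] xs by blast
  have cl: "\<not> adj x y" if "x \<in> set ys" "y \<in> W - set ys" for x y
  proof (rule cyc_closed[OF ys(1) _ _ that(1), of W])
    show "no_path (Suc (length ys)) W" unfolding no_path_def
      by (metis mx ys(3) le_imp_less_Suc list.size(3) zero_less_Suc)
  next
    show "set ys \<subseteq> W" using xs ys(2) by simp
    show "y \<in> W - set ys" by (rule that(2))
  qed
  have hw: "hd ys \<in> set ys" using ys(1) by (simp add: cyc_def)
  have "nb W (hd ys) \<subseteq> set ys - {hd ys}"
    using cl[OF hw] by (auto simp: nb_def)
  then have "dg W (hd ys) \<le> card (set ys - {hd ys})" unfolding dg_def by (intro card_mono) auto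
  also have "\<dots> = length ys - 1" using hw pth_card[OF cyc_pth[OF ys(1)]] by simp
  finally have "dg W (hd ys) \<le> length ys - 1" .
  moreover have "hd ys \<in> W" using hw ys(2) xs by auto
  ultimately have "m \<le> length ys - 1" using d by fastforce
  moreover have "ys \<noteq> []" using ys(1) by (simp add: cyc_def)
  ultimately have "m + 1 \<le> length ys" by (cases ys) auto
  moreover have "set ys \<subseteq> W" using xs ys(2) by simp
  moreover have "length ys \<le> 2 * m" using ys(3) \<open>length xs \<le> 2 * m\<close> by simp
  ultimately show ?thesis using that[of ys] ys(1) cl by blast
qed

end

section \<open>Extremal numbers of odd paths\<close>

context two_graph
begin

text \<open>Deleting a vertex of degree below m costs at most m - 1 edges, and in a component with
  fewer than 2m vertices all degrees are at most 2(m - 1). So only components on exactly 2m vertices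
  exceed the rate of m - 1 edges per vertex. The set \<open>R\<close> records them, because
  \<open>near_full\<close> needs the components themselves and not just their number.\<close>

lemma dense_components:
  assumes "finite W" "no_path (2 * m + 1) W" "m \<ge> 1"
  shows "\<exists>R. finite R \<and> pairwise disjnt R \<and>
    (\<forall>X\<in>R. \<exists>xs. cyc xs \<and> set xs = X \<and> X \<subseteq> W \<and> length xs = 2 * m) \<and>
    2 * ne W \<le> 2 * (m - 1) * card W + 2 * m * card R"
  using assms
proof (induction W rule: finite_psubset_induct)
  case (psubset W)
  show ?case
  proof (cases "\<exists>v\<in>W. dg W v < m")
    case True
    then obtain v where v: "v \<in> W" "dg W v < m" by auto
    have "W - {v} \<subset> W" "no_path (2 * m + 1) (W - {v})"
      using v psubset.prems no_path_mono by auto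
    then obtain R where R: "finite R" "pairwise disjnt R"
      "\<forall>X\<in>R. \<exists>xs. cyc xs \<and> set xs = X \<and> X \<subseteq> W - {v} \<and> length xs = 2 * m"
      "2 * ne (W - {v}) \<le> 2 * (m - 1) * card (W - {v}) + 2 * m * card R"
      using psubset.IH[of "W - {v}"] psubset.prems(2) by blast
    have "2 * dg W v \<le> 2 * (m - 1)" using v by simp
    moreover have "card W = Suc (card (W - {v}))" using v psubset.hyps by (metis card.remove)
    then have "2 * (m - 1) * card W = 2 * (m - 1) * card (W - {v}) + 2 * (m - 1)" by simp
    ultimately have "2 * ne W \<le> 2 * (m - 1) * card W + 2 * m * card R"
      using R(4) ne_remove[OF psubset.hyps v(1)] by linarith
    moreover have "\<forall>X\<in>R. \<exists>xs. cyc xs \<and> set xs = X \<and> X \<subseteq> W \<and> length xs = 2 * m"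
      using R(3) by (meson Diff_subset subset_trans)
    ultimately show ?thesis using R(1,2) by (intro exI[of _ R]) simp
  next
    case False
    show ?thesis
    proof (cases "W = {}")
      case True
      then show ?thesis by (intro exI[of _ "{}"]) auto
    next
      case ne: False
      from False have "\<And>v. v \<in> W \<Longrightarrow> m \<le> dg W v" by force
      then obtain xs where xs: "cyc xs" "set xs \<subseteq> W" "\<And>x y. x \<in> set xs \<Longrightarrow> y \<in> W - set xs \<Longrightarrow> \<not> adj x y"
        "m + 1 \<le> length xs" "length xs \<le> 2 * m"
        using min_degree_cycle[OF psubset.hyps ne _ psubset.prems(1)] by blast
      let ?X = "set xs"
      have Xne: "?X \<noteq> {}" using xs(4) by auto
      have "hd xs \<in> ?X" using xs(4) by (intro hd_in_set) auto
      then have "W - ?X \<noteq> W" using xs(2) by fastforce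
      then have "W - ?X \<subset> W" by auto
      moreover have "no_path (2 * m + 1) (W - ?X)" using no_path_mono[OF psubset.prems(1)] by simp
      ultimately obtain R where R: "finite R" "pairwise disjnt R"
        "\<forall>X\<in>R. \<exists>xs. cyc xs \<and> set xs = X \<and> X \<subseteq> W - ?X \<and> length xs = 2 * m"
        "2 * ne (W - ?X) \<le> 2 * (m - 1) * card (W - ?X) + 2 * m * card R"
        using psubset.IH[of "W - ?X"] psubset.prems(2) by blast
      have eW: "ne W = ne ?X + ne (W - ?X)" using ne_closed psubset.hyps xs(2,3) by blast
      have cX: "card ?X = length xs" using xs(1) pth_card cyc_pth by blast
      have cW: "card W = length xs + card (W - ?X)"
        using psubset.hyps xs(2) by (simp add: card_Diff_subset card_mono flip: cX)
      have eX: "2 * ne ?X \<le> (length xs - 1) * length xs" using ne_bound_card[of ?X] cX by simp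
      show ?thesis
      proof (cases "length xs = 2 * m")
        case True
        have d: "X \<inter> ?X = {}" if "X \<in> R" for X using R(3) that by blast
        have nX: "?X \<notin> R" using d[of ?X] Xne by auto
        \<comment> \<open>The bound 2m(2m - 1) is 2m more than the rate 2(m - 1) on 2m vertices;
          this excess pays for the new member of \<open>R\<close>.\<close>
        have "2 * ne W \<le> (2 * m - 1) * (2 * m) + (2 * (m - 1) * card (W - ?X) + 2 * m * card R)"
          using eW eX R(4) True by simp
        also have "\<dots> = 2 * (m - 1) * card W + 2 * m * card (insert ?X R)"
          using cW True R(1) nX psubset.prems(2) by (cases m) (auto simp: algebra_simps)
        finally have "2 * ne W \<le> 2 * (m - 1) * card W + 2 * m * card (insert ?X R)" .
        moreover have "pairwise disjnt (insert ?X R)"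
          using R(2) d by (auto simp: pairwise_insert disjnt_def)
        moreover have "\<forall>X\<in>insert ?X R. \<exists>xs. cyc xs \<and> set xs = X \<and> X \<subseteq> W \<and> length xs = 2 * m"
          using R(3) xs(1,2) True by (metis Diff_subset insert_iff subset_trans)
        ultimately show ?thesis using R(1) by (intro exI[of _ "insert ?X R"]) simp
      next
        case False
        then have "length xs - 1 \<le> 2 * (m - 1)" using xs(5) by simp
        then have "(length xs - 1) * length xs \<le> 2 * (m - 1) * length xs" by (rule mult_le_mono1)
        then have "2 * ne W \<le> 2 * (m - 1) * length xs + (2 * (m - 1) * card (W - ?X) + 2 * m * card R)"
          using eW eX R(4) by linarith
        then have "2 * ne W \<le> 2 * (m - 1) * card W + 2 * m * card R"
          by (simp add: cW add_mult_distrib2)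
        moreover have "\<forall>X\<in>R. \<exists>xs. cyc xs \<and> set xs = X \<and> X \<subseteq> W \<and> length xs = 2 * m"
          using R(3) by (meson Diff_subset subset_trans)
        ultimately show ?thesis using R(1,2) by (intro exI[of _ R]) simp
      qed
    qed
  qed
qed

text \<open>The members of \<open>R\<close> are disjoint sets of 2m vertices, so their total excess
  is at most the size of \<open>W\<close>.\<close>

lemma erdos_gallai:
  assumes "finite W" "no_path (2 * m + 1) W" "m \<ge> 1"
  shows "2 * ne W \<le> (2 * m - 1) * card W"
proof -
  obtain R where R: "finite R" "pairwise disjnt R"
    "\<forall>X\<in>R. \<exists>xs. cyc xs \<and> set xs = X \<and> X \<subseteq> W \<and> length xs = 2 * m"
    "2 * ne W \<le> 2 * (m - 1) * card W + 2 * m * card R"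
    using dense_components[OF assms] by blast
  have cR: "card X = 2 * m" "X \<subseteq> W" if "X \<in> R" for X
    using R(3) that pth_card cyc_pth by metis+
  then have "card (\<Union>R) = (\<Sum>X\<in>R. 2 * m)"
    using R(2) by (subst card_Union_disjoint) (auto intro: finite_subset[OF _ assms(1)] sum.cong)
  moreover have "card (\<Union>R) \<le> card W" using cR(2) assms(1) by (intro card_mono) auto
  ultimately have "2 * m * card R \<le> card W" by (simp add: mult.commute)
  then have "2 * ne W \<le> 2 * (m - 1) * card W + card W" using R(4) by linarith
  also have "\<dots> = (2 * m - 1) * card W" using assms(3) by (cases m) auto
  finally show ?thesis .
qed

text \<open>Greedy passage to the m-core, stopped at m vertices: the core may be empty, while the
  estimate for the peeled graph in \<open>faudree_schelp\<close> wants at least m vertices to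
  remain.\<close>

lemma peel:
  assumes "finite W" "m \<le> card W"
  shows "\<exists>D\<subseteq>W. m \<le> card D \<and> ne W \<le> ne D + (m - 1) * (card W - card D) \<and>
    (card D = m \<or> (\<forall>v\<in>D. m \<le> dg D v))"
  using assms
proof (induction W rule: finite_psubset_induct)
  case (psubset W)
  show ?case
  proof (cases "card W = m \<or> (\<forall>v\<in>W. m \<le> dg W v)")
    case True
    then show ?thesis using psubset.prems by (intro exI[of _ W]) auto
  next
    case False
    then obtain v where v: "v \<in> W" "dg W v < m" by force
    have c: "card W = Suc (card (W - {v}))" using v psubset.hyps by (metis card.remove)
    have sub: "W - {v} \<subset> W" "m \<le> card (W - {v})" using c v(1) False psubset.prems by auto
    obtain D where D: "D \<subseteq> W - {v}" "m \<le> card D"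
      "ne (W - {v}) \<le> ne D + (m - 1) * (card (W - {v}) - card D)"
      "card D = m \<or> (\<forall>v\<in>D. m \<le> dg D v)"
      using psubset.IH[OF sub] by (elim exE conjE) simp
    have "card D \<le> card (W - {v})" using D(1) psubset.hyps by (intro card_mono) auto
    then have "card W - card D = Suc (card (W - {v}) - card D)" using c by simp
    then have "(m - 1) * (card W - card D) = (m - 1) * (card (W - {v}) - card D) + (m - 1)" by simp
    moreover have "dg W v \<le> m - 1" using v by simp
    ultimately have "ne W \<le> ne D + (m - 1) * (card W - card D)"
      using D(3) ne_remove[OF psubset.hyps v(1)] by linarith
    moreover have "D \<subseteq> W" using D(1) by auto
    ultimately show ?thesis using D(2,4) by (intro exI[of _ D]) simp
  qed
qed

text \<open>Connectedness by cuts. A minimal counterexample has this property because both sides of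
  an empty cut satisfy the bound, and it yields boundary edges directly.\<close>

definition conn :: "'a set \<Rightarrow> bool" where
  "conn W \<longleftrightarrow> (\<forall>X\<subseteq>W. X \<noteq> {} \<longrightarrow> X \<noteq> W \<longrightarrow> (\<exists>x\<in>X. \<exists>y\<in>W - X. adj x y))"

lemma cyc_last_at:
  assumes "cyc xs" "x \<in> set xs"
  obtains ys where "cyc ys" "set ys = set xs" "length ys = length xs" "last ys = x"
proof -
  obtain ys where "cyc ys" "set ys = set xs" "length ys = length xs" "hd ys = x"
    using cyc_hd_at[OF assms] .
  then show ?thesis using that[of "rotate1 ys"] cyc_rotate1[of ys]
    by (cases ys) (auto simp: cyc_def)
qed

text \<open>Run around the first cycle, leave it towards the second, and run around that one from
  the point of entry.\<close>

lemma link_cycles: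
  assumes conn: "conn W" and xs: "cyc xs" "set xs \<subseteq> W" and ys: "cyc ys" "set ys \<subseteq> W"
    and dj: "set xs \<inter> set ys = {}"
  obtains zs where "pth zs" "set zs \<subseteq> W" "length xs + length ys \<le> length zs"
proof -
  \<comment> \<open>Ends of paths that begin with a full turn of the first cycle and have not
    touched the second. An edge leaving this set can only lead into \<open>ys\<close>.\<close>
  define S where "S = {v. \<exists>xs' q. cyc xs' \<and> set xs' = set xs \<and> length xs' = length xs \<and>
     pth (xs' @ q) \<and> set q \<subseteq> W - set ys \<and> last (xs' @ q) = v}"
  have nx: "xs \<noteq> []" and ny: "ys \<noteq> []" using xs ys by (auto simp: cyc_def)
  have Ssub: "S \<subseteq> W - set ys"
  proof
    fix v assume "v \<in> S"
    then obtain xs' q where q: "set xs' = set xs" "length xs' = length xs" "set q \<subseteq> W - set ys" "last (xs' @ q) = v"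
      by (auto simp: S_def)
    then have "v \<in> set (xs' @ q)" using nx by (metis append_is_Nil_conv last_in_set length_0_conv)
    then show "v \<in> W - set ys" using q(1,3) xs(2) dj by auto
  qed
  have xS: "set xs \<subseteq> S"
  proof
    fix v assume v: "v \<in> set xs"
    obtain xs' where "cyc xs'" "set xs' = set xs" "length xs' = length xs" "last xs' = v"
      using cyc_last_at[OF xs(1) v] .
    then show "v \<in> S" unfolding S_def using cyc_pth by (intro CollectI exI[of _ xs'] exI[of _ "[]"]) auto
  qed
  have "S \<noteq> {}" using xS nx by auto
  moreover have "S \<noteq> W" using Ssub ys(2) ny by (cases ys) auto
  moreover have "S \<subseteq> W" using Ssub by auto
  ultimately obtain v y where vy: "v \<in> S" "y \<in> W - S" "adj v y" using conn unfolding conn_def by meson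
  obtain xs' q where q: "cyc xs'" "set xs' = set xs" "length xs' = length xs"
     "pth (xs' @ q)" "set q \<subseteq> W - set ys" "last (xs' @ q) = v"
    using vy(1) by (auto simp: S_def)
  have "y \<in> set ys"
  proof (rule ccontr)
    assume y: "y \<notin> set ys"
    have "y \<notin> set xs" using xS vy(2) by auto
    \<comment> \<open>If \<open>y\<close> lay on \<open>q\<close>, the path cut off at
      \<open>y\<close> would already show that \<open>y\<close> is in \<open>S\<close>.\<close>
    moreover have "y \<notin> set q"
    proof
      assume "y \<in> set q"
      then obtain q1 q2 where s: "q = q1 @ y # q2" by (auto simp: in_set_conv_decomp)
      have "xs' @ q = (xs' @ q1 @ [y]) @ q2" by (simp add: s)
      then have "pth (xs' @ q1 @ [y])" using q(4) pth_append by metis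
      then have "y \<in> S" unfolding S_def using q s by (intro CollectI exI[of _ xs'] exI[of _ "q1 @ [y]"]) auto
      then show False using vy by auto
    qed
    ultimately have "pth ((xs' @ q) @ [y])" unfolding pth_append[of "xs' @ q"] using q vy by auto
    then have "y \<in> S" unfolding S_def using q y vy by (intro CollectI exI[of _ xs'] exI[of _ "q @ [y]"]) auto
    then show False using vy by auto
  qed
  then obtain ys' where ys': "cyc ys'" "set ys' = set ys" "length ys' = length ys" "hd ys' = y"
    using cyc_hd_at[OF ys(1)] by blast
  have "pth ((xs' @ q) @ ys')" unfolding pth_append[of "xs' @ q"]
    using q ys' vy dj cyc_pth by auto
  then show ?thesis using that[of "(xs' @ q) @ ys'"] q ys' xs ys by auto
qed

lemma card_nth_filter: "distinct xs \<Longrightarrow> card {i. i < length xs \<and> P (xs ! i)} = card {x \<in> set xs. P x}"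
proof -
  assume d: "distinct xs"
  have "{x \<in> set xs. P x} = (\<lambda>i. xs ! i) ` {i. i < length xs \<and> P (xs ! i)}"
    by (auto simp: in_set_conv_nth)
  moreover have "inj_on (\<lambda>i. xs ! i) {i. i < length xs \<and> P (xs ! i)}"
    using d by (auto simp: inj_on_def nth_eq_iff_index_eq)
  ultimately show ?thesis by (simp add: card_image)
qed

text \<open>Here j is what the core lacks to 2m vertices. Cycle and ear have at most 2m vertices
  together, so if the ear has p vertices, the cycle has at most j - p vertices outside
  \<open>D\<close>. Each end of the ear has at least j + 2 - p neighbours on the cycle, and so at
  least two of them are followed by core vertices.\<close>

lemma no_dense_core:
  assumes W: "finite W" "2 * m + 1 \<le> card W" "conn W" "no_path (2 * m + 1) W"
    and deg: "\<And>v. v \<in> W \<Longrightarrow> j + 1 \<le> dg W v"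
    and D: "D \<subseteq> W" "\<And>v. v \<in> D \<Longrightarrow> m \<le> dg D v" "card D + j = 2 * m"
    and c: "cyc zs0" "set zs0 = D"
  shows False
proof -
  have finD: "finite D" using D W finite_subset by auto
  define C where "C = (\<lambda>ys. cyc ys \<and> D \<subseteq> set ys \<and> set ys \<subseteq> W)"
  have "C zs0" "\<And>xs. C xs \<Longrightarrow> pth xs \<and> set xs \<subseteq> W" using c D(1) cyc_pth by (auto simp: C_def)
  then obtain zs where "C zs" and mx: "\<And>ys. C ys \<Longrightarrow> length ys \<le> length zs"
    using longest_list[OF W(1), of C zs0] by blast
  then have zs: "cyc zs" "D \<subseteq> set zs" "set zs \<subseteq> W" by (auto simp: C_def)
  let ?Z = "set zs" let ?n = "length zs"
  have nz: "zs \<noteq> []" using zs by (auto simp: cyc_def)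
  have cZ: "card ?Z = ?n" using zs pth_card cyc_pth by blast
  have "?n < 2 * m + 1" using W(4) zs cyc_pth no_pathD by blast
  then have "?Z \<noteq> W" using cZ W(2) by auto
  then obtain x0 y0 where x0: "x0 \<in> ?Z" "y0 \<in> W - ?Z" "adj x0 y0"
    using W(3) zs(3) nz unfolding conn_def by (metis set_empty)
  define P where "P = (\<lambda>ys. pth ys \<and> ys \<noteq> [] \<and> set ys \<subseteq> W - ?Z \<and> (\<exists>x\<in>?Z. adj x (hd ys)))"
  have P0: "P [y0]" using x0 by (auto simp: P_def)
  obtain ys where ys: "P ys" and mxy: "\<And>xs. P xs \<Longrightarrow> length xs \<le> length ys"
    using longest_list[of W P "[y0]"] W(1) P0 unfolding P_def by auto
  let ?p = "length ys"
  have len: "?n + ?p \<le> 2 * m"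
  proof -
    obtain x where x: "x \<in> ?Z" "adj x (hd ys)" using ys by (auto simp: P_def)
    obtain zs' where z: "cyc zs'" "set zs' = ?Z" "length zs' = ?n" "last zs' = x"
      using cyc_last_at[OF zs(1) x(1)] .
    have "pth (zs' @ ys)" using z x ys cyc_pth by (auto simp: pth_append P_def)
    moreover have "set (zs' @ ys) \<subseteq> W" using z ys zs by (auto simp: P_def)
    ultimately have "length (zs' @ ys) < 2 * m + 1" using W(4) no_pathD by blast
    then show ?thesis using z by simp
  qed
  \<comment> \<open>A longest ear cannot be extended, so the neighbours of its last vertex lie on
    the ear or on the cycle. The claim covers all longest ears, as it is needed for the reversed ear
    too.\<close>
  have many: "j + 2 \<le> ?p + dg ?Z (last ws)" if "P ws" "length ws = ?p" for ws
  proof -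
    have wn: "ws \<noteq> []" "pth ws" and wW: "set ws \<subseteq> W - ?Z" using that by (auto simp: P_def)
    have "nb W (last ws) \<subseteq> (set ws - {last ws}) \<union> nb ?Z (last ws)"
    proof
      fix u assume u: "u \<in> nb W (last ws)"
      show "u \<in> (set ws - {last ws}) \<union> nb ?Z (last ws)"
      proof (cases "u \<in> ?Z \<or> u \<in> set ws")
        case True
        then show ?thesis using u by (auto simp: nb_def)
      next
        case False
        then have "P (ws @ [u])" using that(1) u by (auto simp: P_def pth_append nb_def)
        then show ?thesis using mxy[of "ws @ [u]"] that(2) by auto
      qed
    qed
    then have "dg W (last ws) \<le> card ((set ws - {last ws}) \<union> nb ?Z (last ws))"
      unfolding dg_def by (intro card_mono) auto
    also have "\<dots> \<le> card (set ws - {last ws}) + dg ?Z (last ws)"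
      unfolding dg_def by (rule card_Un_le)
    also have "card (set ws - {last ws}) = ?p - 1" using wn that(2) pth_card by auto
    finally have "dg W (last ws) \<le> ?p - 1 + dg ?Z (last ws)" .
    moreover have "last ws \<in> W" using wn wW last_in_set[of ws] by blast
    ultimately have "j + 1 \<le> ?p - 1 + dg ?Z (last ws)" using deg le_trans by blast
    moreover have "?p \<ge> 1" using wn(1) that(2) by (cases ws) auto
    ultimately show ?thesis by simp
  qed
  have yn: "ys \<noteq> []" "pth ys" and yW: "set ys \<subseteq> W - ?Z" using ys by (auto simp: P_def)
  have cD: "card D + card (?Z - D) = ?n"
    using zs(2) cZ card_mono[OF _ zs(2)] by (simp add: card_Diff_subset[OF finD])
  have L: "j + 2 \<le> ?p + dg ?Z (last ys)" using many ys by auto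
  \<comment> \<open>Since |D| + p <= 2m, the ear has at most j vertices. Hence its last vertex also
    sees the cycle, and the reversed list is an ear as well.\<close>
  then have "dg ?Z (last ys) > 0" using len D(3) cD by linarith
  then obtain x1 where "x1 \<in> nb ?Z (last ys)" unfolding dg_def by (metis card_gt_0_iff ex_in_conv)
  then have "P (rev ys)" using ys adj_sym by (auto simp: P_def hd_rev nb_def)
  then have H: "j + 2 \<le> ?p + dg ?Z (hd ys)" using many[of "rev ys"] yn by (simp add: last_rev)
  define I where "I y = {i. i < ?n \<and> adj y (zs ! i) \<and> rotate1 zs ! i \<in> D}" for y
  have Ic: "2 \<le> card (I y)" if "j + 2 \<le> ?p + dg ?Z y" for y
  proof -
    let ?B = "{i. i < ?n \<and> rotate1 zs ! i \<notin> D}"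
    have d: "distinct zs" using zs(1) by (simp add: cyc_def pth_def)
    have "card {i. i < ?n \<and> adj y (zs ! i)} = dg ?Z y"
      using card_nth_filter[OF d] by (simp add: dg_def nb_def)
    moreover have "card {i. i < ?n \<and> adj y (zs ! i)} \<le> card (I y \<union> ?B)"
      by (intro card_mono) (auto simp: I_def)
    moreover have "card (I y \<union> ?B) \<le> card (I y) + card ?B" by (rule card_Un_le)
    moreover have "card ?B = card {x \<in> ?Z. x \<notin> D}"
      using card_nth_filter[of "rotate1 zs" "\<lambda>x. x \<notin> D"] d by simp
    moreover have "{x \<in> ?Z. x \<notin> D} = ?Z - D" by auto
    ultimately show ?thesis using that len D(3) cD by simp
  qed
  have "card (I (hd ys)) \<ge> 2" "card (I (last ys)) \<ge> 2" using Ic H L by auto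
  then obtain i where i: "i \<in> I (hd ys)" by fastforce
  \<comment> \<open>The two positions must differ, since the cycle is cut behind each of
    them.\<close>
  have "\<not> I (last ys) \<subseteq> {i}"
    using \<open>card (I (last ys)) \<ge> 2\<close> card_mono[of "{i}" "I (last ys)"] by auto
  then obtain i' where i': "i' \<in> I (last ys)" "i' \<noteq> i" by auto
  have dz: "distinct zs" using zs(1) by (simp add: cyc_def pth_def)
  have ii: "i < ?n" "i' < ?n" using i i' by (auto simp: I_def)
  define zr where "zr = rotate (Suc i) zs"
  have zr: "cyc zr" unfolding zr_def by (rule cyc_rotate[OF zs(1)])
  have zr2: "set zr = ?Z" "length zr = ?n" by (auto simp: zr_def)
  have nth_zr: "zr ! q = zs ! ((Suc i + q) mod ?n)" if "q < ?n" for q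
    unfolding zr_def by (rule nth_rotate[OF that])
  have last_zr: "zr ! (?n - 1) = zs ! i"
  proof -
    have "Suc i + (?n - 1) = i + ?n" using ii by simp
    then have "(Suc i + (?n - 1)) mod ?n = i" using ii by (simp only: mod_add_self2 mod_less)
    then show ?thesis using nth_zr[of "?n - 1"] ii by simp
  qed
  obtain q where q: "q < ?n" "zr ! q = zs ! i'"
    using ii(2) zr2 by (metis in_set_conv_nth nth_mem)
  have mi: "(Suc i + q) mod ?n = i'" using q nth_zr[OF q(1)] ii dz
    by (metis mod_less_divisor nth_eq_iff_index_eq gr_implies_not0 not_gr0)
  have "q \<noteq> ?n - 1" using last_zr q i'(2) ii dz by (metis nth_eq_iff_index_eq)
  then have q': "Suc q < ?n" using q by simp
  have sucq: "zr ! Suc q = rotate1 zs ! i'"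
  proof -
    have "(Suc i + Suc q) mod ?n = Suc i' mod ?n" using mi mod_Suc_eq[of "Suc i + q" ?n] by simp
    then show ?thesis using nth_zr[OF q'] ii by (simp add: nth_rotate1)
  qed
  have hdz: "zr ! 0 = rotate1 zs ! i" using nth_zr[of 0] ii nz by (simp add: nth_rotate1)
  define a b where "a = take (Suc q) zr" and "b = drop (Suc q) zr"
  have ab: "zr = a @ b" "a \<noteq> []" "b \<noteq> []" using q' zr2(2) by (auto simp: a_def b_def)
  have la: "last a = zs ! i'" using q zr2(2) by (simp add: a_def take_Suc_conv_app_nth)
  have hb: "hd b = rotate1 zs ! i'" using q' zr2(2) sucq by (simp add: b_def hd_drop_conv_nth)
  have ha: "hd a = rotate1 zs ! i" using hdz ab(2) by (simp add: a_def hd_conv_nth)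
  have lb: "last b = zs ! i" using last_zr zr2(2) ab last_conv_nth[of zr] by (metis append_is_Nil_conv last_appendR)
  have pab: "pth a" "pth b" "set a \<inter> set b = {}" "set a \<union> set b = ?Z"
    using cyc_pth[OF zr] zr2(1) unfolding ab(1) pth_append by auto
  \<comment> \<open>From the successor of position \<open>i\<close> along \<open>a\<close> to
    position \<open>i'\<close>, through the ear backwards, and from position \<open>i\<close> along
    \<open>b\<close> backwards to the successor of \<open>i'\<close>. Both ends are core vertices
    with at least m neighbours in \<open>D\<close>, and there are at most 2m vertices, so
    \<open>ore_cycle\<close> gives a cycle longer than \<open>zs\<close>.\<close>
  define w where "w = a @ rev ys @ rev b"
  have adjs: "adj (last a) (last ys)" "adj (hd ys) (last b)"
    using i i' la lb adj_sym by (auto simp: I_def)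
  have pw: "pth w" unfolding w_def pth_append using pab yn yW ab(2,3) adjs
    by (auto simp: hd_rev last_rev hd_append)
  have sw: "set w = ?Z \<union> set ys" using pab(4) by (auto simp: w_def)
  have lw: "length w = ?n + ?p" using arg_cong[OF ab(1), of length] zr2(2) by (simp add: w_def)
  have wne: "w \<noteq> []" using ab by (simp add: w_def)
  have mw: "m \<le> dg (set w) v" if "v \<in> D" for v
  proof -
    have "D \<subseteq> set w" using zs(2) sw by blast
    then show ?thesis using D(2)[OF that] dg_mono[of D "set w" v] by simp
  qed
  have "hd w \<in> D" using ab(2) ha i by (simp add: w_def I_def)
  moreover have "last w \<in> D" using ab(3) hb i' by (simp add: w_def I_def last_rev)
  ultimately have "length w \<le> dg (set w) (hd w) + dg (set w) (last w)"
    using len lw mw[of "hd w"] mw[of "last w"] by linarith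
  then obtain u where u: "cyc u" "set u = set w" "length u = length w"
    using ore_cycle[OF pw wne] by metis
  have "length u \<le> ?n" using u sw zs yW by (intro mx) (auto simp: C_def)
  then show False using u lw yn by (cases ys) auto
qed

end

text \<open>Twice the number of edges of disjoint copies of \<open>K\<^bsub>2m\<^esub>\<close> and a clique on the remaining
  \<open>n mod 2m\<close> vertices.\<close>

definition fs_bound :: "nat \<Rightarrow> nat \<Rightarrow> int" where
  "fs_bound m n = (2 * int m - 1) * int n - int (n mod (2 * m)) * (2 * int m - int (n mod (2 * m)))"

text \<open>A remainder r costs r(2m - r). Merging remainders r and s saves 2rs, or 2(2m - r)(2m -
  s) if their sum reaches 2m.\<close>

lemma fs_bound_superadd:
  assumes "m \<ge> 1" shows "fs_bound m a + fs_bound m b \<le> fs_bound m (a + b)"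
proof -
  let ?M = "2 * m"
  define r s where "r = a mod ?M" and "s = b mod ?M"
  have rs: "r < ?M" "s < ?M" using assms by (auto simp: r_def s_def)
  have e: "(a + b) mod ?M = (r + s) mod ?M" by (simp add: r_def s_def mod_add_eq)
  have "int ((a + b) mod ?M) * (2 * int m - int ((a + b) mod ?M)) \<le>
     int r * (2 * int m - int r) + int s * (2 * int m - int s)"
  proof (cases "r + s < ?M")
    case True
    have "0 \<le> int r * int s" by simp
    then show ?thesis using True e by (simp add: algebra_simps)
  next
    case False
    then have f: "(a + b) mod ?M = r + s - ?M" using e rs by (simp add: mod_if)
    have g: "int (r + s - ?M) = int r + int s - 2 * int m" using False by simp
    have "0 \<le> (2 * int m - int r) * (2 * int m - int s)" using rs by (intro mult_nonneg_nonneg) auto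
    then show ?thesis unfolding f g by (simp add: algebra_simps)
  qed
  then show ?thesis unfolding fs_bound_def r_def[symmetric] s_def[symmetric]
    by (simp add: algebra_simps)
qed


text \<open>In a minimal counterexample twice every degree exceeds this increment, so every degree
  is at least the remainder of n modulo 2m.\<close>

lemma fs_bound_Suc:
  assumes "m \<ge> 1" "n mod (2 * m) \<noteq> 0"
  shows "fs_bound m n - fs_bound m (n - 1) = 2 * int (n mod (2 * m)) - 2"
proof -
  let ?M = "2 * m"
  obtain n' where n: "n = Suc n'" using assms by (cases n) auto
  have "Suc (n' mod ?M) = n mod ?M" using assms n by (metis mod_Suc)
  then have "int (n mod ?M) = int (n' mod ?M) + 1" by linarith
  then show ?thesis using n by (simp add: fs_bound_def algebra_simps)
qed

lemma fs_bound_Suc0: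
  assumes "m \<ge> 1" "n > 0" "n mod (2 * m) = 0"
  shows "fs_bound m n - fs_bound m (n - 1) = 4 * int m - 2"
proof -
  let ?M = "2 * m"
  obtain n' where n: "n = Suc n'" using assms by (cases n) auto
  have "Suc (n' mod ?M) = ?M" using assms n mod_Suc[of n' ?M] by (auto split: if_splits)
  then have x: "int (n' mod ?M) = 2 * int m - 1" by linarith
  have "fs_bound m n = (2 * int m - 1) * int n" using assms(3) by (simp add: fs_bound_def)
  moreover have "fs_bound m n' = (2 * int m - 1) * int n' - (2 * int m - 1) * 1"
    unfolding fs_bound_def x by simp
  ultimately show ?thesis using n by (simp add: algebra_simps)
qed

lemma fs_bound_small:
  assumes "n \<le> 2 * m" shows "fs_bound m n = int n * (int n - 1)"
proof (cases "n = 2 * m")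
  case False
  then have "n mod (2 * m) = n" using assms by simp
  then show ?thesis by (simp add: fs_bound_def algebra_simps)
qed (simp add: fs_bound_def algebra_simps)

context two_graph
begin

theorem faudree_schelp:
  assumes "finite W" "no_path (2 * m + 1) W" "m \<ge> 1"
  shows "2 * int (ne W) \<le> fs_bound m (card W)"
  using assms(1,2)
proof (induction W rule: finite_psubset_induct)
  case (psubset W)
  show ?case
  proof (rule ccontr)
    assume big: "\<not> ?case"
    define n where "n = card W"
    define r where "r = n mod (2 * m)"
    have big': "2 * int (ne W) > fs_bound m n" using big by (simp add: n_def)
    have n2: "2 * m + 1 \<le> n"
    proof (rule ccontr)
      assume "\<not> 2 * m + 1 \<le> n"
      then have "fs_bound m n = int n * (int n - 1)" by (intro fs_bound_small) auto
      moreover have "2 * ne W \<le> (n - 1) * n" using ne_bound_card[OF psubset.hyps] by (simp add: n_def)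
      then have "2 * int (ne W) \<le> int ((n - 1) * n)" by linarith
      moreover have "int ((n - 1) * n) = int n * (int n - 1)" by (cases n) (auto simp: algebra_simps)
      ultimately show False using big' by simp
    qed
    have IH: "2 * int (ne X) \<le> fs_bound m (card X)" if "X \<subset> W" for X
      using psubset.IH[OF that] no_path_mono[OF psubset.prems] that by auto
    have conn: "conn W" unfolding conn_def
    proof (intro allI impI)
      fix X assume X: "X \<subseteq> W" "X \<noteq> {}" "X \<noteq> W"
      show "\<exists>x\<in>X. \<exists>y\<in>W - X. adj x y"
      proof (rule ccontr)
        assume "\<not> (\<exists>x\<in>X. \<exists>y\<in>W - X. adj x y)"
        then have "ne W = ne X + ne (W - X)" using X psubset.hyps by (intro ne_closed) auto
        moreover have "2 * int (ne X) \<le> fs_bound m (card X)" using X by (intro IH) auto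
        moreover have "2 * int (ne (W - X)) \<le> fs_bound m (card (W - X))" using X by (intro IH) auto
        moreover have "card X + card (W - X) = n" unfolding n_def
          using X psubset.hyps by (metis card_Diff_subset card_mono finite_subset le_add_diff_inverse)
        then have "fs_bound m (card X) + fs_bound m (card (W - X)) \<le> fs_bound m n"
          using fs_bound_superadd[OF assms(3)] by metis
        ultimately show False using big' by linarith
      qed
    qed
    have delta: "fs_bound m n - fs_bound m (n - 1) < 2 * int (dg W v)" if "v \<in> W" for v
    proof -
      have "2 * int (ne (W - {v})) \<le> fs_bound m (card (W - {v}))" using that by (intro IH) auto
      then show ?thesis using ne_remove[OF psubset.hyps that] big' that psubset.hyps by (simp add: n_def)
    qed
    have Wn: "W \<noteq> {}" using n2 by (auto simp: n_def)
    \<comment> \<open>Otherwise \<open>min_degree_cycle\<close> separates a set of at most 2m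
      vertices from the rest, against connectedness.\<close>
    have low: "\<exists>v\<in>W. dg W v < m"
    proof (rule ccontr)
      assume "\<not> (\<exists>v\<in>W. dg W v < m)"
      then obtain xs where xs: "cyc xs" "set xs \<subseteq> W"
        "\<And>x y. x \<in> set xs \<Longrightarrow> y \<in> W - set xs \<Longrightarrow> \<not> adj x y" "length xs \<le> 2 * m"
        using min_degree_cycle[OF psubset.hyps Wn _ psubset.prems] by (metis not_le)
      have "card (set xs) \<le> 2 * m" using xs(4) card_length le_trans by blast
      then have "set xs \<noteq> W" using n2 by (auto simp: n_def)
      moreover have "set xs \<noteq> {}" using xs(1) by (auto simp: cyc_def)
      ultimately show False using conn xs(2,3) unfolding conn_def by meson
    qed
    \<comment> \<open>If 2m divided n, every degree would be at least 2m, but some degree is below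
      m.\<close>
    have r0: "r \<noteq> 0"
    proof
      assume "r = 0"
      then have "4 * int m - 2 = fs_bound m n - fs_bound m (n - 1)"
        using fs_bound_Suc0[of m n] assms(3) n2 by (simp add: r_def)
      then show False using low delta assms(3) by fastforce
    qed
    have degr: "r \<le> dg W v" if "v \<in> W" for v
      using delta[OF that] fs_bound_Suc[of m n] r0 assms(3) unfolding r_def by linarith
    have rm: "r < m" using low degr by fastforce
    have n3: "2 * m + r \<le> n"
    proof -
      have "n = 2 * m * (n div (2 * m)) + r" by (simp add: r_def)
      moreover have "n div (2 * m) \<ge> 1" using n2 assms(3) by (simp add: div_greater_zero_iff Suc_le_eq)
      then have "2 * m * 1 \<le> 2 * m * (n div (2 * m))" by (intro mult_le_mono2)
      ultimately show ?thesis by linarith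
    qed
    have "m \<le> card W" using n2 by (simp add: n_def)
    then obtain D where D: "D \<subseteq> W" "m \<le> card D" "ne W \<le> ne D + (m - 1) * (card W - card D)"
      "card D = m \<or> (\<forall>v\<in>D. m \<le> dg D v)"
      using peel[OF psubset.hyps] by blast
    have finD: "finite D" using D psubset.hyps finite_subset by auto
    define s where "s = card D"
    have sn: "s \<le> n" using D psubset.hyps by (simp add: s_def n_def card_mono)
    have count: "2 * int (ne W) \<le> int s * (int s - 1) + 2 * (int m - 1) * (int n - int s)"
    proof -
      have "2 * ne D \<le> (s - 1) * s" using ne_bound_card[OF finD] by (simp add: s_def)
      then have "2 * int (ne D) \<le> int ((s - 1) * s)" by linarith
      also have "\<dots> = int s * (int s - 1)" by (cases s) (auto simp: algebra_simps)
      finally have a: "2 * int (ne D) \<le> int s * (int s - 1)" .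
      have "int (ne W) \<le> int (ne D + (m - 1) * (n - s))"
        using D(3) unfolding s_def n_def by (simp only: of_nat_le_iff)
      also have "\<dots> = int (ne D) + (int m - 1) * (int n - int s)" using sn assms(3) by simp
      finally show ?thesis using a by (simp add: algebra_simps)
    qed
    \<comment> \<open>With s = 2m - j, the bound from peeling lies below \<open>fs_bound\<close> by
      (n - 2m) + j + (j - r)(2m - j - r), and the product is nonnegative for r <= j <= m.\<close>
    have small_r: False if "s \<le> 2 * m - r" "m \<le> s"
    proof -
      define j where "j = 2 * int m - int s"
      have s: "int s = 2 * int m - j" by (simp add: j_def)
      have "int r \<le> j" "j \<le> int m" using that rm by (auto simp: j_def)
      then have "0 \<le> (j - int r) * (2 * int m - j - int r)" using rm by (intro mult_nonneg_nonneg) auto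
      moreover have "0 \<le> j" using \<open>int r \<le> j\<close> by linarith
      moreover have "int n \<ge> 2 * int m + int r" using n3 by linarith
      moreover have "int s * (int s - 1) + 2 * (int m - 1) * (int n - int s) =
         (2 * int m - 1) * int n - int r * (2 * int m - int r) - (int n - 2 * int m) - j
         - (j - int r) * (2 * int m - j - int r)"
        unfolding s by (simp add: algebra_simps)
      ultimately have "2 * int (ne W) \<le> fs_bound m n"
        using count unfolding fs_bound_def r_def[symmetric] by linarith
      then show False using big' by simp
    qed
    show False
    proof (cases "\<forall>v\<in>D. m \<le> dg D v")
      case False
      then have "s = m" using D(4) unfolding s_def by blast
      then have "s \<le> 2 * m - r" "m \<le> s" using rm by linarith+
      then show False by (rule small_r)
    next
      case True
      have npD: "no_path (2 * m + 1) X" if "X \<subseteq> D" for X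
        using no_path_mono[OF psubset.prems] that D(1) by blast
      have Dn: "D \<noteq> {}" using D(2) assms(3) by auto
      obtain xs where xs: "cyc xs" "set xs \<subseteq> D"
        "\<And>x y. x \<in> set xs \<Longrightarrow> y \<in> D - set xs \<Longrightarrow> \<not> adj x y" "m + 1 \<le> length xs" "length xs \<le> 2 * m"
        using min_degree_cycle[OF finD Dn _ npD[of D]] True by blast
      \<comment> \<open>A second cycle in the core would also have at least m + 1 vertices, and
        linking the two gives a path on at least 2m + 2.\<close>
      have "D - set xs = {}"
      proof (rule ccontr)
        assume ne: "D - set xs \<noteq> {}"
        have "m \<le> dg (D - set xs) v" if "v \<in> D - set xs" for v
        proof -
          have "nb D v = nb (D - set xs) v" using xs(3) that adj_sym by (auto simp: nb_def)
          then show ?thesis using True that by (auto simp: dg_def)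
        qed
        then obtain ys where ys: "cyc ys" "set ys \<subseteq> D - set xs" "m + 1 \<le> length ys"
          using min_degree_cycle[OF _ ne _ npD[of "D - set xs"]] finD by (metis Diff_subset finite_Diff)
        have "set xs \<subseteq> W" "set ys \<subseteq> W" "set xs \<inter> set ys = {}" using xs ys D by auto
        then obtain zs where "pth zs" "set zs \<subseteq> W" "length xs + length ys \<le> length zs"
          using link_cycles[OF conn xs(1) _ ys(1)] by blast
        then show False using no_pathD[OF psubset.prems, of zs] xs(4) ys(3) by linarith
      qed
      then have DX: "set xs = D" using xs(2) by auto
      have sx: "s = length xs" unfolding s_def DX[symmetric] using xs(1) cyc_pth pth_card by blast
      show False
      proof (cases "s \<le> 2 * m - r")
        case True
        moreover have "m \<le> s" using xs(4) sx by simp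
        ultimately show False by (rule small_r)
      next
        case False
        \<comment> \<open>Now the deficit 2m - s of the core is below r, hence below every
          degree.\<close>
        then have "2 * m - s + 1 \<le> dg W v" if "v \<in> W" for v using degr[OF that] xs(5) sx by linarith
        moreover have "card D + (2 * m - s) = 2 * m" using sx xs(5) by (simp add: s_def)
        ultimately show False
          using no_dense_core[OF psubset.hyps _ conn psubset.prems, of "2 * m - s" D xs]
            n2 D(1) \<open>\<forall>v\<in>D. m \<le> dg D v\<close> xs(1) DX by (auto simp: n_def)
      qed
    qed
  qed
qed

end

section \<open>Embeddings of star forests and paths\<close>

text \<open>Maps are easier to restrict and to combine than subgraphs up to isomorphism;
  \<open>is_free_iff\<close> makes the transition.\<close>

definition embeds :: "('a \<Rightarrow> 'b) \<Rightarrow> 'a ugraph \<Rightarrow> 'b ugraph \<Rightarrow> bool" where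
  "embeds f F G \<longleftrightarrow> inj_on f (verts F) \<and> f ` verts F \<subseteq> verts G \<and> (\<forall>e\<in>edges F. f ` e \<in> edges G)"

lemma is_free_iff:
  assumes F: "simple_graph F" and G: "simple_graph G"
  shows "is_free F G \<longleftrightarrow> \<not> (\<exists>f. embeds f F G)"
proof -
  have "\<exists>S. subgraph S G \<and> F \<simeq> S"
    if "embeds f F G" for f
  proof -
    have f: "inj_on f (verts F)" "f ` verts F \<subseteq> verts G" "\<forall>e\<in>edges F. f ` e \<in> edges G"
      using that by (auto simp: embeds_def)
    define S where "S = \<lparr>verts = f ` verts F, edges = (\<lambda>e. f ` e) ` edges F\<rparr>"
    have "card (f ` e) = 2" "e \<subseteq> verts F" if "e \<in> edges F" for e
    proof -
      have e: "e \<subseteq> verts F" "card e = 2" using that F by (auto simp: simple_graph_def all_pairs_def)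
      then show "e \<subseteq> verts F" "card (f ` e) = 2" using f(1) by (auto simp: card_image inj_on_subset)
    qed
    then have "simple_graph S" using F by (auto simp: simple_graph_def S_def all_pairs_def)
    then have "subgraph S G" using f by (auto simp: subgraph_def S_def)
    moreover have "F \<simeq> S" unfolding isomorphic_def
      by (rule exI[of _ f]) (auto simp: S_def bij_betw_def f(1))
    ultimately show ?thesis by blast
  qed
  moreover have "\<exists>f. embeds f F G"
    if S: "subgraph S G" "F \<simeq> S" for S
  proof -
    obtain f where f: "bij_betw f (verts F) (verts S)" "edges S = (\<lambda>e. f ` e) ` edges F"
      using S(2) unfolding isomorphic_def by (elim exE conjE)
    have "inj_on f (verts F)" "f ` verts F \<subseteq> verts G" "\<forall>e\<in>edges F. f ` e \<in> edges G"
      using f S(1) by (auto simp: bij_betw_def subgraph_def)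
    then show ?thesis by (auto simp: embeds_def)
  qed
  ultimately show ?thesis unfolding is_free_def by blast
qed

lemma is_free_disj_union:
  assumes "simple_graph F1" "simple_graph F2" "simple_graph (F1 \<squnion>\<^sub>G F2)" "simple_graph G" "is_free F1 G"
  shows "is_free (F1 \<squnion>\<^sub>G F2) G"
proof -
  have False if "embeds f (F1 \<squnion>\<^sub>G F2) G" for f
  proof -
    have f: "inj_on f (verts (F1 \<squnion>\<^sub>G F2))" "f ` verts (F1 \<squnion>\<^sub>G F2) \<subseteq> verts G"
      "\<forall>e\<in>edges (F1 \<squnion>\<^sub>G F2). f ` e \<in> edges G"
      using that by (auto simp: embeds_def)
    have "inj_on (f \<circ> Inl) (verts F1)" using f(1) by (auto simp: disj_union_def inj_on_def)
    moreover have "(f \<circ> Inl) ` verts F1 \<subseteq> verts G" using f(2) by (auto simp: disj_union_def)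
    moreover have "(f \<circ> Inl) ` e \<in> edges G" if "e \<in> edges F1" for e
    proof -
      have "Inl ` e \<in> edges (F1 \<squnion>\<^sub>G F2)" using that by (simp add: disj_union_def)
      then have "f ` Inl ` e \<in> edges G" using f(3) by blast
      then show ?thesis by (simp add: image_comp)
    qed
    ultimately have "embeds (f \<circ> Inl) F1 G" by (simp add: embeds_def)
    then show False using assms(1,4,5) is_free_iff by blast
  qed
  then show ?thesis using assms(3,4) is_free_iff by blast
qed

lemma simple_path_graph: "simple_graph (path_graph l)"
  by (auto simp: simple_graph_def path_graph_def all_pairs_def)

lemma verts_star_forest: "verts (star_forest t a) = {(i, j). i \<in> {1..t} \<and> j \<le> a i}"
  by (auto simp: star_forest_def disj_Union_def star_graph_def)

lemma edges_star_forest: "edges (star_forest t a) = {{(i, 0), (i, j)} | i j. i \<in> {1..t} \<and> j \<in> {1..a i}}"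
proof -
  have "{{0, j} | j. j \<in> {1..a i}} = (\<lambda>j. {0, j}) ` {1..a i}" for i by auto
  then have "edges (star_forest t a) = (\<Union>i\<in>{1..t}. (\<lambda>j. {(i, 0), (i, j)}) ` {1..a i})"
    by (simp add: star_forest_def disj_Union_def star_graph_def image_image)
  also have "\<dots> = {{(i, 0), (i, j)} | i j. i \<in> {1..t} \<and> j \<in> {1..a i}}" by blast
  finally show ?thesis .
qed

lemma simple_star_forest: "simple_graph (star_forest t a)"
proof -
  have "finite (verts (star_forest t a))"
    by (simp add: star_forest_def disj_Union_def star_graph_def)
  moreover have "card {(i, 0), (i, j)} = 2" if "j \<in> {1..a i}" for i j :: nat using that by auto
  ultimately show ?thesis
    unfolding simple_graph_def all_pairs_def by (auto simp: edges_star_forest verts_star_forest)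
qed

lemma simple_disj_union:
  assumes "simple_graph F1" "simple_graph F2" shows "simple_graph (F1 \<squnion>\<^sub>G F2)"
proof -
  have l: "card (Inl ` e :: ('a + 'b) set) = 2" "e \<subseteq> verts F1" if "e \<in> edges F1" for e
    using that assms(1) by (auto simp: card_image simple_graph_def all_pairs_def)
  have r: "card (Inr ` e :: ('a + 'b) set) = 2" "e \<subseteq> verts F2" if "e \<in> edges F2" for e
    using that assms(2) by (auto simp: card_image simple_graph_def all_pairs_def)
  have "finite (verts F1)" "finite (verts F2)" using assms by (auto simp: simple_graph_def)
  moreover have "card x = 2 \<and> x \<subseteq> Inl ` verts F1 \<union> Inr ` verts F2" if "x \<in> edges (F1 \<squnion>\<^sub>G F2)" for x
  proof -
    consider (1) e where "e \<in> edges F1" "x = Inl ` e" | (2) e where "e \<in> edges F2" "x = Inr ` e"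
      using \<open>x \<in> edges (F1 \<squnion>\<^sub>G F2)\<close> by (auto simp: disj_union_def)
    then show ?thesis
    proof cases
      case 1
      then show ?thesis using l[OF 1(1)] image_mono[of e "verts F1" Inl] by auto
    next
      case 2
      then show ?thesis using r[OF 2(1)] image_mono[of e "verts F2" Inr] by auto
    qed
  qed
  ultimately show ?thesis by (auto simp: simple_graph_def all_pairs_def disj_union_def)
qed

lemma simple_two_graph: "simple_graph G \<Longrightarrow> two_graph (edges G)"
  by (auto simp: two_graph_def simple_graph_def all_pairs_def)

context two_graph
begin

text \<open>Leaves are kept as sets, since the greedy choices below only control their number and
  what they avoid. Labels are restored in \<open>stars_path_not_free\<close>.\<close>

definition stars :: "'a set \<Rightarrow> nat set \<Rightarrow> (nat \<Rightarrow> nat) \<Rightarrow> (nat \<Rightarrow> 'a) \<Rightarrow> (nat \<Rightarrow> 'a set) \<Rightarrow> bool" where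
  "stars W I a c A \<longleftrightarrow>
     (\<forall>i\<in>I. c i \<in> W \<and> A i \<subseteq> W \<and> finite (A i) \<and> card (A i) = a i \<and> (\<forall>x\<in>A i. adj (c i) x)) \<and>
     (\<forall>i\<in>I. \<forall>j\<in>I. i \<noteq> j \<longrightarrow> insert (c i) (A i) \<inter> insert (c j) (A j) = {})"

definition has_stars_path :: "'a set \<Rightarrow> nat set \<Rightarrow> (nat \<Rightarrow> nat) \<Rightarrow> nat \<Rightarrow> bool" where
  "has_stars_path W I a l \<longleftrightarrow> (\<exists>c A xs. stars W I a c A \<and> pth xs \<and> set xs \<subseteq> W \<and> length xs = l \<and>
     (\<forall>i\<in>I. insert (c i) (A i) \<inter> set xs = {}))"

lemma pth_nth: "pth xs \<longleftrightarrow> distinct xs \<and> (\<forall>i. Suc i < length xs \<longrightarrow> adj (xs ! i) (xs ! Suc i))"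
  by (simp add: pth_def successively_conv_nth)

end

lemma embed_stars:
  assumes G: "simple_graph G"
    and "embeds f (star_forest t a) G"
  shows "two_graph.stars (edges G) (verts G) {1..t} a (\<lambda>i. f (i, 0)) (\<lambda>i. (\<lambda>j. f (i, j)) ` {1..a i})"
proof -
  interpret two_graph "edges G" by (rule simple_two_graph[OF G])
  have f: "inj_on f (verts (star_forest t a))" "f ` verts (star_forest t a) \<subseteq> verts G"
    "\<forall>e\<in>edges (star_forest t a). f ` e \<in> edges G"
    using assms(2) by (auto simp: embeds_def)
  have inj: "(i, j) = (i', j')" if "f (i, j) = f (i', j')" "i \<in> {1..t}" "i' \<in> {1..t}" "j \<le> a i" "j' \<le> a i'" for i j i' j'
    using f(1) that by (auto simp: verts_star_forest inj_on_def)
  have "f (i, j) \<in> verts G" if "i \<in> {1..t}" "j \<le> a i" for i j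
    using f(2) that by (auto simp: verts_star_forest)
  moreover have "card ((\<lambda>j. f (i, j)) ` {1..a i}) = a i" if "i \<in> {1..t}" for i
    using inj that by (subst card_image) (auto simp: inj_on_def)
  moreover have "adj (f (i, 0)) (f (i, j))" if "i \<in> {1..t}" "j \<in> {1..a i}" for i j
  proof -
    have "{(i, 0), (i, j)} \<in> edges (star_forest t a)" using that unfolding edges_star_forest by blast
    then have "f ` {(i, 0), (i, j)} \<in> edges G" using f(3) by blast
    then show ?thesis by (simp add: adj_def)
  qed
  moreover have "insert (f (i, 0)) ((\<lambda>j. f (i, j)) ` {1..a i}) \<inter> insert (f (i', 0)) ((\<lambda>j. f (i', j)) ` {1..a i'}) = {}"
    if "i \<in> {1..t}" "i' \<in> {1..t}" "i \<noteq> i'" for i i'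
  proof -
    have a: "insert (f (i, 0)) ((\<lambda>j. f (i, j)) ` {1..a i}) \<subseteq> (\<lambda>j. f (i, j)) ` {..a i}" for i by auto
    have "(\<lambda>j. f (i, j)) ` {..a i} \<inter> (\<lambda>j. f (i', j)) ` {..a i'} = {}" using inj that by fastforce
    then show ?thesis using Int_mono[OF a[of i] a[of i']] by (simp add: subset_empty)
  qed
  ultimately show ?thesis unfolding stars_def by auto
qed

text \<open>Numbering every leaf set by a bijection from \<open>{1..a i}\<close> and sending 0 to
  the centre turns the sets back into an embedding.\<close>

lemma stars_path_not_free:
  assumes G: "simple_graph G" and h: "two_graph.has_stars_path (edges G) (verts G) {1..t} a l"
  shows "\<not> is_free (star_forest t a \<squnion>\<^sub>G path_graph l) G"
proof -
  interpret two_graph "edges G" by (rule simple_two_graph[OF G])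
  obtain c A xs where st: "stars (verts G) {1..t} a c A" and xs: "pth xs" "set xs \<subseteq> verts G" "length xs = l"
    and dj: "\<forall>i\<in>{1..t}. insert (c i) (A i) \<inter> set xs = {}"
    using h unfolding has_stars_path_def by blast
  have "\<forall>i\<in>{1..t}. \<exists>h. bij_betw h {1..a i} (A i)"
    using st ex_bij_betw_nat_finite_1 unfolding stars_def by metis
  then obtain h where h: "\<And>i. i \<in> {1..t} \<Longrightarrow> bij_betw (h i) {1..a i} (A i)" by metis
  define g where "g = (\<lambda>i j. if j = 0 then c i else h i j)"
  define f where "f = (\<lambda>x. case x of Inl (i, j) \<Rightarrow> g i j | Inr j \<Rightarrow> xs ! j)"
  have f_simps: "f (Inl (i, j)) = g i j" "f (Inr j) = xs ! j" for i j by (auto simp: f_def)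
  have gA: "g i j \<in> insert (c i) (A i)" if "i \<in> {1..t}" "j \<le> a i" for i j
    using h[OF that(1)] that by (auto simp: g_def bij_betw_def)
  have cA: "c i \<notin> A i" if "i \<in> {1..t}" for i using st that unfolding stars_def by force
  have ginj: "j = j'" if "g i j = g i j'" "i \<in> {1..t}" "j \<le> a i" "j' \<le> a i" for i j j'
  proof -
    have hj: "h i j \<in> A i" if "j \<noteq> 0" "j \<le> a i" for j
      using h[OF \<open>i \<in> {1..t}\<close>] that by (auto simp: bij_betw_def)
    have hinj: "inj_on (h i) {1..a i}" using h[OF that(2)] by (simp add: bij_betw_def)
    have "c i \<noteq> h i j" if "j \<noteq> 0" "j \<le> a i" for j
      using hj[OF that] cA[OF \<open>i \<in> {1..t}\<close>] by metis
    then have "j = 0 \<longleftrightarrow> j' = 0" using that(1,3,4) unfolding g_def by (metis (full_types))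
    moreover have "j = j'" if "j \<noteq> 0" "j' \<noteq> 0"
      using inj_onD[OF hinj, of j j'] that \<open>g i j = g i j'\<close> \<open>j \<le> a i\<close> \<open>j' \<le> a i\<close> by (simp add: g_def)
    ultimately show ?thesis by blast
  qed
  have ginj2: "i = i'" if "g i j = g i' j'" "i \<in> {1..t}" "i' \<in> {1..t}" "j \<le> a i" "j' \<le> a i'" for i j i' j'
  proof (rule ccontr)
    assume "i \<noteq> i'"
    then have "insert (c i) (A i) \<inter> insert (c i') (A i') = {}" using st that unfolding stars_def by blast
    then show False using gA[OF that(2,4)] gA[OF that(3,5)] that(1) by auto
  qed
  have gx: "g i j \<notin> set xs" if "i \<in> {1..t}" "j \<le> a i" for i j
    using gA[OF that] dj that(1) by blast
  have vF: "verts (star_forest t a \<squnion>\<^sub>G path_graph l) =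
    {Inl (i, j) | i j. i \<in> {1..t} \<and> j \<le> a i} \<union> {Inr j | j. j < l}"
    by (auto simp: disj_union_def verts_star_forest path_graph_def)
  have dx: "distinct xs" using xs(1) by (simp add: pth_def)
  have gg: "g i j = g i' j' \<longleftrightarrow> i = i' \<and> j = j'"
    if "i \<in> {1..t}" "i' \<in> {1..t}" "j \<le> a i" "j' \<le> a i'" for i j i' j'
    using ginj ginj2 that by metis
  have gn: "g i j \<noteq> xs ! j'" "xs ! j' \<noteq> g i j" if "i \<in> {1..t}" "j \<le> a i" "j' < l" for i j j'
    using gx[OF that(1,2)] that(3) xs(3) nth_mem by metis+
  have "inj_on f (verts (star_forest t a \<squnion>\<^sub>G path_graph l))"
    using dx xs(3) by (auto simp: inj_on_def vF f_simps gg gn nth_eq_iff_index_eq)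
  moreover have "f ` verts (star_forest t a \<squnion>\<^sub>G path_graph l) \<subseteq> verts G"
  proof -
    have "insert (c i) (A i) \<subseteq> verts G" if "i \<in> {1..t}" for i using st that unfolding stars_def by blast
    then have "g i j \<in> verts G" if "i \<in> {1..t}" "j \<le> a i" for i j using gA that by blast
    moreover have "xs ! j \<in> verts G" if "j < l" for j using xs that by auto
    ultimately show ?thesis unfolding vF by (auto simp: f_simps)
  qed
  moreover have "f ` e \<in> edges G" if "e \<in> edges (star_forest t a \<squnion>\<^sub>G path_graph l)" for e
  proof -
    from that consider (1) i j where "e = {Inl (i, 0), Inl (i, j)}" "i \<in> {1..t}" "j \<in> {1..a i}"
      | (2) j where "e = {Inr j, Inr (Suc j)}" "Suc j < l"
      unfolding disj_union_def edges_star_forest path_graph_def by auto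
    then show ?thesis
    proof cases
      case 1
      have "h i j \<in> A i" using h[OF 1(2)] 1(3) by (auto simp: bij_betw_def)
      then have "adj (c i) (h i j)" using st 1(2) unfolding stars_def by blast
      then show ?thesis using 1 by (simp add: f_simps g_def adj_def)
    next
      case 2
      then have "adj (xs ! j) (xs ! Suc j)" using xs pth_nth by auto
      then show ?thesis using 2 by (simp add: f_simps adj_def)
    qed
  qed
  ultimately have "embeds f (star_forest t a \<squnion>\<^sub>G path_graph l) G" by (simp add: embeds_def)
  then show ?thesis
    using is_free_iff[OF simple_disj_union[OF simple_star_forest simple_path_graph] G] by blast
qed

lemma not_free_stars_path:
  assumes G: "simple_graph G" and nf: "\<not> is_free (star_forest t a \<squnion>\<^sub>G path_graph l) G"
  shows "two_graph.has_stars_path (edges G) (verts G) {1..t} a l"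
proof -
  interpret two_graph "edges G" by (rule simple_two_graph[OF G])
  let ?F = "star_forest t a \<squnion>\<^sub>G path_graph l"
  obtain f where "embeds f ?F G"
    using nf is_free_iff[OF simple_disj_union[OF simple_star_forest simple_path_graph] G] by blast
  then have f: "inj_on f (verts ?F)" "f ` verts ?F \<subseteq> verts G" "\<forall>e\<in>edges ?F. f ` e \<in> edges G"
    by (auto simp: embeds_def)
  let ?f = "\<lambda>x. f (Inl x)"
  have "stars (verts G) {1..t} a (\<lambda>i. ?f (i, 0)) (\<lambda>i. (\<lambda>j. ?f (i, j)) ` {1..a i})"
  proof (rule embed_stars[OF G], unfold embeds_def, intro conjI)
    show "inj_on ?f (verts (star_forest t a))" using f(1) by (auto simp: inj_on_def disj_union_def)
    show "?f ` verts (star_forest t a) \<subseteq> verts G" using f(2) by (auto simp: disj_union_def)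
    show "\<forall>e\<in>edges (star_forest t a). ?f ` e \<in> edges G"
    proof
      fix e assume "e \<in> edges (star_forest t a)"
      then have "Inl ` e \<in> edges ?F" by (simp add: disj_union_def)
      then have "f ` Inl ` e \<in> edges G" using f(3) by blast
      then show "?f ` e \<in> edges G" by (simp add: image_image)
    qed
  qed
  moreover define xs where "xs = map (\<lambda>j. f (Inr j)) [0..<l]"
  have ve: "Inr j \<in> verts ?F" if "j < l" for j using that by (auto simp: disj_union_def path_graph_def)
  have "pth xs"
  proof -
    have "j = j'" if "f (Inr j) = f (Inr j')" "j < l" "j' < l" for j j'
      using inj_onD[OF f(1) that(1) ve[OF that(2)] ve[OF that(3)]] by simp
    then have "distinct xs" by (auto simp: xs_def distinct_map inj_on_def)
    moreover have "adj (xs ! j) (xs ! Suc j)" if "Suc j < length xs" for j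
    proof -
      have "{j, Suc j} \<in> edges (path_graph l)" using that by (auto simp: path_graph_def xs_def)
      then have "Inr ` {j, Suc j} \<in> edges ?F" unfolding disj_union_def by (simp del: image_insert)
      then have "f ` Inr ` {j, Suc j} \<in> edges G" using f(3) by blast
      then show ?thesis using that by (simp add: adj_def xs_def)
    qed
    ultimately show ?thesis using pth_nth by blast
  qed
  moreover have "set xs \<subseteq> verts G" using f(2) ve by (auto simp: xs_def)
  moreover have "length xs = l" by (simp add: xs_def)
  moreover have "insert (?f (i, 0)) ((\<lambda>j. ?f (i, j)) ` {1..a i}) \<inter> set xs = {}" if i: "i \<in> {1..t}" for i
  proof -
    have "f (Inl (i, j)) \<noteq> f (Inr j')" if "j \<le> a i" "j' < l" for j j'
    proof -
      have "Inl (i, j) \<in> verts ?F" using i that by (auto simp: disj_union_def verts_star_forest)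
      then show ?thesis using inj_onD[OF f(1) _ _ ve[OF that(2)], of "Inl (i, j)"] by auto
    qed
    then show ?thesis by (auto simp: xs_def)
  qed
  ultimately show ?thesis unfolding has_stars_path_def by blast
qed

lemma not_free_stars:
  assumes G: "simple_graph G" and nf: "\<not> is_free (star_forest t a) G"
  shows "\<exists>c A. two_graph.stars (edges G) (verts G) {1..t} a c A"
  using embed_stars[OF G] nf is_free_iff[OF simple_star_forest G] by blast

lemma is_free_path:
  assumes G: "simple_graph G"
  shows "is_free (path_graph l) G \<longleftrightarrow> two_graph.no_path (edges G) l (verts G)"
proof -
  interpret two_graph "edges G" by (rule simple_two_graph[OF G])
  have "\<exists>xs. pth xs \<and> set xs \<subseteq> verts G \<and> length xs = l"
    if "embeds f (path_graph l) G" for f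
  proof -
    have f: "inj_on f (verts (path_graph l))" "f ` verts (path_graph l) \<subseteq> verts G"
     "\<forall>e\<in>edges (path_graph l). f ` e \<in> edges G" using that by (auto simp: embeds_def)
    define xs where "xs = map f [0..<l]"
    have "distinct xs" using f(1) by (auto simp: xs_def distinct_map inj_on_def path_graph_def)
    moreover have "adj (xs ! j) (xs ! Suc j)" if "Suc j < length xs" for j
    proof -
      have "{j, Suc j} \<in> edges (path_graph l)" using that by (auto simp: path_graph_def xs_def)
      then have "f ` {j, Suc j} \<in> edges G" using f(3) by blast
      then show ?thesis using that by (simp add: adj_def xs_def)
    qed
    moreover have "set xs \<subseteq> verts G" using f(2) by (auto simp: xs_def path_graph_def)
    ultimately show ?thesis using pth_nth by (intro exI[of _ xs]) (auto simp: xs_def)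
  qed
  moreover have "\<exists>f. embeds f (path_graph l) G"
    if xs: "pth xs" "set xs \<subseteq> verts G" "length xs = l" for xs
    using xs unfolding pth_nth
    by (intro exI[of _ "\<lambda>i. xs ! i"]) (auto simp: embeds_def path_graph_def inj_on_def nth_eq_iff_index_eq adj_def)
  ultimately have "(\<exists>f. embeds f (path_graph l) G) \<longleftrightarrow> (\<exists>xs. pth xs \<and> set xs \<subseteq> verts G \<and> length xs = l)"
    by metis
  then show ?thesis unfolding is_free_iff[OF simple_path_graph G] no_path_iff by simp
qed

section \<open>Lower bounds\<close>

text \<open>The edge set of the join of a clique on \<open>T\<close> with an edgeless graph on the
  rest of \<open>V\<close>.\<close>

definition cross :: "'a set \<Rightarrow> 'a set \<Rightarrow> 'a set set" where
  "cross V T = {e \<in> all_pairs V. e \<inter> T \<noteq> {}}"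

lemma finite_all_pairs [simp]: "finite V \<Longrightarrow> finite (all_pairs V)"
  by (rule finite_subset[of _ "Pow V"]) (auto simp: all_pairs_def)

lemma finite_cross [simp]: "finite V \<Longrightarrow> finite (cross V T)"
  by (rule finite_subset[of _ "all_pairs V"]) (auto simp: cross_def)

lemma two_graph_subset: "E \<subseteq> all_pairs V \<Longrightarrow> two_graph E"
  by (auto simp: two_graph_def all_pairs_def)

lemma all_pairs_dg:
  assumes "v \<in> V" "W \<subseteq> V" shows "two_graph.dg (all_pairs V) W v = card (W - {v})"
proof -
  interpret two_graph "all_pairs V" by (rule two_graph_subset[OF order_refl])
  have "adj u w \<longleftrightarrow> u \<in> V \<and> w \<in> V \<and> u \<noteq> w" for u w
    unfolding adj_def by (auto simp: all_pairs_def)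
  then have "nb W v = W - {v}" using assms by (auto simp: nb_def)
  then show ?thesis by (simp add: dg_def)
qed

lemma card_all_pairs:
  assumes "finite V" shows "2 * int (card (all_pairs V)) = int (card V) * (int (card V) - 1)"
proof -
  interpret two_graph "all_pairs V" by (rule two_graph_subset[OF order_refl])
  have "{e \<in> all_pairs V. e \<subseteq> V} = all_pairs V" by (auto simp: all_pairs_def)
  then have "2 * card (all_pairs V) = (\<Sum>v\<in>V. dg V v)" using handshake[OF assms] by (simp add: ne_def)
  also have "\<dots> = card V * (card V - 1)" using assms all_pairs_dg[of _ V V] by simp
  finally have "2 * int (card (all_pairs V)) = int (card V * (card V - 1))" by linarith
  then show ?thesis by (cases "card V") (auto simp: algebra_simps)
qed

lemma card_cross:
  assumes "finite V" "T \<subseteq> V"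
  shows "2 * int (card (cross V T)) =
    int (card V) * (int (card V) - 1) - (int (card V) - int (card T)) * (int (card V) - int (card T) - 1)"
proof -
  have "all_pairs V = cross V T \<union> all_pairs (V - T)" "cross V T \<inter> all_pairs (V - T) = {}"
    using assms(2) by (auto simp: cross_def all_pairs_def)
  then have "card (all_pairs V) = card (cross V T) + card (all_pairs (V - T))"
    using assms(1) by (simp add: card_Un_disjoint)
  then show ?thesis using card_Diff_int[OF assms] card_all_pairs[OF assms(1)] card_all_pairs[of "V - T"] assms(1) by simp
qed

context two_graph
begin

definition missing :: "'a set \<Rightarrow> 'a set \<Rightarrow> nat" where
  "missing V T = card (cross V T - E)"

text \<open>An exact balance: a lower bound on all edges becomes a statement that edges outside
  \<open>T\<close> compensate for the missing ones. All comparisons with the constructions use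
  it.\<close>

lemma edge_count:
  assumes "finite V" "T \<subseteq> V"
  shows "2 * int (ne V) + 2 * int (missing V T) = int (card V) * (int (card V) - 1)
     - (int (card V) - int (card T)) * (int (card V) - int (card T) - 1) + 2 * int (ne (V - T))"
proof -
  have "{e \<in> E. e \<subseteq> V} = (cross V T \<inter> E) \<union> {e \<in> E. e \<subseteq> V - T}"
    using card2 by (auto simp: cross_def all_pairs_def)
  moreover have "(cross V T \<inter> E) \<inter> {e \<in> E. e \<subseteq> V - T} = {}" by (auto simp: cross_def)
  ultimately have "ne V = card (cross V T \<inter> E) + ne (V - T)"
    using assms by (simp add: ne_def card_Un_disjoint)
  moreover have "card (cross V T) = card (cross V T \<inter> E) + missing V T"
    unfolding missing_def using assms by (metis Int_Diff_disjoint Un_Diff_Int card_Un_disjoint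
        finite_Diff finite_Int finite_cross inf_sup_aci(5) inf_commute)
  ultimately show ?thesis using card_cross[OF assms] by simp
qed

text \<open>Pigeonhole with room for one more set: the sets \<open>S i\<close> take different
  elements of \<open>T\<close>, and what \<open>X\<close> has in \<open>T\<close> must be among the
  rest.\<close>

lemma disjoint_hits:
  assumes "finite T" "finite I" "\<And>i. i \<in> I \<Longrightarrow> S i \<inter> T \<noteq> {}"
    "\<And>i j. i \<in> I \<Longrightarrow> j \<in> I \<Longrightarrow> i \<noteq> j \<Longrightarrow> S i \<inter> S j = {}" "\<And>i. i \<in> I \<Longrightarrow> S i \<inter> X = {}"
  shows "card I + card (X \<inter> T) \<le> card T"
proof -
  have "\<forall>i\<in>I. \<exists>x. x \<in> S i \<inter> T" using assms(3) by blast
  then obtain g where g: "\<And>i. i \<in> I \<Longrightarrow> g i \<in> S i" "\<And>i. i \<in> I \<Longrightarrow> g i \<in> T" by (metis IntE)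
  have "inj_on g I"
  proof (rule inj_onI, rule ccontr)
    fix i j assume a: "i \<in> I" "j \<in> I" "g i = g j" "i \<noteq> j"
    then have "g i \<in> S i \<inter> S j" using g(1)[of i] g(1)[of j] by simp
    then show False using assms(4)[of i j] a by simp
  qed
  then have "card (g ` I) = card I" by (rule card_image)
  moreover have "g ` I \<inter> (X \<inter> T) = {}"
  proof -
    have "g i \<notin> X" if "i \<in> I" for i using g(1)[OF that] assms(5)[OF that] by auto
    then show ?thesis by auto
  qed
  moreover have "card (g ` I \<union> (X \<inter> T)) \<le> card T" using g(2) assms(1) by (intro card_mono) auto
  ultimately show ?thesis using assms(1,2) by (simp add: card_Un_disjoint)
qed

lemma stars_disjoint:
  assumes "stars W I a c A" "i \<in> I" "j \<in> I" "i \<noteq> j"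
  shows "insert (c i) (A i) \<inter> insert (c j) (A j) = {}"
  using assms unfolding stars_def by metis

lemma starsD:
  assumes "stars W I a c A" "i \<in> I"
  shows "c i \<in> W" "A i \<subseteq> W" "finite (A i)" "card (A i) = a i" "\<And>x. x \<in> A i \<Longrightarrow> adj (c i) x"
  using assms unfolding stars_def by metis+

lemma stars_hits:
  assumes "finite T" and st: "stars V {1..t} a c A"
    and hit: "\<And>i. i \<in> {1..t} \<Longrightarrow> insert (c i) (A i) \<inter> T \<noteq> {}"
    and dj: "\<forall>i\<in>{1..t}. insert (c i) (A i) \<inter> X = {}"
  shows "t + card (X \<inter> T) \<le> card T"
proof -
  have "card {1..t} + card (X \<inter> T) \<le> card T"
  proof (rule disjoint_hits[OF assms(1), where S = "\<lambda>i. insert (c i) (A i)"])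
    show "insert (c i) (A i) \<inter> T \<noteq> {}" if "i \<in> {1..t}" for i by (rule hit[OF that])
    show "insert (c i) (A i) \<inter> insert (c j) (A j) = {}" if "i \<in> {1..t}" "j \<in> {1..t}" "i \<noteq> j" for i j
      by (rule stars_disjoint[OF st that])
    show "insert (c i) (A i) \<inter> X = {}" if "i \<in> {1..t}" for i using dj that by (rule bspec)
  qed simp
  then show ?thesis by simp
qed

lemma star_dg:
  assumes "finite W" "stars V I a c A" "i \<in> I" "A i \<subseteq> W" shows "a i \<le> dg W (c i)"
proof -
  have "A i \<subseteq> nb W (c i)" using starsD(5)[OF assms(2,3)] assms(4) by (auto simp: nb_def)
  then have "card (A i) \<le> dg W (c i)" unfolding dg_def using assms(1) by (intro card_mono) auto
  then show ?thesis using starsD(4)[OF assms(2,3)] by simp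
qed

text \<open>No star fits outside \<open>T\<close>, so each of the t stars takes a vertex of
  \<open>T\<close> and none is left for the path.\<close>

lemma no_stars_path_join:
  assumes V: "finite V" "T \<subseteq> V" "card T \<le> t" and np: "no_path l (V - T)"
    and dg: "\<And>v i. v \<in> V - T \<Longrightarrow> i \<in> {1..t} \<Longrightarrow> dg (V - T) v < a i"
  shows "\<not> has_stars_path V {1..t} a l"
proof
  assume "has_stars_path V {1..t} a l"
  then obtain c A xs where st: "stars V {1..t} a c A" and xs: "pth xs" "set xs \<subseteq> V" "length xs = l"
    and dj: "\<forall>i\<in>{1..t}. insert (c i) (A i) \<inter> set xs = {}"
    unfolding has_stars_path_def by metis
  have finT: "finite T" using V finite_subset by auto
  have hit: "insert (c i) (A i) \<inter> T \<noteq> {}" if i: "i \<in> {1..t}" for i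
  proof
    assume "insert (c i) (A i) \<inter> T = {}"
    then have "c i \<in> V - T" "A i \<subseteq> V - T" using starsD[OF st i] by auto
    then show False using star_dg[OF _ st i, of "V - T"] dg[OF _ i, of "c i"] V(1) by fastforce
  qed
  have "t + card (set xs \<inter> T) \<le> card T" by (rule stars_hits[OF finT st hit dj])
  then have "card (set xs \<inter> T) = 0" using V(3) by linarith
  then have "set xs \<subseteq> V - T" using finT xs(2) by auto
  then show False using no_pathD[OF np xs(1)] xs(3) by simp
qed

text \<open>Removing q vertices of \<open>T\<close> from a path leaves at most q + 1 runs, and at
  most q if the path begins in \<open>T\<close>; a run of r vertices has r - 1 edges. The last
  summand carries the distinction through the induction.\<close>

lemma path_edges_outside:
  assumes "pth xs" "xs \<noteq> []"
  shows "length xs \<le> ne (set xs - T) + 2 * card (set xs \<inter> T) + (if hd xs \<in> T then 0 else 1)"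
  using assms
proof (induction xs)
  case (Cons x xs)
  have x: "x \<notin> set xs" "pth xs" using Cons.prems by (auto simp: pth_Cons)
  show ?case
  proof (cases "xs = []")
    case True
    then show ?thesis by (cases "x \<in> T") auto
  next
    case False
    then have IH: "length xs \<le> ne (set xs - T) + 2 * card (set xs \<inter> T) + (if hd xs \<in> T then 0 else 1)"
      using Cons.IH x by simp
    have ad: "adj x (hd xs)" using Cons.prems False by (simp add: pth_Cons)
    show ?thesis
    proof (cases "x \<in> T")
      case True
      then have "set (x # xs) - T = set xs - T" "set (x # xs) \<inter> T = insert x (set xs \<inter> T)" by auto
      then show ?thesis using IH x True by (simp split: if_splits)
    next
      case nT: False
      then have e: "set (x # xs) - T = insert x (set xs - T)" "set (x # xs) \<inter> T = set xs \<inter> T" by auto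
      have n: "ne (insert x (set xs - T)) = ne (set xs - T) + dg (set xs - T) x"
        using x by (intro ne_insert) auto
      show ?thesis
      proof (cases "hd xs \<in> T")
        case True
        then show ?thesis using IH nT unfolding e n by simp
      next
        case hT: False
        then have "hd xs \<in> nb (set xs - T) x" using ad False by (auto simp: nb_def)
        then have "dg (set xs - T) x \<ge> 1" unfolding dg_def
          by (metis One_nat_def Suc_leI card_gt_0_iff empty_iff finite_Diff finite_nb List.finite_set)
        then show ?thesis using IH nT hT unfolding e n by simp
      qed
    qed
  qed
qed simp

text \<open>A star has more edges than there are outside \<open>T\<close>, so the stars take t
  vertices of \<open>T\<close> and the path at most k. With one edge outside,
  \<open>path_edges_outside\<close> then allows 2k + 2 vertices at most.\<close>

lemma no_stars_path_near_independent:
  assumes V: "finite V" "T \<subseteq> V" "card T \<le> t + k" and one: "ne (V - T) \<le> 1"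
    and a: "\<And>i. i \<in> {1..t} \<Longrightarrow> a i \<ge> 3"
  shows "\<not> has_stars_path V {1..t} a (2 * k + 3)"
proof
  assume "has_stars_path V {1..t} a (2 * k + 3)"
  then obtain c A xs where st: "stars V {1..t} a c A" and xs: "pth xs" "set xs \<subseteq> V" "length xs = 2 * k + 3"
    and dj: "\<forall>i\<in>{1..t}. insert (c i) (A i) \<inter> set xs = {}"
    unfolding has_stars_path_def by metis
  have finT: "finite T" using V finite_subset by auto
  have hit: "insert (c i) (A i) \<inter> T \<noteq> {}" if i: "i \<in> {1..t}" for i
  proof
    assume "insert (c i) (A i) \<inter> T = {}"
    then have c: "c i \<in> V - T" "A i \<subseteq> V - T" using starsD[OF st i] by auto
    then have "a i \<le> dg (V - T) (c i)" using star_dg[OF _ st i, of "V - T"] V(1) by simp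
    then show False using ne_remove[OF _ c(1)] V(1) one a[OF i] by simp
  qed
  have "t + card (set xs \<inter> T) \<le> card T" by (rule stars_hits[OF finT st hit dj])
  then have "card (set xs \<inter> T) \<le> k" using V(3) by simp
  moreover have "ne (set xs - T) \<le> ne (V - T)" using xs V by (intro ne_mono) auto
  moreover have "xs \<noteq> []" using xs(3) by auto
  ultimately show False using path_edges_outside[OF xs(1), of T] xs(3) one by (simp split: if_splits)
qed

end

text \<open>These notions depend only on the edges inside \<open>W\<close>, so they pass between a
  construction and the parts from which it is assembled.\<close>

lemma same_edges:
  assumes E: "two_graph E" "two_graph E'" "{e \<in> E. e \<subseteq> W} = {e \<in> E'. e \<subseteq> W}"
  shows "v \<in> W \<Longrightarrow> two_graph.dg E W v = two_graph.dg E' W v"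
    "two_graph.no_path E l W = two_graph.no_path E' l W"
    "two_graph.ne E W = two_graph.ne E' W"
proof -
  interpret A: two_graph E by fact
  interpret B: two_graph E' by fact
  have adj: "A.adj u v = B.adj u v" if "u \<in> W" "v \<in> W" for u v
  proof -
    have "{u, v} \<in> {e \<in> E. e \<subseteq> W} \<longleftrightarrow> {u, v} \<in> {e \<in> E'. e \<subseteq> W}" using E(3) by simp
    then show ?thesis using that by (simp add: A.adj_def B.adj_def)
  qed
  then show "v \<in> W \<Longrightarrow> A.dg W v = B.dg W v"
    unfolding A.dg_def B.dg_def A.nb_def B.nb_def by (metis (no_types, lifting) Collect_cong)
  have "A.pth xs = B.pth xs" if "set xs \<subseteq> W" for xs
  proof -
    have "A.adj (xs ! i) (xs ! Suc i) = B.adj (xs ! i) (xs ! Suc i)" if "Suc i < length xs" for i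
      using adj \<open>set xs \<subseteq> W\<close> that by (simp add: subset_iff)
    then show ?thesis unfolding A.pth_nth B.pth_nth by simp
  qed
  then show "A.no_path l W = B.no_path l W" unfolding A.no_path_def B.no_path_def by (intro iff_allI) auto
  show "A.ne W = B.ne W" unfolding A.ne_def B.ne_def using E(3) by simp
qed

lemma extremal_lower:
  assumes G: "G \<in> extremal n (star_forest t a \<squnion>\<^sub>G path_graph l)"
    and V: "finite (V :: nat set)" "card V = n" and E: "E \<subseteq> all_pairs V"
    and no: "\<not> two_graph.has_stars_path E V {1..t} a l"
  shows "two_graph.ne E V \<le> card (edges G)"
proof -
  let ?G = "\<lparr>verts = V, edges = E\<rparr>"
  have s: "simple_graph ?G" using V E by (simp add: simple_graph_def)
  then have "is_free (star_forest t a \<squnion>\<^sub>G path_graph l) ?G"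
    using not_free_stars_path[OF s] no by auto
  then have "card E \<le> card (edges G)" using G s V(2) unfolding extremal_def by fastforce
  moreover have "two_graph.ne E V = card E"
  proof -
    have "{e \<in> E. e \<subseteq> V} = E" using E by (auto simp: all_pairs_def)
    then show ?thesis using two_graph.ne_def[OF two_graph_subset[OF E], of V] by simp
  qed
  ultimately show ?thesis by simp
qed

text \<open>The comparison graph is K_{t+k} joined to the single edge \<open>e0\<close> and isolated
  vertices.\<close>

lemma lower_near_independent:
  assumes G: "G \<in> extremal n (star_forest t a \<squnion>\<^sub>G path_graph (2 * k + 3))"
    and n: "n \<ge> t + k + 2" and a: "\<And>i. i \<in> {1..t} \<Longrightarrow> a i \<ge> 3"
  shows "2 * int (card (edges G)) \<ge> int n * (int n - 1) - (int n - int (t + k)) * (int n - int (t + k) - 1) + 2"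
proof -
  let ?V = "{..<n}" and ?T = "{..<t + k}"
  define e0 where "e0 = {t + k, t + k + 1}"
  define E where "E = insert e0 (cross ?V ?T)"
  have E: "E \<subseteq> all_pairs ?V" using n by (auto simp: E_def cross_def all_pairs_def e0_def)
  interpret two_graph E by (rule two_graph_subset[OF E])
  have TV: "?T \<subseteq> ?V" using n by auto
  have "{e \<in> E. e \<subseteq> ?V - ?T} = {e0}" using n by (auto simp: E_def e0_def cross_def)
  then have one: "ne (?V - ?T) = 1" by (simp add: ne_def)
  have "missing ?V ?T = 0" unfolding missing_def by (auto simp: E_def)
  then have "2 * int (ne ?V) = int n * (int n - 1) - (int n - int (t + k)) * (int n - int (t + k) - 1) + 2"
    using edge_count[of ?V ?T] TV one by simp
  moreover have "\<not> has_stars_path ?V {1..t} a (2 * k + 3)"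
    using no_stars_path_near_independent[of ?V ?T t k a] TV one a by simp
  then have "ne ?V \<le> card (edges G)" using extremal_lower[OF G _ _ E] by simp
  ultimately show ?thesis by linarith
qed

lemma lower_join:
  assumes G: "G \<in> extremal n (star_forest t a \<squnion>\<^sub>G path_graph l)" and n: "t \<le> n"
    and E': "E' \<subseteq> all_pairs {t..<n}" "two_graph.no_path E' l {t..<n}"
      "\<And>v i. v \<in> {t..<n} \<Longrightarrow> i \<in> {1..t} \<Longrightarrow> two_graph.dg E' {t..<n} v < a i"
  shows "2 * int (card (edges G)) \<ge> int n * (int n - 1) - (int n - int t) * (int n - int t - 1)
     + 2 * int (two_graph.ne E' {t..<n})"
proof -
  let ?V = "{..<n}" and ?T = "{..<t}"
  define E where "E = E' \<union> cross ?V ?T"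
  have ss: "all_pairs {t..<n} \<subseteq> all_pairs ?V" by (auto simp: all_pairs_def)
  have E: "E \<subseteq> all_pairs ?V" using E'(1) ss by (auto simp: E_def cross_def)
  interpret two_graph E by (rule two_graph_subset[OF E])
  have TV: "?T \<subseteq> ?V" using n by auto
  have VT: "?V - ?T = {t..<n}" by auto
  have "{e \<in> E. e \<subseteq> {t..<n}} = {e \<in> E'. e \<subseteq> {t..<n}}" by (auto simp: E_def cross_def)
  note s = same_edges[OF two_graph_subset[OF E] two_graph_subset[OF E'(1)] this]
  have "missing ?V ?T = 0" unfolding missing_def by (auto simp: E_def)
  then have "2 * int (ne ?V) = int n * (int n - 1) - (int n - int t) * (int n - int t - 1)
     + 2 * int (two_graph.ne E' {t..<n})"
    using edge_count[of ?V ?T] TV s(3) by (simp add: VT)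
  moreover have "\<not> has_stars_path ?V {1..t} a l"
    using no_stars_path_join[of ?V ?T t l a] TV E'(2,3) s(1,2) by (simp add: VT)
  then have "ne ?V \<le> card (edges G)" using extremal_lower[OF G _ _ E] by simp
  ultimately show ?thesis by linarith
qed

section \<open>Constructions from disjoint small blocks\<close>

lemma disjoint_edge_union:
  assumes V: "finite V1" "finite V2" "V1 \<inter> V2 = {}" and E: "E1 \<subseteq> all_pairs V1" "E2 \<subseteq> all_pairs V2"
  shows "E1 \<union> E2 \<subseteq> all_pairs (V1 \<union> V2)"
    and "v \<in> V1 \<Longrightarrow> two_graph.dg (E1 \<union> E2) (V1 \<union> V2) v = two_graph.dg E1 V1 v"
    and "v \<in> V2 \<Longrightarrow> two_graph.dg (E1 \<union> E2) (V1 \<union> V2) v = two_graph.dg E2 V2 v"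
    and "two_graph.no_path E1 l V1 \<Longrightarrow> two_graph.no_path E2 l V2 \<Longrightarrow> two_graph.no_path (E1 \<union> E2) l (V1 \<union> V2)"
    and "two_graph.ne (E1 \<union> E2) (V1 \<union> V2) = two_graph.ne E1 V1 + two_graph.ne E2 V2"
proof -
  show EE: "E1 \<union> E2 \<subseteq> all_pairs (V1 \<union> V2)" using E by (auto simp: all_pairs_def)
  interpret two_graph "E1 \<union> E2" by (rule two_graph_subset[OF EE])
  have ne1: "e \<noteq> {}" if "e \<in> E1 \<union> E2" for e using card2[OF that] by auto
  have e1: "{e \<in> E1 \<union> E2. e \<subseteq> V1} = {e \<in> E1. e \<subseteq> V1}"
  proof -
    have "\<not> e \<subseteq> V1" if "e \<in> E2" for e
    proof -
      have "e \<subseteq> V2" using that E(2) by (auto simp: all_pairs_def)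
      then show ?thesis using ne1[of e] that V(3) by (metis Int_greatest UnI2 subset_empty)
    qed
    then show ?thesis by auto
  qed
  have e2: "{e \<in> E1 \<union> E2. e \<subseteq> V2} = {e \<in> E2. e \<subseteq> V2}"
  proof -
    have "\<not> e \<subseteq> V2" if "e \<in> E1" for e
    proof -
      have "e \<subseteq> V1" using that E(1) by (auto simp: all_pairs_def)
      then show ?thesis using ne1[of e] that V(3) by (metis Int_greatest UnI1 subset_empty)
    qed
    then show ?thesis by auto
  qed
  note s1 = same_edges[OF two_graph_subset[OF EE] two_graph_subset[OF E(1)] e1]
  note s2 = same_edges[OF two_graph_subset[OF EE] two_graph_subset[OF E(2)] e2]
  have na: "\<not> adj x y" if "x \<in> V1" "y \<in> V2" for x y
  proof -
    have "{x, y} \<notin> E1" using that E(1) V(3) by (auto simp: all_pairs_def)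
    moreover have "{x, y} \<notin> E2" using that E(2) V(3) by (auto simp: all_pairs_def)
    ultimately show ?thesis by (simp add: adj_def)
  qed
  have "nb (V1 \<union> V2) v = nb V1 v" if "v \<in> V1" for v
    using na[OF that] by (auto simp: nb_def)
  then show "dg (V1 \<union> V2) v = two_graph.dg E1 V1 v" if "v \<in> V1" using that s1(1) by (simp add: dg_def)
  have "nb (V1 \<union> V2) v = nb V2 v" if "v \<in> V2" for v
    using na[of _ v] that adj_sym by (auto simp: nb_def)
  then show "dg (V1 \<union> V2) v = two_graph.dg E2 V2 v" if "v \<in> V2" using that s2(1) by (simp add: dg_def)
  have "ne (V1 \<union> V2) = ne V1 + ne (V1 \<union> V2 - V1)" using na V by (intro ne_closed) auto
  moreover have "V1 \<union> V2 - V1 = V2" using V(3) by auto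
  ultimately show "ne (V1 \<union> V2) = two_graph.ne E1 V1 + two_graph.ne E2 V2" using s1(3) s2(3) by simp
  have side: "set xs \<subseteq> V1 \<or> set xs \<subseteq> V2" if "pth xs" "set xs \<subseteq> V1 \<union> V2" for xs
    using that
  proof (induction xs)
    case (Cons x xs)
    then have IH: "set xs \<subseteq> V1 \<or> set xs \<subseteq> V2" "xs = [] \<or> adj x (hd xs)" by (auto simp: pth_Cons)
    show ?case
    proof (cases "xs = []")
      case True
      then show ?thesis using Cons.prems by auto
    next
      case False
      then have h: "hd xs \<in> set xs" "adj x (hd xs)" "adj (hd xs) x" using IH(2) adj_sym by auto
      have xx: "x \<in> V1 \<or> x \<in> V2" using Cons.prems(2) by auto
      from IH(1) show ?thesis
      proof
        assume "set xs \<subseteq> V1"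
        then show ?thesis using na[of "hd xs" x] h xx by auto
      next
        assume "set xs \<subseteq> V2"
        then show ?thesis using na[of x "hd xs"] h xx by auto
      qed
    qed
  qed simp
  show "no_path l (V1 \<union> V2)" if np: "two_graph.no_path E1 l V1" "two_graph.no_path E2 l V2"
  proof -
    have n: "no_path l V1" "no_path l V2" using np s1(2) s2(2) by simp_all
    have "length xs < l" if "pth xs" "set xs \<subseteq> V1 \<union> V2" for xs
      using side[OF that] no_pathD[OF n(1) that(1)] no_pathD[OF n(2) that(1)] by (elim disjE) auto
    then show ?thesis unfolding no_path_def by simp
  qed
qed

lemma no_path_card:
  assumes "E \<subseteq> all_pairs V" "finite V" "card V < l" shows "two_graph.no_path E l V"
proof -
  interpret two_graph E by (rule two_graph_subset[OF assms(1)])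
  show ?thesis unfolding no_path_def using pth_length_le[OF assms(2)] assms(3) by fastforce
qed

lemma disjoint_cliques:
  assumes "m \<ge> 1" "finite V"
  shows "\<exists>E. E \<subseteq> all_pairs V \<and> two_graph.no_path E (2 * m + 1) V \<and>
    (\<forall>v\<in>V. two_graph.dg E V v < 2 * m) \<and> 2 * int (two_graph.ne E V) = fs_bound m (card V)"
  using assms(2)
proof (induction "card V" arbitrary: V rule: less_induct)
  case less
  have ap: "2 * int (two_graph.ne (all_pairs X) X) = int (card X) * (int (card X) - 1)" if "finite X" for X :: "'a set"
  proof -
    have "{e \<in> all_pairs X. e \<subseteq> X} = all_pairs X" by (auto simp: all_pairs_def)
    then show ?thesis using card_all_pairs[OF that] two_graph.ne_def[OF two_graph_subset[OF order_refl], of X X]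
      by simp
  qed
  have ad: "two_graph.dg (all_pairs X) X v < 2 * m" if "finite X" "card X \<le> 2 * m" "v \<in> X" for X :: "'a set" and v
    using all_pairs_dg[OF that(3) order_refl] that card_gt_0_iff[of X] by fastforce
  show ?case
  proof (cases "card V \<le> 2 * m")
    case True
    then show ?thesis using ap ad less.prems fs_bound_small[OF True] no_path_card[of "all_pairs V" V]
      by (intro exI[of _ "all_pairs V"]) auto
  next
    case False
    then obtain X where X: "X \<subseteq> V" "card X = 2 * m" using obtain_subset_with_card_n[of "2 * m" V] by auto
    have fX: "finite X" using X less.prems finite_subset by auto
    have c: "card V = 2 * m + card (V - X)"
      using X less.prems False by (simp add: card_Diff_subset fX)
    then have "card (V - X) < card V" using assms(1) by simp
    then obtain E where E: "E \<subseteq> all_pairs (V - X)" "two_graph.no_path E (2 * m + 1) (V - X)"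
      "\<forall>v\<in>V - X. two_graph.dg E (V - X) v < 2 * m"
      "2 * int (two_graph.ne E (V - X)) = fs_bound m (card (V - X))"
      using less.hyps[of "V - X"] less.prems by auto
    note u = disjoint_edge_union[of X "V - X" "all_pairs X" E, OF fX _ _ order_refl E(1)]
    have VX: "X \<union> (V - X) = V" "X \<union> V = V" using X by auto
    let ?E = "all_pairs X \<union> E"
    have "?E \<subseteq> all_pairs V" using u(1) less.prems by (simp add: VX)
    moreover have "two_graph.no_path ?E (2 * m + 1) V"
      using u(4)[of "2 * m + 1"] less.prems E(2) no_path_card[of "all_pairs X" X] X fX by (simp add: VX)
    moreover have "two_graph.dg ?E V v < 2 * m" if "v \<in> V" for v
      using u(2,3)[of v] E(3) that less.prems ad[OF fX] X(2) by (cases "v \<in> X") (auto simp: VX)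
    moreover have "2 * int (two_graph.ne ?E V) = fs_bound m (card V)"
    proof -
      have "2 * int (two_graph.ne ?E V) = int (2 * m) * (int (2 * m) - 1) + fs_bound m (card (V - X))"
        using u(5) less.prems ap[OF fX] X(2) E(4) by (simp add: VX)
      also have "\<dots> = fs_bound m (card V)" unfolding c fs_bound_def by (simp add: algebra_simps)
      finally show ?thesis .
    qed
    ultimately show ?thesis by (intro exI[of _ ?E]) simp
  qed
qed

text \<open>With K_{2k+1} this provides 2k-regular blocks of two consecutive sizes, both too small
  for a path on 2k + 3 vertices.\<close>

lemma complement_of_matching:
  assumes V: "finite V" "card V = 2 * k + 2"
  shows "\<exists>E. E \<subseteq> all_pairs V \<and> (\<forall>v\<in>V. two_graph.dg E V v = 2 * k)"
proof -
  let ?I = "{0..<2 * k + 2}"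
  obtain h where h: "bij_betw h ?I V" using ex_bij_betw_nat_finite[OF V(1)] V(2) by auto
  \<comment> \<open>The partner in the deleted perfect matching: 2i and 2i + 1 are
    exchanged.\<close>
  define q where "q = (\<lambda>i::nat. if even i then i + 1 else i - 1)"
  have "q i < 2 * k + 2" if "i < 2 * k + 2" for i
    using that unfolding q_def by (cases "even i") (simp_all, presburger)
  moreover have "q (q i) = i" "q i \<noteq> i" for i by (auto simp: q_def elim!: evenE oddE)
  ultimately have q: "q i \<in> ?I" "q (q i) = i" "q i \<noteq> i" if "i \<in> ?I" for i
    using that by auto
  define E where "E = {{h i, h j} | i j. i \<in> ?I \<and> j \<in> ?I \<and> i \<noteq> j \<and> j \<noteq> q i}"
  have inj: "inj_on h ?I" and im: "h ` ?I = V" using h by (auto simp: bij_betw_def)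
  have E: "E \<subseteq> all_pairs V"
  proof
    fix e assume "e \<in> E"
    then obtain i j where ij: "e = {h i, h j}" "i \<in> ?I" "j \<in> ?I" "i \<noteq> j"
      by (auto simp: E_def)
    then have "h i \<noteq> h j" using inj by (meson inj_onD)
    then show "e \<in> all_pairs V" using ij im by (auto simp: all_pairs_def)
  qed
  interpret two_graph E by (rule two_graph_subset[OF E])
  have "dg V v = 2 * k" if "v \<in> V" for v
  proof -
    have "v \<in> h ` ?I" using that by (simp only: im)
    then obtain i where i: "i \<in> ?I" "v = h i" by (auto simp only: image_iff)
    have adj_iff: "adj (h i) (h j) \<longleftrightarrow> j \<noteq> i \<and> j \<noteq> q i" if j: "j \<in> ?I" for j
    proof
      assume "adj (h i) (h j)"
      then have "{h i, h j} \<in> E" by (simp only: adj_def)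
      then obtain i' j' where r: "{h i, h j} = {h i', h j'}" "i' \<in> ?I" "j' \<in> ?I"
        "i' \<noteq> j'" "j' \<noteq> q i'" unfolding E_def by (elim CollectE exE conjE)
      then have "h i = h i' \<and> h j = h j' \<or> h i = h j' \<and> h j = h i'" by (auto simp: doubleton_eq_iff)
      then have "i = i' \<and> j = j' \<or> i = j' \<and> j = i'" using inj_onD[OF inj] i(1) j r(2,3) by metis
      then show "j \<noteq> i \<and> j \<noteq> q i" using r q(2) i(1) by metis
    next
      assume "j \<noteq> i \<and> j \<noteq> q i"
      then have "{h i, h j} \<in> E" unfolding E_def using i(1) j
        by (intro CollectI exI[of _ i] exI[of _ j]) simp
      then show "adj (h i) (h j)" by (simp only: adj_def)
    qed
    have "nb V v = h ` (?I - {i, q i})"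
      unfolding nb_def im[symmetric] i(2) using adj_iff by auto
    moreover have "card (h ` (?I - {i, q i})) = card (?I - {i, q i})"
      by (intro card_image inj_on_subset[OF inj]) auto
    moreover have "card (?I - {i, q i}) = 2 * k"
      using q[OF i(1)] i(1) by (subst card_Diff_subset) auto
    ultimately show ?thesis by (simp add: dg_def)
  qed
  then show ?thesis using E by blast
qed

lemma regular_blocks:
  assumes "finite V" "card V = x * (2 * k + 1) + y * (2 * k + 2)"
  shows "\<exists>E. E \<subseteq> all_pairs V \<and> two_graph.no_path E (2 * k + 3) V \<and> (\<forall>v\<in>V. two_graph.dg E V v = 2 * k)"
  using assms
proof (induction "x + y" arbitrary: x y V)
  case 0
  then have "V = {}" by simp
  then show ?case using no_path_card[of "{}" "{}" "2 * k + 3"] by (intro exI[of _ "{}"]) auto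
next
  case (Suc z)
  have step: ?case if X: "X \<subseteq> V" "E1 \<subseteq> all_pairs X" "\<forall>v\<in>X. two_graph.dg E1 X v = 2 * k" "card X \<le> 2 * k + 2"
    and r: "z = x' + y'" "card (V - X) = x' * (2 * k + 1) + y' * (2 * k + 2)" for X E1 x' y'
  proof -
    have fX: "finite X" using X Suc.prems finite_subset by auto
    obtain E where E: "E \<subseteq> all_pairs (V - X)" "two_graph.no_path E (2 * k + 3) (V - X)"
      "\<forall>v\<in>V - X. two_graph.dg E (V - X) v = 2 * k"
      using Suc.hyps(1)[OF r(1) _ r(2)] Suc.prems by auto
    note u = disjoint_edge_union[of X "V - X" E1 E, OF fX _ _ X(2) E(1)]
    have VX: "X \<union> (V - X) = V" "X \<union> V = V" using X by auto
    have "E1 \<union> E \<subseteq> all_pairs V" using u(1) Suc.prems by (simp add: VX)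
    moreover have "two_graph.no_path (E1 \<union> E) (2 * k + 3) V"
      using u(4)[of "2 * k + 3"] Suc.prems E(2) no_path_card[of E1 X] X fX by (simp add: VX)
    moreover have "two_graph.dg (E1 \<union> E) V v = 2 * k" if "v \<in> V" for v
      using u(2,3)[of v] E(3) that Suc.prems X(3) by (cases "v \<in> X") (auto simp: VX)
    ultimately show ?thesis by (intro exI[of _ "E1 \<union> E"]) simp
  qed
  show ?case
  proof (cases x)
    case (Suc x')
    then have "2 * k + 1 \<le> card V" using Suc.prems by simp
    then obtain X where X: "X \<subseteq> V" "card X = 2 * k + 1" using obtain_subset_with_card_n by metis
    have fX: "finite X" using X Suc.prems finite_subset by auto
    have "\<forall>v\<in>X. two_graph.dg (all_pairs X) X v = 2 * k" using all_pairs_dg[of _ X X] X fX by auto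
    then show ?thesis using X Suc \<open>Suc z = x + y\<close> Suc.prems fX
      by (intro step[of X "all_pairs X" x' y]) (auto simp: card_Diff_subset)
  next
    case 0
    then obtain y' where y': "y = Suc y'" using \<open>Suc z = x + y\<close> by (cases y) auto
    then have "2 * k + 2 \<le> card V" using Suc.prems 0 by simp
    then obtain X where X: "X \<subseteq> V" "card X = 2 * k + 2" using obtain_subset_with_card_n by metis
    have fX: "finite X" using X Suc.prems finite_subset by auto
    obtain E1 where "E1 \<subseteq> all_pairs X" "\<forall>v\<in>X. two_graph.dg E1 X v = 2 * k"
      using complement_of_matching[OF fX X(2)] by blast
    then show ?thesis using X 0 y' \<open>Suc z = x + y\<close> Suc.prems fX
      by (intro step[of X E1 0 y']) (auto simp: card_Diff_subset)
  qed
qed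

lemma lower_regular:
  assumes G: "G \<in> extremal n (star_forest t a \<squnion>\<^sub>G path_graph (2 * k + 3))"
    and n: "n \<ge> t + (2 * k + 1) * (2 * k + 1)" and a: "\<And>i. i \<in> {1..t} \<Longrightarrow> a i > 2 * k"
  shows "2 * int (card (edges G)) \<ge> int n * (int n - 1) - (int n - int t) * (int n - int t - 1)
     + 2 * int k * (int n - int t)"
proof -
  let ?b = "2 * k + 1"
  \<comment> \<open>The remainder y is absorbed by enlarging y of the blocks of size 2k + 1 by one
    vertex. The quotient is at least 2k + 1 and hence at least y, which is where the square in the
    bound on n comes from.\<close>
  define y where "y = (n - t) mod ?b"
  have y: "y < ?b" by (simp add: y_def)
  have "?b * ?b \<le> n - t" using n by simp
  then have "?b \<le> (n - t) div ?b" by (metis div_le_mono nonzero_mult_div_cancel_right add_is_0 one_neq_zero)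
  then obtain x where x: "(n - t) div ?b = x + y" using y by (metis add.commute le_add_diff_inverse less_imp_le_nat order_trans)
  have "n - t = (n - t) div ?b * ?b + y" unfolding y_def by (rule div_mult_mod_eq[symmetric])
  also have "\<dots> = x * ?b + y * (2 * k + 2)" unfolding x by (simp add: algebra_simps)
  finally obtain E where E: "E \<subseteq> all_pairs {t..<n}" "two_graph.no_path E (2 * k + 3) {t..<n}"
    "\<forall>v\<in>{t..<n}. two_graph.dg E {t..<n} v = 2 * k"
    using regular_blocks[of "{t..<n}" x k y] by auto
  interpret two_graph E by (rule two_graph_subset[OF E(1)])
  have "2 * ne {t..<n} = (n - t) * (2 * k)" using handshake[of "{t..<n}"] E(3) by simp
  then have "2 * int (ne {t..<n}) = int ((n - t) * (2 * k))" by linarith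
  then have "2 * int (ne {t..<n}) = 2 * int k * (int n - int t)" using n by simp
  then show ?thesis using lower_join[OF G _ E(1,2)] E(3) a n by simp
qed

lemma lower_cliques:
  assumes G: "G \<in> extremal n (star_forest t a \<squnion>\<^sub>G path_graph (2 * k + 3))"
    and n: "n \<ge> t" and a: "\<And>i. i \<in> {1..t} \<Longrightarrow> a i \<ge> 2 * k + 2"
  shows "2 * int (card (edges G)) \<ge> int n * (int n - 1) - (int n - int t) * (int n - int t - 1)
     + fs_bound (k + 1) (n - t)"
proof -
  have e: "2 * (k + 1) = 2 * k + 2" "2 * k + 2 + 1 = 2 * k + 3" by simp_all
  have "k + 1 \<ge> 1" "finite {t..<n}" by simp_all
  from disjoint_cliques[OF this, unfolded e card_atLeastLessThan] obtain E where E: "E \<subseteq> all_pairs {t..<n}" "two_graph.no_path E (2 * k + 3) {t..<n}"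
    "\<forall>v\<in>{t..<n}. two_graph.dg E {t..<n} v < 2 * k + 2"
    "2 * int (two_graph.ne E {t..<n}) = fs_bound (k + 1) (n - t)"
    by (elim exE conjE)
  have "two_graph.dg E {t..<n} v < a i" if "v \<in> {t..<n}" "i \<in> {1..t}" for v i
    using E(3) a that by (meson less_le_trans)
  then show ?thesis using lower_join[OF G n E(1,2)] E(4) by simp
qed

section \<open>Vertices of large degree\<close>

context two_graph
begin

text \<open>The degree bound has room for all that is to be avoided: \<open>X\<close>, the other
  centres and the leaves chosen so far. Each finished star is moved into \<open>X\<close>, which is
  why \<open>X\<close> varies in the induction.\<close>

lemma greedy_stars:
  assumes "finite I" "finite V" "inj_on c I" "\<And>i. i \<in> I \<Longrightarrow> c i \<in> V" "finite X" "c ` I \<inter> X = {}"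
    "\<And>i. i \<in> I \<Longrightarrow> card X + (\<Sum>j\<in>I. a j + 1) \<le> dg V (c i)"
  shows "\<exists>A. stars V I a c A \<and> (\<forall>i\<in>I. insert (c i) (A i) \<inter> X = {})"
  using assms(1,3-)
proof (induction I arbitrary: X rule: finite_induct)
  case empty
  then show ?case by (simp add: stars_def)
next
  case (insert j I)
  have cj: "c j \<in> V" "c j \<notin> X" "c j \<notin> c ` I" using insert.prems insert.hyps by (auto simp: inj_on_def)
  have sm: "(\<Sum>i\<in>insert j I. a i + 1) = a j + 1 + (\<Sum>i\<in>I. a i + 1)" using insert.hyps by simp
  have "card I \<le> (\<Sum>i\<in>I. a i + 1)"
    using sum_mono[of I "\<lambda>_. 1" "\<lambda>i. a i + 1"] by simp
  then have "card X + card I + a j \<le> dg V (c j)" using insert.prems(5)[of j] sm by simp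
  moreover have "card (X \<union> c ` I) \<le> card X + card I"
    by (meson add_left_mono card_Un_le card_image_le insert.hyps(1) le_trans)
  moreover have "dg V (c j) - card (X \<union> c ` I) \<le> card (nb V (c j) - (X \<union> c ` I))"
    unfolding dg_def using insert.prems(3) insert.hyps by (intro diff_card_le_card_Diff) auto
  ultimately have "a j \<le> card (nb V (c j) - (X \<union> c ` I))" by linarith
  then obtain B where B: "B \<subseteq> nb V (c j) - (X \<union> c ` I)" "card B = a j" "finite B"
    using obtain_subset_with_card_n by metis
  have cjB: "c j \<notin> B" using B(1) by (auto simp: nb_def)
  define X' where "X' = X \<union> insert (c j) B"
  have "card X' \<le> card X + (a j + 1)" unfolding X'_def
    using card_Un_le[of X "insert (c j) B"] B cjB by simp
  then have "card X' + (\<Sum>i\<in>I. a i + 1) \<le> dg V (c i)" if "i \<in> I" for i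
    using insert.prems(5)[of i] that sm by simp
  moreover have "inj_on c I" using insert.prems(1) by simp
  moreover have "c ` I \<inter> X' = {}" using insert.prems(4) B(1) cj(3) by (auto simp: X'_def)
  moreover have "finite X'" using insert.prems(3) B(3) by (simp add: X'_def)
  ultimately obtain A where A: "stars V I a c A" "\<forall>i\<in>I. insert (c i) (A i) \<inter> X' = {}"
    using insert.IH[of X'] insert.prems(2) by auto
  define A' where "A' = A(j := B)"
  have A'j: "A' j = B" and A'i: "\<And>i. i \<in> I \<Longrightarrow> A' i = A i" using insert.hyps(2) by (auto simp: A'_def)
  have "stars V (insert j I) a c A'" unfolding stars_def
  proof (intro conjI ballI impI)
    fix i assume i: "i \<in> insert j I"
    show "c i \<in> V" using i insert.prems(2) by blast
    show "A' i \<subseteq> V" using i A'j A'i starsD(2)[OF A(1)] B(1) by (cases "i = j") (auto simp: nb_def)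
    show "finite (A' i)" using i A'j A'i starsD(3)[OF A(1)] B(3) by (cases "i = j") auto
    show "card (A' i) = a i" using i A'j A'i starsD(4)[OF A(1)] B(2) by (cases "i = j") auto
    show "adj (c i) x" if "x \<in> A' i" for x
      using i that A'j A'i starsD(5)[OF A(1)] B(1) by (cases "i = j") (auto simp: nb_def)
    fix l assume l: "l \<in> insert j I" "i \<noteq> l"
    have jX: "insert (c j) (A' j) \<subseteq> X'" by (auto simp: A'j X'_def)
    consider "i = j" "l \<in> I" | "l = j" "i \<in> I" | "i \<in> I" "l \<in> I" using i l by auto
    then show "insert (c i) (A' i) \<inter> insert (c l) (A' l) = {}"
    proof cases
      case 1
      then have "insert (c l) (A' l) \<inter> X' = {}" using A(2) A'i by simp
      then show ?thesis using 1(1) jX by blast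
    next
      case 2
      then have "insert (c i) (A' i) \<inter> X' = {}" using A(2) A'i by simp
      then show ?thesis using 2(1) jX by blast
    next
      case 3
      then show ?thesis using stars_disjoint[OF A(1)] A'i l(2) by simp
    qed
  qed
  moreover have "insert (c i) (A' i) \<inter> X = {}" if "i \<in> insert j I" for i
  proof (cases "i = j")
    case True
    then show ?thesis using B(1) cj(2) A'j by auto
  next
    case False
    then have "insert (c i) (A' i) \<inter> X' = {}" using A(2) A'i that by simp
    then show ?thesis by (auto simp: X'_def)
  qed
  ultimately show ?case by (intro exI[of _ A']) simp
qed

lemma non_neighbours_le_missing:
  assumes "finite V" "v \<in> T" "T \<subseteq> V"
  shows "card {u \<in> V - {v}. \<not> adj v u} \<le> missing V T"
proof -
  have "inj_on (\<lambda>u. {v, u}) {u \<in> V - {v}. \<not> adj v u}" by (auto simp: inj_on_def doubleton_eq_iff)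
  then have "card {u \<in> V - {v}. \<not> adj v u} = card ((\<lambda>u. {v, u}) ` {u \<in> V - {v}. \<not> adj v u})"
    by (simp add: card_image)
  also have "\<dots> \<le> missing V T" unfolding missing_def
    using assms by (intro card_mono) (auto simp: cross_def all_pairs_def adj_def)
  finally show ?thesis .
qed

text \<open>A vertex \<open>v\<close> that sees no dense component away from \<open>S\<close> loses two edges for each edge
  such a component gains, so there are few dense components and \<open>T\<close> is almost completely joined.\<close>

lemma near_full:
  assumes V: "finite V" "T \<subseteq> V" "v \<in> T" and np: "no_path (2 * k + 3) (V - T)"
    and S: "S \<subseteq> V - T" "no_path (2 * k + 3) (insert v (V - T - S))"
    and low: "int (card V) * (int (card V) - 1)
      - (int (card V) - int (card T)) * (int (card V) - int (card T) - 1)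
      + 2 * int k * (int (card V) - int (card T)) - 2 * int k * int k \<le> 2 * int (ne V)"
  shows "missing V T \<le> 2 * (k + 1) * card S + 2 * k * k"
    and "int k * (int (card V) - int (card T)) - int k * int k \<le> int (ne (V - T))"
proof -
  let ?W = "V - T" and ?m = "k + 1" and ?mu = "missing V T"
  have finW: "finite ?W" using V by simp
  then have finS: "finite S" using S(1) by (rule finite_subset[rotated])
  note cW = card_Diff_int[OF V(1,2)]
  have ec: "2 * int k * int (card ?W) - 2 * int k * int k + 2 * int ?mu \<le> 2 * int (ne ?W)"
    using edge_count[OF V(1,2)] low unfolding cW by linarith
  then show "int k * (int (card V) - int (card T)) - int k * int k \<le> int (ne (V - T))" unfolding cW by linarith
  have np': "no_path (2 * ?m + 1) ?W" using np by (simp add: eval_nat_numeral)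
  obtain R where R: "finite R" "pairwise disjnt R"
    "\<forall>X\<in>R. \<exists>xs. cyc xs \<and> set xs = X \<and> X \<subseteq> ?W \<and> length xs = 2 * ?m"
    "2 * ne ?W \<le> 2 * (?m - 1) * card ?W + 2 * ?m * card R"
    using dense_components[OF finW np'] by auto
  \<comment> \<open>At most |S| of the disjoint members of \<open>R\<close> meet \<open>S\<close>. A
    neighbour of \<open>v\<close> in another member would give a path on 2k + 3 vertices, so
    \<open>v\<close> misses all 2(k + 1) vertices of every member of \<open>R0\<close>.\<close>
  define R0 where "R0 = {X \<in> R. X \<inter> S = {}}"
  have "card (R - R0) + card ({} \<inter> S) \<le> card S"
  proof (rule disjoint_hits[OF finS, where S = id])
    show "id X \<inter> S \<noteq> {}" if "X \<in> R - R0" for X using that by (auto simp: R0_def)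
    show "id X \<inter> id Y = {}" if "X \<in> R - R0" "Y \<in> R - R0" "X \<noteq> Y" for X Y
      using R(2) that by (auto simp: pairwise_def disjnt_def)
  qed (use R(1) in auto)
  then have cR: "card R \<le> card R0 + card S" using R(1) by (simp add: R0_def card_Diff_subset)
  have no: "\<not> adj v x" if X: "X \<in> R0" "x \<in> X" for X x
  proof
    assume ad: "adj v x"
    obtain xs where xs: "cyc xs" "set xs = X" "X \<subseteq> ?W" "length xs = 2 * ?m" using X R(3) unfolding R0_def by blast
    have "v \<notin> set xs" using xs V(3) by auto
    then obtain ys where ys: "pth ys" "set ys = insert v (set xs)" "length ys = Suc (length xs)"
      using cyc_extend[OF xs(1), of x v] X(2) xs(2) ad adj_sym by metis
    have "set ys \<subseteq> insert v (?W - S)" using ys(2) xs X(1) by (auto simp: R0_def)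
    then show False using no_pathD[OF S(2) ys(1)] ys(3) xs(4) by simp
  qed
  have R0: "card X = 2 * ?m" "X \<subseteq> ?W" if "X \<in> R0" for X
    using R(3) that pth_card cyc_pth unfolding R0_def by auto
  have "pairwise disjnt R0" using R(2) by (auto simp: R0_def pairwise_def)
  then have "card (\<Union>R0) = (\<Sum>X\<in>R0. 2 * ?m)"
    using R0 by (subst card_Union_disjoint) (auto intro: finite_subset[OF _ finW])
  moreover have "card (\<Union>R0) \<le> card {u \<in> V - {v}. \<not> adj v u}"
    using no R0(2) V by (intro card_mono) auto
  moreover have "\<dots> \<le> ?mu" by (rule non_neighbours_le_missing[OF V(1,3,2)])
  ultimately have a: "2 * ?m * card R0 \<le> ?mu" by (simp add: mult.commute)
  have b: "2 * ?m * card R \<le> 2 * ?m * card R0 + 2 * ?m * card S"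
    using mult_le_mono2[OF cR, of "2 * ?m"] by (simp only: add_mult_distrib2)
  have "2 * int (ne ?W) \<le> int (2 * (?m - 1) * card ?W + 2 * ?m * card R)" using R(4) by linarith
  then have "2 * int (ne ?W) \<le> 2 * int k * int (card ?W) + int (2 * ?m * card R)" by simp
  then have "int ?mu * 2 \<le> int (2 * ?m * card R) + 2 * int k * int k" using ec by linarith
  then have "int ?mu \<le> int (2 * ?m * card S) + 2 * int k * int k" using a b by linarith
  then have "int ?mu \<le> int (2 * ?m * card S + 2 * k * k)" by simp
  then show "?mu \<le> 2 * (k + 1) * card S + 2 * k * k" by linarith
qed

text \<open>Each vertex of \<open>us\<close> is followed by a fresh piece of h vertices in
  \<open>D\<close>; \<open>B\<close> bounds what has been used, so a piece that avoids it always
  exists. Single vertices suffice for alternating paths, while \<open>large_not_between\<close>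
  needs longer pieces.\<close>

lemma weave:
  assumes "pth xs" "xs \<noteq> []" "last xs \<in> D" "distinct us" "set us \<inter> set xs = {}" "set us \<inter> D = {}"
    "\<And>u x. u \<in> set us \<Longrightarrow> x \<in> D \<Longrightarrow> adj u x" "h \<ge> 1"
    "\<And>X. finite X \<Longrightarrow> card X \<le> B \<Longrightarrow> \<exists>p. pth p \<and> length p = h \<and> set p \<subseteq> D - X"
    "length xs + length us * (h + 1) \<le> B"
  shows "\<exists>ys. pth ys \<and> ys \<noteq> [] \<and> length ys = length xs + length us * (h + 1) \<and> last ys \<in> D \<and>
     set ys \<subseteq> set xs \<union> set us \<union> D"
  using assms
proof (induction us arbitrary: xs)
  case Nil
  then show ?case by (intro exI[of _ xs]) auto
next
  case (Cons u us)
  have "card (set xs) \<le> B" using Cons.prems(10) card_length[of xs] by simp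
  then obtain p where p: "pth p" "length p = h" "set p \<subseteq> D - set xs"
    using Cons.prems(9)[of "set xs"] by auto
  have pn: "p \<noteq> []" using p Cons.prems(8) by auto
  then have "hd p \<in> set p" "last p \<in> set p" by simp_all
  then have hp: "hd p \<in> D" "last p \<in> D" using p(3) by auto
  let ?xs = "xs @ u # p"
  have ad: "adj (last xs) u" "adj u (hd p)"
    using Cons.prems(7)[of u "last xs"] Cons.prems(7)[of u "hd p"] Cons.prems(3) hp(1) adj_sym by auto
  have u: "u \<notin> set xs" "u \<notin> set p" using Cons.prems(5,6) p(3) by auto
  have 1: "pth ?xs" using Cons.prems(1,2) p ad u pn by (auto simp: pth_append pth_Cons)
  have 2: "last ?xs \<in> D" using hp pn by simp
  have 3: "set us \<inter> set ?xs = {}" using Cons.prems(4,5,6) p(3) by auto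
  have 4: "length ?xs + length us * (h + 1) = length xs + length (u # us) * (h + 1)" using p(2) by simp
  have "\<exists>ys. pth ys \<and> ys \<noteq> [] \<and> length ys = length ?xs + length us * (h + 1) \<and> last ys \<in> D \<and>
     set ys \<subseteq> set ?xs \<union> set us \<union> D"
    using Cons.prems(4,6-10) 1 2 3 4 by (intro Cons.IH) auto
  then obtain ys where "pth ys" "ys \<noteq> []" "length ys = length ?xs + length us * (h + 1)" "last ys \<in> D"
     "set ys \<subseteq> set ?xs \<union> set us \<union> D" by (elim exE conjE)
  then show ?case using 4 p(3) by (intro exI[of _ ys]) auto
qed

end

locale host = two_graph E for E :: "'a set set" +
  fixes V :: "'a set" and t k :: nat and a :: "nat \<Rightarrow> nat"
  assumes finV: "finite V" and t1: "t \<ge> 1" and k1: "k \<ge> 1"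
    and noF: "\<not> has_stars_path V {1..t} a (2 * k + 3)"
begin

definition star_size :: nat where "star_size = (\<Sum>i\<in>{1..t}. a i + 1)"
text \<open>Room for all stars and for a path on 2k + 3 vertices at once.\<close>

definition M :: nat where "M = star_size + (2 * k + 3)"
definition L :: "'a set" where "L = {v \<in> V. M \<le> dg V v}"

lemma L_subset: "L \<subseteq> V" by (auto simp: L_def)
lemma finL: "finite L" using L_subset finV finite_subset by auto

lemma stars_sup_card:
  assumes "stars W J a c A" "J \<subseteq> {1..t}"
  shows "card (\<Union>i\<in>J. insert (c i) (A i)) \<le> (\<Sum>i\<in>J. a i + 1)"
proof -
  have fJ: "finite J" using assms(2) finite_subset by auto
  then have "card (\<Union>i\<in>J. insert (c i) (A i)) \<le> (\<Sum>i\<in>J. card (insert (c i) (A i)))"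
    by (rule card_UN_le)
  also have "\<dots> \<le> (\<Sum>i\<in>J. a i + 1)"
  proof (rule sum_mono)
    fix i assume "i \<in> J"
    then show "card (insert (c i) (A i)) \<le> a i + 1"
      using starsD(3,4)[OF assms(1)] by (metis Suc_eq_plus1 card_insert_le_m1 card_insert_if le_refl le_Suc_eq)
  qed
  finally show ?thesis .
qed

text \<open>The vertices of \<open>U\<close> take over the stars outside \<open>J\<close>: their
  leaves can be chosen away from the stars kept in place and from any given path, which would
  complete a forbidden copy.\<close>

lemma host_stars:
  assumes J: "J \<subseteq> {1..t}" "stars V J a c A" and U: "U \<subseteq> L" "card U = t - card J"
    and dU: "\<And>i. i \<in> J \<Longrightarrow> insert (c i) (A i) \<inter> U = {}"
  shows "no_path (2 * k + 3) (V - U - (\<Union>i\<in>J. insert (c i) (A i)))"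
proof -
  let ?X = "\<Union>i\<in>J. insert (c i) (A i)" and ?I = "{1..t} - J"
  have False if xs: "pth xs" "set xs \<subseteq> V - U - ?X" "length xs = 2 * k + 3" for xs
  proof -
    have fJ: "finite J" using J(1) finite_subset by auto
    have fU: "finite U" using U(1) finL finite_subset by auto
    have "card ?I = card U" using U(2) J(1) fJ by (simp add: card_Diff_subset)
    then obtain c' where c': "bij_betw c' ?I U" using finite_same_card_bij[of ?I U] fU by auto
    have fX: "finite ?X" using fJ starsD(3)[OF J(2)] by auto
    have c'U: "c' i \<in> U" if "i \<in> ?I" for i using c' that by (auto simp: bij_betw_def)
    have "card (?X \<union> set xs) \<le> (\<Sum>i\<in>J. a i + 1) + (2 * k + 3)"
      using card_Un_le[of ?X "set xs"] stars_sup_card[OF J(2,1)] card_length[of xs] xs(3) by linarith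
    moreover have "(\<Sum>i\<in>?I. a i + 1) + (\<Sum>i\<in>J. a i + 1) = star_size"
      unfolding star_size_def using J(1) by (intro sum.subset_diff[symmetric]) auto
    ultimately have b: "card (?X \<union> set xs) + (\<Sum>i\<in>?I. a i + 1) \<le> M" unfolding M_def by linarith
    have "\<exists>A'. stars V ?I a c' A' \<and> (\<forall>i\<in>?I. insert (c' i) (A' i) \<inter> (?X \<union> set xs) = {})"
    proof (rule greedy_stars)
      show "inj_on c' ?I" using c' by (simp add: bij_betw_def)
      show "c' i \<in> V" if "i \<in> ?I" for i using c'U[OF that] U(1) L_subset by auto
      have "c' ` ?I = U" using c' by (simp add: bij_betw_def)
      moreover have "?X \<inter> U = {}" using dU by blast
      ultimately show "c' ` ?I \<inter> (?X \<union> set xs) = {}" using xs(2) by auto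
      show "card (?X \<union> set xs) + (\<Sum>j\<in>?I. a j + 1) \<le> dg V (c' i)" if "i \<in> ?I" for i
        using c'U[OF that] U(1) b by (auto simp: L_def)
    qed (use finV fX in auto)
    then obtain A' where A': "stars V ?I a c' A'" "\<forall>i\<in>?I. insert (c' i) (A' i) \<inter> (?X \<union> set xs) = {}"
      by (elim exE conjE)
    define c2 where "c2 = (\<lambda>i. if i \<in> J then c i else c' i)"
    define A2 where "A2 = (\<lambda>i. if i \<in> J then A i else A' i)"
    have mixed: "insert (c i) (A i) \<inter> insert (c' j) (A' j) = {}" if "i \<in> J" "j \<in> ?I" for i j
      using A'(2) that by blast
    have "stars V {1..t} a c2 A2" unfolding stars_def
    proof (intro conjI ballI impI)
      fix i assume i: "i \<in> {1..t}"
      show "c2 i \<in> V" "A2 i \<subseteq> V" "finite (A2 i)" "card (A2 i) = a i"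
        using i starsD(1-4)[OF J(2), of i] starsD(1-4)[OF A'(1), of i] by (auto simp: c2_def A2_def)
      show "adj (c2 i) x" if "x \<in> A2 i" for x
        using i that starsD(5)[OF J(2), of i] starsD(5)[OF A'(1), of i] by (auto simp: c2_def A2_def split: if_splits)
      fix j assume j: "j \<in> {1..t}" "i \<noteq> j"
      show "insert (c2 i) (A2 i) \<inter> insert (c2 j) (A2 j) = {}"
        using stars_disjoint[OF J(2), of i j] stars_disjoint[OF A'(1), of i j] mixed[of i j] mixed[of j i] i j
        by (cases "i \<in> J"; cases "j \<in> J") (simp_all add: c2_def A2_def Int_commute)
    qed
    moreover have "insert (c2 i) (A2 i) \<inter> set xs = {}" if "i \<in> {1..t}" for i
    proof (cases "i \<in> J")
      case True
      then have "insert (c i) (A i) \<subseteq> ?X" by blast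
      then show ?thesis using xs(2) True by (auto simp: c2_def A2_def)
    next
      case False
      then have "insert (c' i) (A' i) \<inter> (?X \<union> set xs) = {}" using A'(2) that by simp
      then show ?thesis using False by (auto simp: c2_def A2_def)
    qed
    moreover have "set xs \<subseteq> V" using xs(2) by auto
    ultimately show False using noF xs(1,3) unfolding has_stars_path_def by metis
  qed
  then show ?thesis unfolding no_path_iff by metis
qed

lemma no_path_outside:
  assumes "T \<subseteq> L" "card T = t" shows "no_path (2 * k + 3) (V - T)"
  \<comment> \<open>No star is kept in place, so centres and leaf sets are arbitrary.\<close>
  using host_stars[of "{}" undefined undefined T] assms by (simp add: stars_def)

text \<open>The star with index t is placed by hand at \<open>x\<close>, so one large vertex fewer
  is spent on the stars.\<close>

lemma no_path_with_star:
  assumes "T \<subseteq> L" "card T = t - 1" "x \<in> V - T" "B \<subseteq> nb (V - T) x" "card B = a t"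
  shows "no_path (2 * k + 3) (V - T - insert x B)"
proof -
  have "finite B" using assms(4) finV finite_subset[of B V] nb_subset by fastforce
  moreover have "B \<subseteq> V - T" using assms(4) nb_subset by blast
  ultimately have "stars V {t} a (\<lambda>_. x) (\<lambda>_. B)" "insert x B \<inter> T = {}"
    using assms(3,4,5) by (auto simp: stars_def nb_def)
  then show ?thesis using host_stars[of "{t}" "\<lambda>_. x" "\<lambda>_. B" T] assms(1,2) t1 by simp
qed

text \<open>The large vertices meet at most |L| of the given stars, so enough stars avoid
  \<open>L\<close> and can stay while the large vertices take over the others. In twice the edge
  number, Erdos-Gallai gives 2k + 1 per vertex and the at most t - 1 large vertices give 2(t - 1),
  together one less than the 2(t + k) of the lower bound.\<close>

lemma few_large:
  assumes st: "stars V {1..t} a c A" and few: "card L < t"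
  shows "2 * ne V \<le> (2 * t + 2 * k - 1) * card V + 2 * star_size * M"
proof -
  define S where "S i = insert (c i) (A i)" for i
  define Jall where "Jall = {i \<in> {1..t}. S i \<inter> L = {}}"
  have "card ({1..t} - Jall) + card ({} \<inter> L) \<le> card L"
  proof (rule disjoint_hits[OF finL, where S = S])
    show "S i \<inter> L \<noteq> {}" if "i \<in> {1..t} - Jall" for i using that by (auto simp: Jall_def)
    show "S i \<inter> S j = {}" if "i \<in> {1..t} - Jall" "j \<in> {1..t} - Jall" "i \<noteq> j" for i j
      using stars_disjoint[OF st] that by (auto simp: S_def)
  qed auto
  moreover have "Jall \<subseteq> {1..t}" "finite Jall" by (auto simp: Jall_def)
  ultimately have "t - card L \<le> card Jall" by (simp add: card_Diff_subset)
  then obtain J where J: "J \<subseteq> Jall" "card J = t - card L" using obtain_subset_with_card_n by metis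
  have Jt: "J \<subseteq> {1..t}" using J by (auto simp: Jall_def)
  have stJ: "stars V J a c A" using st Jt unfolding stars_def by (meson subsetD)
  let ?X = "\<Union>i\<in>J. insert (c i) (A i)"
  have np: "no_path (2 * k + 3) (V - L - ?X)"
  proof (rule host_stars[OF Jt stJ order_refl])
    show "card L = t - card J" using J(2) few by simp
    show "insert (c i) (A i) \<inter> L = {}" if "i \<in> J" for i using that J(1) by (auto simp: Jall_def S_def)
  qed
  have cX: "card ?X \<le> star_size"
  proof -
    have "(\<Sum>i\<in>J. a i + 1) \<le> star_size" unfolding star_size_def using Jt by (intro sum_mono2) auto
    then show ?thesis using stars_sup_card[OF stJ Jt] by linarith
  qed
  have fX: "finite ?X" using finite_subset[OF Jt] starsD(3)[OF stJ] by auto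
  have "no_path (2 * (k + 1) + 1) (V - L - ?X)" using np by (simp add: eval_nat_numeral)
  then have "2 * ne (V - L - ?X) \<le> (2 * (k + 1) - 1) * card (V - L - ?X)"
    using finV by (intro erdos_gallai) auto
  also have "\<dots> \<le> (2 * k + 1) * card V" using finV by (intro mult_le_mono card_mono) auto
  finally have a: "2 * ne (V - L - ?X) \<le> (2 * k + 1) * card V" .
  have "ne (V - L) \<le> ne (V - L - ?X) + M * card ?X"
  proof (rule ne_delete_le[OF fX])
    fix x assume "x \<in> ?X \<inter> (V - L)"
    then have "dg V x < M" by (auto simp: L_def)
    then show "dg (V - L) x \<le> M" using dg_mono[of "V - L" V x] finV by auto
  qed (use finV in auto)
  moreover have "M * card ?X \<le> M * star_size" using cX by simp
  ultimately have b: "ne (V - L) \<le> ne (V - L - ?X) + M * star_size" by linarith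
  have "ne V \<le> ne (V - L) + card V * card L"
    using finL finV dg_less_card[OF finV] by (intro ne_delete_le) (auto intro: less_imp_le)
  moreover have "card V * card L \<le> card V * (t - 1)" using few by (intro mult_le_mono) auto
  ultimately have "2 * ne V \<le> 2 * (card V * (t - 1)) + 2 * (M * star_size) + (2 * k + 1) * card V" using a b by linarith
  also have "\<dots> = (2 * t + 2 * k - 1) * card V + 2 * star_size * M"
    using t1 by (cases t) (auto simp: algebra_simps)
  finally show ?thesis .
qed

end

context two_graph
begin

lemma single_vertex_pieces:
  assumes "B < card D" "finite X" "card X \<le> B"
  shows "\<exists>p. pth p \<and> length p = 1 \<and> set p \<subseteq> D - X"
proof -
  have "\<not> D \<subseteq> X" using assms card_mono[of X D] by auto
  then obtain x where "x \<in> D - X" by blast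
  then show ?thesis by (intro exI[of _ "[x]"]) simp
qed

lemma erdos_gallai_path:
  assumes "finite W" "g \<ge> 1" "(2 * g - 1) * card W < 2 * ne W"
  shows "\<exists>p. pth p \<and> length p = 2 * g + 1 \<and> set p \<subseteq> W"
  using erdos_gallai[OF assms(1) _ assms(2)] assms(3) unfolding no_path_iff by (meson not_le)

end

section \<open>The possible numbers of large vertices\<close>

context host
begin

text \<open>Once t vertices are removed this asks for k edges per vertex up to a constant. That
  exceeds the Erdos-Gallai bound for paths on 2k + 1 vertices by a linear amount.\<close>

definition weakly_dense :: bool where
  "weakly_dense \<longleftrightarrow> int (card V) * (int (card V) - 1) - (int (card V) - int t) * (int (card V) - int t - 1)
      + 2 * int k * (int (card V) - int t) - 2 * int k * int k \<le> 2 * int (ne V)"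

lemma dg_outside:
  assumes "W \<subseteq> V" "x \<in> V - L" shows "dg W x \<le> M"
proof -
  have "dg V x < M" using assms(2) by (auto simp: L_def)
  moreover have "dg W x \<le> dg V x" using dg_mono[OF assms(1) finV] .
  ultimately show ?thesis by linarith
qed

lemma ne_delete_outside:
  assumes "finite X" "W \<subseteq> V - L" "card X \<le> b" shows "ne W \<le> ne (W - X) + M * b"
proof -
  have "finite W" using assms(2) finV finite_subset by blast
  moreover have "dg W x \<le> M" if "x \<in> X \<inter> W" for x using dg_outside[of W x] assms(2) that by auto
  ultimately have "ne W \<le> ne (W - X) + M * card X" using assms(1) by (intro ne_delete_le) auto
  moreover have "M * card X \<le> M * b" using assms(3) by simp
  ultimately show ?thesis by linarith
qed

text \<open>A star at \<open>x\<close> would release a large vertex \<open>v\<close> for the path.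
  By \<open>near_full\<close>, \<open>v\<close> is joined to all but boundedly many vertices, and
  what is left outside is dense enough for a path on 2k + 1 vertices. With a further neighbour
  \<open>w\<close> and \<open>v\<close> in front it has 2k + 3 vertices and avoids the star.\<close>

lemma small_degree_outside:
  assumes cL: "card L = t" and low: weakly_dense
    and C: "C = 2 * (k + 1) * (a t + 1) + 2 * k * k"
    and n: "card V > t + 2 * k * k + 2 * (M * (a t + 1 + C)) + (a t + 1 + C) + 2 * k + 2"
    and x: "x \<in> V - L"
  shows "dg (V - L) x < a t"
proof (rule ccontr)
  let ?W = "V - L"
  assume "\<not> dg ?W x < a t"
  then obtain B where B: "B \<subseteq> nb ?W x" "card B = a t" "finite B"
    unfolding dg_def not_less using obtain_subset_with_card_n by metis
  define S where "S = insert x B"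
  have BW: "B \<subseteq> ?W" "x \<notin> B" using B(1) by (auto simp: nb_def)
  have S: "S \<subseteq> ?W" "card S = a t + 1" "finite S" using x BW B by (auto simp: S_def)
  obtain v where v: "v \<in> L" using cL t1 finL by fastforce
  have "L - {v} \<subseteq> L" "card (L - {v}) = t - 1" using v cL finL by auto
  moreover have "x \<in> V - (L - {v})" "B \<subseteq> nb (V - (L - {v})) x" using x B(1) by (auto simp: nb_def)
  ultimately have "no_path (2 * k + 3) (V - (L - {v}) - insert x B)" using B(2) no_path_with_star by blast
  then have np: "no_path (2 * k + 3) (insert v (?W - S))"
    by (rule no_path_mono) (use v S L_subset in \<open>auto simp: S_def\<close>)
  note nf = near_full[OF finV L_subset v no_path_outside[OF order_refl cL] S(1) np]
  have mu: "missing V L \<le> C" using nf(1) low unfolding weakly_dense_def cL C S(2) by simp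
  have neW: "int k * (int (card V) - int t) - int k * int k \<le> int (ne ?W)"
    using nf(2) low unfolding weakly_dense_def cL by simp
  define U where "U = {u \<in> V - {v}. \<not> adj v u}"
  have cU: "card U \<le> C" using non_neighbours_le_missing[OF finV v L_subset] mu by (simp add: U_def)
  have fU: "finite U" using finV by (simp add: U_def)
  have cSU: "card (S \<union> U) \<le> a t + 1 + C" using card_Un_le[of S U] S(2) cU by linarith
  \<comment> \<open>The star and the non-neighbours of \<open>v\<close> are boundedly many, and
    vertices outside \<open>L\<close> have degree below \<open>M\<close>, so only O(1) edges are
    lost.\<close>
  let ?H = "?W - (S \<union> U)"
  have d: "ne ?W \<le> ne ?H + M * (a t + 1 + C)"
    using cSU S(3) fU by (intro ne_delete_outside) auto
  have cW: "card ?W = card V - t" using cL finL L_subset by (simp add: card_Diff_subset)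
  have "int ((2 * k - 1) * card ?H) < int (2 * ne ?H)"
  proof -
    have "int ((2 * k - 1) * card ?H) \<le> int ((2 * k - 1) * card ?W)"
      using finV by (intro of_nat_mono mult_le_mono2 card_mono) auto
    also have "\<dots> = 2 * int k * (int (card V) - int t) - (int (card V) - int t)"
    proof -
      have i: "int (2 * k - 1) = 2 * int k - 1" "int (card ?W) = int (card V) - int t" using k1 cW n by auto
      show ?thesis unfolding of_nat_mult i by (simp add: algebra_simps)
    qed
    also have "\<dots> < 2 * int (ne ?H)"
    proof -
      have "int t + 2 * int k * int k + 2 * int (M * (a t + 1 + C)) < int (card V)"
      proof -
        have "t + 2 * k * k + 2 * (M * (a t + 1 + C)) < card V" using n by linarith
        then have "int (t + 2 * k * k + 2 * (M * (a t + 1 + C))) < int (card V)" by (simp only: of_nat_less_iff)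
        then show ?thesis by simp
      qed
      moreover have "int (ne ?W) \<le> int (ne ?H) + int (M * (a t + 1 + C))" using d by linarith
      ultimately show ?thesis using neW by linarith
    qed
    finally show ?thesis by simp
  qed
  then have "(2 * k - 1) * card ?H < 2 * ne ?H" by (simp only: of_nat_less_iff)
  then obtain xs where xs: "pth xs" "length xs = 2 * k + 1" "set xs \<subseteq> ?H"
    using erdos_gallai_path[of ?H k] finV k1 by auto
  have "card ?W - card (S \<union> U) \<le> card ?H" using S(3) fU by (intro diff_card_le_card_Diff) auto
  then have "2 * k + 1 < card ?H" using cW cSU n by linarith
  then obtain w where w: "w \<in> ?H - set xs"
    using single_vertex_pieces[of "2 * k + 1" ?H "set xs"] card_length[of xs] xs(2) by (metis List.finite_set length_greater_0_conv
      less_numeral_extra(1) nth_mem subsetD)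
  have vad: "adj v u" if "u \<in> ?H" for u using that v by (auto simp: U_def)
  have "xs \<noteq> []" using xs(2) by auto
  then have "hd xs \<in> ?H" using xs(3) hd_in_set by blast
  then have "pth (w # v # xs)" using xs w v vad adj_sym by (auto simp: pth_Cons)
  moreover have "set (w # v # xs) \<subseteq> insert v (?W - S)" using xs(3) w by auto
  ultimately show False using no_pathD[OF np] xs(2) by fastforce
qed

text \<open>A spare large vertex \<open>u\<close> can replace \<open>v\<close> among the t hosts, so
  \<open>v\<close> is free for paths that avoid \<open>u\<close>, and \<open>near_full\<close>
  applies with this single vertex as \<open>S\<close>.\<close>

lemma almost_full:
  assumes cL: "t < card L" and low: weakly_dense and v: "v \<in> L"
  shows "card {u \<in> V - {v}. \<not> adj v u} \<le> 2 * (k + 1) + 2 * k * k"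
proof -
  have "t - 1 \<le> card (L - {v})" using cL v finL by simp
  then obtain T0 where T0: "T0 \<subseteq> L - {v}" "card T0 = t - 1" using obtain_subset_with_card_n by metis
  define T where "T = insert v T0"
  have fT0: "finite T0" using T0(1) finL finite_subset by blast
  have T: "T \<subseteq> L" "card T = t" "v \<in> T" using T0 v t1 fT0 by (auto simp: T_def card_insert_if subset_iff)
  have "\<not> L \<subseteq> T" using cL T(2) card_mono[of T L] fT0 by (auto simp: T_def)
  then obtain u where u: "u \<in> L" "u \<notin> T" by blast
  have "insert u T0 \<subseteq> L" "card (insert u T0) = t" using u T0 t1 fT0 by (auto simp: T_def)
  then have "no_path (2 * k + 3) (V - insert u T0)" by (rule no_path_outside)
  moreover have "insert v (V - T - {u}) \<subseteq> V - insert u T0" using u T0 v L_subset by (auto simp: T_def)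
  ultimately have np: "no_path (2 * k + 3) (insert v (V - T - {u}))" using no_path_mono by blast
  have TV: "T \<subseteq> V" using T(1) L_subset by blast
  have "{u} \<subseteq> V - T" using u L_subset by auto
  then have "missing V T \<le> 2 * (k + 1) * card {u} + 2 * k * k"
    using near_full(1)[OF finV TV T(3) no_path_outside[OF T(1,2)] _ np] low unfolding weakly_dense_def T(2) by simp
  then show ?thesis using non_neighbours_le_missing[OF finV T(3) TV] by simp
qed

text \<open>The pool of connectors: any two members are linked through any vertex of
  \<open>U\<close>.\<close>

definition full :: "'a set \<Rightarrow> 'a set" where
  "full U = {x \<in> V - U. \<forall>v\<in>U. adj v x}"

lemma card_not_full:
  assumes cL: "t < card L" and low: weakly_dense and U: "U \<subseteq> L"
  shows "card (V - U - full U) \<le> card U * (2 * (k + 1) + 2 * k * k)"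
proof -
  have fU: "finite U" using U finL finite_subset by blast
  have "V - U - full U \<subseteq> (\<Union>v\<in>U. {u \<in> V - {v}. \<not> adj v u})" by (auto simp: full_def)
  then have "card (V - U - full U) \<le> card (\<Union>v\<in>U. {u \<in> V - {v}. \<not> adj v u})"
    using fU finV by (intro card_mono) auto
  also have "\<dots> \<le> (\<Sum>v\<in>U. card {u \<in> V - {v}. \<not> adj v u})" using fU by (rule card_UN_le)
  also have "\<dots> \<le> (\<Sum>v\<in>U. 2 * (k + 1) + 2 * k * k)"
    using U by (intro sum_mono almost_full[OF cL low]) auto
  finally show ?thesis by simp
qed

lemma card_full:
  assumes cL: "t < card L" and low: weakly_dense and U: "U \<subseteq> L"
  shows "card V \<le> card (full U) + card U + card U * (2 * (k + 1) + 2 * k * k)"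
proof -
  have fU: "finite U" using U finL finite_subset by blast
  have "V = (full U \<union> U) \<union> (V - U - full U)" using U L_subset by (auto simp: full_def)
  then have "card V \<le> card (full U \<union> U) + card (V - U - full U)" by (metis card_Un_le)
  also have "\<dots> \<le> card (full U) + card U + card (V - U - full U)" by (simp add: card_Un_le)
  finally show ?thesis using card_not_full[OF assms] by linarith
qed

lemma list_of_set:
  assumes "finite U" obtains us where "set us = U" "distinct us" "length us = card U"
  using finite_distinct_list[OF assms] distinct_card by metis

lemma full_subset: "full U \<subseteq> V - U" by (auto simp: full_def)

lemma weave_full:
  assumes "pth xs" "xs \<noteq> []" "last xs \<in> D" "D \<subseteq> full U" "distinct us" "set us \<subseteq> U - set xs"
    "2 * k + 3 < card D" "length xs + 2 * length us \<le> 2 * k + 3"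
  obtains ys where "pth ys" "ys \<noteq> []" "length ys = length xs + 2 * length us" "last ys \<in> D"
    "set ys \<subseteq> set xs \<union> set us \<union> D"
proof -
  have "\<exists>ys. pth ys \<and> ys \<noteq> [] \<and> length ys = length xs + length us * (1 + 1) \<and> last ys \<in> D \<and>
     set ys \<subseteq> set xs \<union> set us \<union> D"
  proof (rule weave[OF assms(1-3,5), where B = "2 * k + 3"])
    show "\<exists>p. pth p \<and> length p = 1 \<and> set p \<subseteq> D - X" if "finite X" "card X \<le> 2 * k + 3" for X
      by (rule single_vertex_pieces[OF assms(7) that])
    show "set us \<inter> D = {}" using assms(4,6) full_subset by blast
    show "set us \<inter> set xs = {}" using assms(6) by auto
    show "adj v q" if "v \<in> set us" "q \<in> D" for v q using that assms(4,6) adj_sym by (auto simp: full_def)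
  qed (use assms(8) in simp_all)
  then show ?thesis using that by (auto simp: mult.commute)
qed

text \<open>Beyond t hosts, k + 1 large vertices alternate with k + 2 common neighbours, which makes
  2k + 3 vertices.\<close>

lemma large_upper:
  assumes cL: "t < card L" and low: weakly_dense
    and n: "card V > (t + k + 1) + (t + k + 1) * (2 * (k + 1) + 2 * k * k) + 2 * k + 4"
  shows "card L \<le> t + k"
proof (rule ccontr)
  assume "\<not> card L \<le> t + k"
  then have "t + k + 1 \<le> card L" by simp
  then obtain L' where L': "L' \<subseteq> L" "card L' = t + k + 1" using obtain_subset_with_card_n by metis
  have fL: "finite L'" using L'(1) finL finite_subset by blast
  obtain T where T: "T \<subseteq> L'" "card T = t" using L'(2) obtain_subset_with_card_n[of t L'] by auto
  obtain us where us: "set us = L' - T" "distinct us" "length us = card (L' - T)"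
    using list_of_set[of "L' - T"] fL by blast
  have lus: "length us = k + 1" using us(3) T L'(2) fL by (simp add: card_Diff_subset finite_subset[OF T(1)])
  let ?D = "full L'"
  have cD: "2 * k + 3 < card ?D" using card_full[OF cL low L'(1)] n unfolding L'(2) by linarith
  then obtain w where w: "w \<in> ?D" by (metis card.empty equals0I not_less_zero)
  have pre: "pth [w]" "[w] \<noteq> []" "last [w] \<in> ?D" "set us \<subseteq> L' - set [w]"
    "length [w] + 2 * length us \<le> 2 * k + 3" using us(1) w full_subset lus by auto
  obtain ys where ys: "pth ys" "ys \<noteq> []" "length ys = length [w] + 2 * length us" "last ys \<in> ?D"
    "set ys \<subseteq> set [w] \<union> set us \<union> ?D"
    using weave_full[OF pre(1-3) order_refl us(2) pre(4) cD pre(5)] .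
  have "set ys \<subseteq> V - T" using ys(5) w us(1) T(1) L'(1) L_subset by (auto simp: full_def)
  then show False using no_pathD[OF no_path_outside[of T] ys(1)] T L'(1) ys(3) lus by auto
qed

text \<open>The rest now needs about g edges per vertex, so it contains paths on 2g + 1 vertices
  even after bounded deletions. The k - g large vertices beyond t hosts tie k - g + 1 of them
  together, in all (k - g + 1)(2g + 1) + (k - g) vertices. This is at least 2k + 3 for 1 <= g < k,
  while g = 0 and g = k, the two cases that survive, give only 2k + 1.\<close>

lemma large_not_between:
  assumes cL: "card L = t + k - g" "1 \<le> g" "g < k" and low: weakly_dense
    and dense: "int (card V) * (int (card V) - 1)
      - (int (card V) - int (t + k)) * (int (card V) - int (t + k) - 1) + 2 \<le> 2 * int (ne V)"
    and b: "b = (t + k) * (2 * (k + 1) + 2 * k * k) + (2 * g + 1 + (k - g) * (2 * g + 2))"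
    and n: "card V > (t + k) + 2 * g * g + 2 * (M * b)"
  shows False
proof -
  let ?Q = "V - L" and ?D = "full L" and ?B = "2 * g + 1 + (k - g) * (2 * g + 2)"
  have tL: "t < card L" using cL by linarith
  note cQ = card_Diff_int[OF finV L_subset]
  have cLi: "int (card L) = int t + int k - int g" using cL by linarith
  have neQ: "2 * int g * int (card ?Q) - 2 * int g * int g \<le> 2 * int (ne ?Q)"
  proof -
    define P where "P = int (card ?Q)"
    have e: "int (card V) - int (t + k) = P - int g" "int (card V) - int (card L) = P"
      using cQ cLi by (auto simp: P_def)
    have "2 * int (ne V) + 2 * int (missing V L) = int (card V) * (int (card V) - 1) - P * (P - 1) + 2 * int (ne ?Q)"
      using edge_count[OF finV L_subset] e(2) by simp
    moreover have "int (card V) * (int (card V) - 1) - (P - int g) * (P - int g - 1) + 2 \<le> 2 * int (ne V)"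
      using dense e(1) by simp
    moreover have "P * (P - 1) - (P - int g) * (P - int g - 1) = 2 * int g * P - int g * int g - int g"
      by (simp add: algebra_simps)
    moreover have "int g \<le> int g * int g" using cL(2) by simp
    ultimately show ?thesis unfolding P_def[symmetric] by linarith
  qed
  have pieces: "\<exists>p. pth p \<and> length p = 2 * g + 1 \<and> set p \<subseteq> ?D - X" if X: "finite X" "card X \<le> ?B" for X
  proof -
    \<comment> \<open>Outside \<open>L\<close> all but boundedly many vertices are common neighbours
      of \<open>L\<close>, so the pieces can be found among these.\<close>
    let ?Y = "(V - L - ?D) \<union> X"
    have "card (V - L - ?D) \<le> (t + k) * (2 * (k + 1) + 2 * k * k)"
    proof -
      have "card L * (2 * (k + 1) + 2 * k * k) \<le> (t + k) * (2 * (k + 1) + 2 * k * k)"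
        using cL by (intro mult_le_mono1) auto
      then show ?thesis using card_not_full[OF tL low order_refl] by linarith
    qed
    then have "card ?Y \<le> b" using card_Un_le[of "V - L - ?D" X] X(2) unfolding b by linarith
    then have d: "ne ?Q \<le> ne (?Q - ?Y) + M * b" using X(1) finV by (intro ne_delete_outside) auto
    have DX: "?Q - ?Y = ?D - X" by (auto simp: full_def)
    have "int ((2 * g - 1) * card (?D - X)) < int (2 * ne (?D - X))"
    proof -
      have "?D - X \<subseteq> ?Q" by (auto simp: full_def)
      then have "int ((2 * g - 1) * card (?D - X)) \<le> int ((2 * g - 1) * card ?Q)"
        using finV by (intro of_nat_mono mult_le_mono2 card_mono) auto
      also have "\<dots> = 2 * int g * int (card ?Q) - int (card ?Q)" using cL(2) by (simp add: algebra_simps)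
      also have "\<dots> < 2 * int (ne (?D - X))"
      proof -
        have "int ((t + k) + 2 * g * g + 2 * (M * b)) < int (card V)" using n by (simp only: of_nat_less_iff)
        then have "int t + int k + 2 * int g * int g + 2 * int (M * b) < int (card V)" by simp
        moreover have "int (ne ?Q) \<le> int (ne (?D - X)) + int (M * b)" using d unfolding DX by linarith
        ultimately show ?thesis using neQ cQ cLi by linarith
      qed
      finally show ?thesis by simp
    qed
    then have "(2 * g - 1) * card (?D - X) < 2 * ne (?D - X)" by (simp only: of_nat_less_iff)
    moreover have "finite (?D - X)" using finV by (simp add: full_def)
    ultimately show ?thesis using erdos_gallai_path cL(2) by blast
  qed
  obtain T where T: "T \<subseteq> L" "card T = t" using tL obtain_subset_with_card_n[of t L] by auto
  obtain us where us: "set us = L - T" "distinct us" "length us = card (L - T)"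
    using list_of_set[of "L - T"] finL by blast
  have lus: "length us = k - g" using us(3) T cL finL by (simp add: card_Diff_subset finite_subset[OF T(1)])
  obtain p0 where p0: "pth p0" "length p0 = 2 * g + 1" "set p0 \<subseteq> ?D" using pieces[of "{}"] by auto
  have "\<exists>ys. pth ys \<and> ys \<noteq> [] \<and> length ys = length p0 + length us * (2 * g + 1 + 1) \<and> last ys \<in> ?D \<and>
     set ys \<subseteq> set p0 \<union> set us \<union> ?D"
  proof (rule weave[where B = ?B])
    show p0n: "p0 \<noteq> []" using p0(2) by auto
    then show "last p0 \<in> ?D" using p0(3) last_in_set by blast
    show "set us \<inter> set p0 = {}" "set us \<inter> ?D = {}" using p0(3) us(1) by (auto simp: full_def)
  qed (use p0 us lus pieces in \<open>auto simp: full_def\<close>)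
  then obtain ys where ys: "pth ys" "length ys = 2 * g + 1 + (k - g) * (2 * g + 2)"
     "set ys \<subseteq> set p0 \<union> set us \<union> ?D"
    using lus p0(2) by auto
  have "?D \<subseteq> V - L" by (auto simp: full_def)
  then have "set ys \<subseteq> V - T" using ys(3) p0(3) us(1) T(1) L_subset by blast
  then have "length ys < 2 * k + 3" using no_pathD[OF no_path_outside[OF T] ys(1)] by simp
  moreover have "2 * k + 3 \<le> 2 * g + 1 + (k - g) * (2 * g + 2)"
  proof -
    obtain q where q: "k = g + Suc q" using cL(3) less_imp_Suc_add by auto
    obtain g' where g': "g = Suc g'" using cL(2) by (cases g) auto
    show ?thesis unfolding q g' by simp
  qed
  ultimately show False using ys(2) by linarith
qed


text \<open>Divides the large vertices by role: \<open>T\<close> hosts the stars, \<open>u\<close>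
  has a prescribed place on a path, and \<open>us\<close> is woven in.\<close>

lemma split_large:
  assumes cL: "card L = t + k" and u: "u \<in> L"
  obtains T us where "T \<subseteq> L" "card T = t" "u \<notin> T" "set us = L - T - {u}" "distinct us" "length us = k - 1"
proof -
  have "t \<le> card (L - {u})" using cL u finL k1 by simp
  then obtain T where T: "T \<subseteq> L - {u}" "card T = t" using obtain_subset_with_card_n by metis
  have fT: "finite T" using T(1) finL finite_subset by blast
  obtain us where us: "set us = L - T - {u}" "distinct us" "length us = card (L - T - {u})"
    using list_of_set[of "L - T - {u}"] finL by blast
  have "card (L - T) = k" using T cL fT by (subst card_Diff_subset) auto
  moreover have "u \<in> L - T" using u T by auto
  ultimately have "length us = k - 1" using us(3) finL by simp
  then show ?thesis using that[of T us] T us(1,2) by auto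
qed

text \<open>The path z, y, x, u, w ends in a common neighbour, and the other k - 1 large vertices
  add two vertices each: 5 + 2(k - 1) = 2k + 3.\<close>

lemma no_path3_into_L:
  assumes cL: "card L = t + k" and D: "card (full L) > 2 * k + 6"
    and xyz: "{x, y, z} \<subseteq> V - L" "adj x y" "adj y z" "x \<noteq> z" and u: "u \<in> L"
  shows "\<not> adj x u"
proof
  assume xu: "adj x u"
  obtain T us where T: "T \<subseteq> L" "card T = t" "u \<notin> T" "set us = L - T - {u}" "distinct us" "length us = k - 1"
    using split_large[OF cL u] .
  let ?D = "full L - {x, y, z}"
  have fD: "finite (full L)" using finV by (simp add: full_def)
  \<comment> \<open>The surplus in 2k + 6 covers the three discarded vertices.\<close>
  have "card (full L) - card {x, y, z} \<le> card ?D" by (intro diff_card_le_card_Diff) auto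
  moreover have "card {x, y, z} \<le> 3" by (simp add: card_insert_if)
  ultimately have cD: "2 * k + 3 < card ?D" using D by linarith
  then obtain w where w: "w \<in> ?D" by (metis card.empty equals0I not_less_zero)
  have "x \<noteq> y" "y \<noteq> z" "z \<noteq> y" using xyz by auto
  moreover have "u \<notin> V - L" "w \<in> V - L" "adj u w" "adj u x" "adj z y" "adj y x"
    using u w xu xyz adj_sym by (auto simp: full_def)
  ultimately have p: "pth [z, y, x, u, w]" using xyz w u xu by (auto simp: pth_Cons)
  have D_sub: "?D \<subseteq> V - L" using full_subset by blast
  have pre: "[z, y, x, u, w] \<noteq> []" "last [z, y, x, u, w] \<in> ?D" "?D \<subseteq> full L"
    "set us \<subseteq> L - set [z, y, x, u, w]" "length [z, y, x, u, w] + 2 * length us \<le> 2 * k + 3"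
    using T(4,6) xyz(1) w D_sub k1 by auto
  obtain ys where ys: "pth ys" "ys \<noteq> []" "length ys = length [z, y, x, u, w] + 2 * length us" "last ys \<in> ?D"
    "set ys \<subseteq> set [z, y, x, u, w] \<union> set us \<union> ?D"
    using weave_full[OF p pre(1-3) T(5) pre(4) cD pre(5)] .
  have "{x, y, z} \<subseteq> V - T" "?D \<subseteq> V - T" "set us \<subseteq> V - T" "u \<in> V - T"
    using xyz(1) D_sub T(1,3,4) u L_subset by auto
  then have "set ys \<subseteq> V - T" using ys(5) w by auto
  then show False using no_pathD[OF no_path_outside[OF T(1,2)] ys(1)] ys(3) T(6) k1 by simp
qed

text \<open>Start with one edge, weave in k - 1 large vertices, and cross through \<open>u\<close>
  to the other edge: 2 + 2(k - 1) + 3 = 2k + 3.\<close>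

lemma no_two_full_edges:
  assumes cL: "card L = t + k" and D: "card (full L) > 2 * k + 6"
    and y: "{y1, y2, y3, y4} \<subseteq> V - L" "adj y1 y2" "adj y3 y4" "y2 \<in> full L" "y3 \<in> full L"
      "y1 \<noteq> y3" "y1 \<noteq> y4" "y2 \<noteq> y3" "y2 \<noteq> y4"
  shows False
proof -
  obtain u where u: "u \<in> L" using cL t1 finL by fastforce
  obtain T us where T: "T \<subseteq> L" "card T = t" "u \<notin> T" "set us = L - T - {u}" "distinct us" "length us = k - 1"
    using split_large[OF cL u] .
  let ?D = "full L - {y1, y3, y4}"
  have "card (full L) - card {y1, y3, y4} \<le> card ?D" by (intro diff_card_le_card_Diff) auto
  moreover have "card {y1, y3, y4} \<le> 3" by (simp add: card_insert_if)
  ultimately have cD: "2 * k + 3 < card ?D" using D by linarith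
  have y12: "y1 \<noteq> y2" "y3 \<noteq> y4" using y by auto
  have p: "pth [y1, y2]" using y12 y(2) by (auto simp: pth_Cons)
  have D_sub: "?D \<subseteq> V - L" using full_subset by blast
  have pre: "[y1, y2] \<noteq> []" "last [y1, y2] \<in> ?D" "?D \<subseteq> full L" "set us \<subseteq> L - set [y1, y2]"
    "length [y1, y2] + 2 * length us \<le> 2 * k + 3" using T(4,6) y y12 k1 by auto
  obtain ys where ys: "pth ys" "ys \<noteq> []" "length ys = length [y1, y2] + 2 * length us" "last ys \<in> ?D"
    "set ys \<subseteq> set [y1, y2] \<union> set us \<union> ?D"
    using weave_full[OF p pre(1-3) T(5) pre(4) cD pre(5)] .
  have "u \<notin> set ys" "y3 \<notin> set ys" "y4 \<notin> set ys" using ys(5) y u T(4) D_sub by auto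
  moreover have "adj (last ys) u" "adj u y3" using ys(4) y(5) u adj_sym by (auto simp: full_def)
  ultimately have "pth (ys @ [u, y3, y4])" using ys(1,2) y y12 u by (auto simp: pth_append pth_Cons)
  moreover have "set (ys @ [u, y3, y4]) \<subseteq> V - T"
  proof -
    have "{y1, y2, y3, y4} \<subseteq> V - T" "?D \<subseteq> V - T" "set us \<subseteq> V - T" "u \<in> V - T"
      using y(1) D_sub T(1,3,4) u L_subset by auto
    then show ?thesis using ys(5) by auto
  qed
  ultimately have "length (ys @ [u, y3, y4]) < 2 * k + 3" using no_pathD[OF no_path_outside[OF T(1,2)]] by blast
  then show False using ys(3) T(6) k1 by simp
qed

text \<open>Edges outside \<open>L\<close> must outnumber the missing pairs. Vertices with a
  neighbour in \<open>L\<close> span only a matching, and all but two of the matched ones miss a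
  large vertex. A vertex of \<open>B\<close> misses all of \<open>L\<close>, at least k + 1 pairs,
  but brings at most k + 1/2 edges on average.\<close>

lemma single_edge_outside:
  assumes cL: "card L = t + k" and D: "card (full L) > 2 * k + 6"
    and dense: "int (card V) * (int (card V) - 1)
      - (int (card V) - int (t + k)) * (int (card V) - int (t + k) - 1) + 2 \<le> 2 * int (ne V)"
  shows "missing V L = 0 \<and> ne (V - L) = 1"
proof -
  let ?Q = "V - L" and ?mu = "missing V L"
  have finQ: "finite ?Q" using finV by simp
  have "int ?mu + 1 \<le> int (ne ?Q)" using edge_count[OF finV L_subset] dense unfolding cL by linarith
  then have low: "?mu + 1 \<le> ne ?Q" by linarith
  define B where "B = {x \<in> ?Q. \<forall>u\<in>L. \<not> adj x u}"
  \<comment> \<open>Vertices of \<open>B0\<close> have degree at most one outside \<open>L\<close>,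
    for their neighbour outside \<open>B\<close> must not end a path on three vertices. Once they
    are deleted, no edge joins \<open>B\<close> to the rest.\<close>
  define B0 where "B0 = {y \<in> B. \<exists>x\<in>?Q - B. adj y x}"
  have BQ: "B \<subseteq> ?Q" "B0 \<subseteq> B" by (auto simp: B_def B0_def)
  have "finite B" using BQ(1) finQ by (rule finite_subset)
  moreover from BQ(2) this have "finite B0" by (rule finite_subset)
  ultimately have finB: "finite B" "finite B0" .
  text \<open>A vertex of \<open>?Q - B\<close> is not an end of a path on three vertices in \<open>?Q\<close>.\<close>
  have unique: "z = x" if h: "x \<in> ?Q - B" "adj x y" "y \<in> ?Q" "adj y z" "z \<in> ?Q" for x y z
  proof (rule ccontr)
    assume "z \<noteq> x"
    obtain u where "u \<in> L" "adj x u" using h(1) by (auto simp: B_def)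
    then show False using no_path3_into_L[OF cL D, of x y z u] h \<open>z \<noteq> x\<close> by auto
  qed
  have deg1: "dg W y \<le> 1" if "adj x y" "x \<in> ?Q - B" "y \<in> ?Q" "W \<subseteq> ?Q" for x y W
  proof -
    have "nb W y \<subseteq> {x}" using unique[OF that(2,1,3)] that(4) by (auto simp: nb_def)
    then show ?thesis unfolding dg_def using card_mono[of "{x}" "nb W y"] by simp
  qed
  have "ne ?Q \<le> ne (?Q - B0) + 1 * card B0"
  proof (rule ne_delete_le[OF finB(2) finQ])
    fix y assume "y \<in> B0 \<inter> ?Q"
    then obtain x where "x \<in> ?Q - B" "adj y x" "y \<in> ?Q" by (auto simp: B0_def)
    then show "dg ?Q y \<le> 1" using deg1[of x y ?Q] adj_sym by blast
  qed
  moreover have "ne (?Q - B0) = ne (?Q - B) + ne (?Q - B0 - (?Q - B))"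
  proof (rule ne_closed)
    fix x y assume "x \<in> ?Q - B" "y \<in> ?Q - B0 - (?Q - B)"
    then show "\<not> adj x y" using adj_sym by (auto simp: B0_def)
  qed (use finQ BQ in auto)
  moreover have "?Q - B0 - (?Q - B) = B - B0" using BQ by auto
  moreover have "2 * ne (B - B0) \<le> (2 * (k + 1) - 1) * card (B - B0)"
  proof (rule erdos_gallai)
    obtain T where T: "T \<subseteq> L" "card T = t" using cL obtain_subset_with_card_n[of t L] by auto
    have "no_path (2 * k + 3) (B - B0)" using T BQ by (intro no_path_mono[OF no_path_outside[OF T]]) auto
    then show "no_path (2 * (k + 1) + 1) (B - B0)" by (simp add: eval_nat_numeral)
  qed (use finB in auto)
  moreover have cB: "card B = card (B - B0) + card B0"
    using BQ finB by (simp add: card_Diff_subset card_mono)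
  ultimately have up: "2 * ne ?Q \<le> 2 * ne (?Q - B) + (2 * k + 1) * card (B - B0) + 2 * card B0" by simp
  have "2 * card B0 \<le> (2 * k + 1) * card B0" using k1 by (intro mult_le_mono1) auto
  then have up2: "2 * ne ?Q \<le> 2 * ne (?Q - B) + (2 * k + 1) * card B"
    using up unfolding cB add_mult_distrib2 by linarith
  \<comment> \<open>Degrees within \<open>?Q - B\<close> are at most one, so \<open>K\<close>
    consists of the ends of a matching.\<close>
  define K where "K = {x \<in> ?Q - B. dg (?Q - B) x = 1}"
  define N where "N = {x \<in> ?Q - B. x \<notin> full L}"
  have cK: "card K = 2 * ne (?Q - B)"
  proof -
    have "dg (?Q - B) y = (if y \<in> K then 1 else 0)" if y: "y \<in> ?Q - B" for y
    proof (cases "nb (?Q - B) y = {}")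
      case True
      then show ?thesis by (simp add: K_def dg_def)
    next
      case False
      then obtain x where "x \<in> ?Q - B" "adj y x" by (auto simp: nb_def)
      then have "dg (?Q - B) y \<le> 1" using deg1[of x y "?Q - B"] y adj_sym by blast
      moreover have "dg (?Q - B) y \<noteq> 0" using False finQ by (simp add: dg_def)
      ultimately show ?thesis using y by (auto simp: K_def)
    qed
    then have "2 * ne (?Q - B) = (\<Sum>y\<in>?Q - B. if y \<in> K then 1 else 0)"
      using handshake[of "?Q - B"] finQ by simp
    also have "\<dots> = card K" using finQ by (simp add: sum.If_cases K_def Int_def)
    finally show ?thesis by simp
  qed
  have finK: "finite K" and finN: "finite N" using finV by (simp_all add: K_def N_def)
  \<comment> \<open>Of three matched common neighbours, two lie on different edges of the matching,
    which \<open>no_two_full_edges\<close> forbids.\<close>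
  have cN: "card K \<le> card N + 2"
  proof (rule ccontr)
    assume "\<not> card K \<le> card N + 2"
    moreover have "card K \<le> card (K \<inter> full L) + card N"
    proof -
      have "K \<subseteq> (K \<inter> full L) \<union> N" by (auto simp: K_def N_def)
      then have "card K \<le> card ((K \<inter> full L) \<union> N)" using finK finN by (intro card_mono) auto
      then show ?thesis using card_Un_le le_trans by blast
    qed
    ultimately have "3 \<le> card (K \<inter> full L)" by linarith
    then obtain S where "S \<subseteq> K \<inter> full L" "card S = 3" using obtain_subset_with_card_n by metis
    then obtain p q r where pqr: "p \<in> K \<inter> full L" "q \<in> K \<inter> full L" "r \<in> K \<inter> full L" "p \<noteq> q" "p \<noteq> r" "q \<noteq> r"
      by (auto simp: card_3_iff)
    have non: False if y2: "y2 \<in> K \<inter> full L" and y3: "y3 \<in> K \<inter> full L" and "y2 \<noteq> y3" "\<not> adj y2 y3" for y2 y3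
    proof -
      have "nb (?Q - B) y2 \<noteq> {}" "nb (?Q - B) y3 \<noteq> {}" using y2 y3 by (auto simp: K_def dg_def)
      then obtain y1 y4 where y14: "y1 \<in> ?Q - B" "adj y2 y1" "y4 \<in> ?Q - B" "adj y3 y4" by (auto simp: nb_def)
      have "y1 \<noteq> y3" "y4 \<noteq> y2" using y14 that adj_sym by blast+
      moreover have "y1 \<noteq> y4"
      proof
        assume "y1 = y4"
        then have "y3 = y2" using unique[of y2 y1 y3] y14 y2 y3 adj_sym by (auto simp: K_def)
        then show False using that by simp
      qed
      moreover have "{y1, y2, y3, y4} \<subseteq> V - L" using y14 y2 y3 by (auto simp: K_def)
      moreover have "adj y1 y2" "adj y3 y4" using y14 adj_sym by auto
      ultimately show False using no_two_full_edges[OF cL D, of y1 y2 y3 y4] y2 y3 that(3) by auto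
    qed
    have "adj p q" "adj p r" using non[of p q] non[of p r] pqr by auto
    then have "q = r" using unique[of q p r] pqr adj_sym by (auto simp: K_def)
    then show False using pqr by simp
  qed
  have mis: "card N + (k + 1) * card B \<le> ?mu"
  proof -
    have "\<exists>u\<in>L. \<not> adj x u" if "x \<in> N" for x using that adj_sym by (auto simp: N_def full_def)
    then obtain g where g: "\<And>x. x \<in> N \<Longrightarrow> g x \<in> L \<and> \<not> adj x (g x)" by metis
    \<comment> \<open>One missing pair for each vertex of \<open>N\<close> and all pairs between
      \<open>B\<close> and \<open>L\<close>; these are different because \<open>N\<close> avoids
      \<open>B\<close>.\<close>
    let ?A1 = "(\<lambda>x. {x, g x}) ` N" and ?A2 = "(\<lambda>(x, u). {x, u}) ` (B \<times> L)"
    have NQ: "N \<subseteq> ?Q" "N \<inter> B = {}" by (auto simp: N_def)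
    have "inj_on (\<lambda>x. {x, g x}) N" using g NQ by (auto simp: inj_on_def doubleton_eq_iff)
    then have c1: "card ?A1 = card N" by (rule card_image)
    have "inj_on (\<lambda>(x, u). {x, u}) (B \<times> L)" using BQ by (auto simp: inj_on_def doubleton_eq_iff)
    then have c2: "card ?A2 = card B * (t + k)" by (simp add: card_image card_cartesian_product cL)
    have "?A1 \<inter> ?A2 = {}"
    proof -
      have "{x, g x} \<noteq> {y, u}" if "x \<in> N" "y \<in> B" "u \<in> L" for x y u
      proof -
        have "x \<noteq> y" "x \<noteq> u" using that NQ by auto
        then show ?thesis by (auto simp: doubleton_eq_iff)
      qed
      then show ?thesis by auto
    qed
    moreover have "finite ?A1" "finite ?A2" using finN finB finL by auto
    ultimately have "card ?A1 + card ?A2 = card (?A1 \<union> ?A2)" by (simp add: card_Un_disjoint)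
    also have "\<dots> \<le> ?mu" unfolding missing_def
    proof (intro card_mono)
      have a1: "{x, u} \<in> cross V L - E" if "x \<in> ?Q" "u \<in> L" "\<not> adj x u" for x u
      proof -
        have "x \<noteq> u" using that by auto
        then show ?thesis using that L_subset by (auto simp: cross_def all_pairs_def adj_def)
      qed
      show "?A1 \<union> ?A2 \<subseteq> cross V L - E"
      proof
        fix e assume "e \<in> ?A1 \<union> ?A2"
        then consider x where "e = {x, g x}" "x \<in> N" | x u where "e = {x, u}" "x \<in> B" "u \<in> L" by auto
        then show "e \<in> cross V L - E"
        proof cases
          case 1
          then show ?thesis using a1[of x "g x"] g NQ by auto
        next
          case 2
          then show ?thesis using a1[of x u] BQ by (auto simp: B_def)
        qed
      qed
    qed (use finV in simp)
    finally have "card N + card B * (t + k) \<le> ?mu" using c1 c2 by simp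
    moreover have "card B * (k + 1) \<le> card B * (t + k)" using t1 by (intro mult_le_mono2) simp
    ultimately show ?thesis by (simp add: mult.commute)
  qed
  \<comment> \<open>Now 2|N| + 2(k + 1)|B| + 2 <= 2 e(Q) <= |K| + (2k + 1)|B| <= |N| + 2 + (2k +
    1)|B|, so \<open>N\<close> and \<open>B\<close> are empty.\<close>
  have "(2 * k + 1) * card B + card B = 2 * ((k + 1) * card B)" by (simp add: algebra_simps)
  then have "2 * card N + card B + 2 \<le> 2 * ne (?Q - B)" using low mis up2 by linarith
  then have fin: "ne (?Q - B) \<le> 1" "card N = 0" "card B = 0" using cK cN by linarith+
  then have "ne ?Q \<le> 1" using up2 by simp
  then show ?thesis using low by linarith
qed

end

context host
begin

text \<open>The bound is twice the number of edges of \<open>K\<^bsub>t+k\<^esub> \<or> (K\<^sub>2 \<union> independent set)\<close>.\<close>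

definition dense :: bool where
  "dense \<longleftrightarrow> int (card V) * (int (card V) - 1)
      - (int (card V) - int (t + k)) * (int (card V) - int (t + k) - 1) + 2 \<le> 2 * int (ne V)"

lemma dense_imp_weakly_dense: "dense \<Longrightarrow> weakly_dense"
proof -
  assume l: dense
  define P where "P = int (card V) - int t"
  have "int (card V) - int (t + k) = P - int k" by (simp add: P_def)
  then have "int (card V) * (int (card V) - 1) - (P - int k) * (P - int k - 1) + 2 \<le> 2 * int (ne V)"
    using l unfolding dense_def by (simp only:)
  moreover have "P * (P - 1) - (P - int k) * (P - int k - 1) = 2 * int k * P - int k * int k - int k"
    by (simp add: algebra_simps)
  moreover have "int k \<le> int k * int k" using k1 by simp
  ultimately show weakly_dense unfolding weakly_dense_def P_def[symmetric] by linarith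
qed

text \<open>The coefficient of n in twice the edge number is 2(t + k) by \<open>dense\<close>, but
  only 2(t + k) - 1 by \<open>few_large\<close>.\<close>

lemma many_large:
  assumes "stars V {1..t} a c A" dense
    and n: "card V > 2 * star_size * M + (t + k) * (t + k) + (t + k)"
  shows "t \<le> card L"
proof (rule ccontr)
  assume "\<not> t \<le> card L"
  then have "2 * ne V \<le> (2 * t + 2 * k - 1) * card V + 2 * star_size * M" using few_large[OF assms(1)] by simp
  then have "2 * int (ne V) \<le> int ((2 * t + 2 * k - 1) * card V + 2 * star_size * M)" by linarith
  moreover have s: "int (2 * t + 2 * k - 1) = 2 * int (t + k) - 1" using t1 by simp
  ultimately have "2 * int (ne V) \<le> (2 * int (t + k) - 1) * int (card V) + int (2 * star_size * M)"
    by (simp only: of_nat_add[of "(2 * t + 2 * k - 1) * card V"] of_nat_mult[of _ "card V"] s)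
  moreover have "int (card V) * (int (card V) - 1)
      - (int (card V) - int (t + k)) * (int (card V) - int (t + k) - 1) =
      (2 * int (t + k) - 1) * int (card V) + int (card V) - int (t + k) * int (t + k) - int (t + k)"
    by (simp add: algebra_simps)
  moreover have "int (2 * star_size * M) + int (t + k) * int (t + k) + int (t + k) < int (card V)"
    using n by (simp only: of_nat_add[symmetric] of_nat_mult[symmetric] of_nat_less_iff)
  ultimately show False using assms(2) unfolding dense_def by linarith
qed

lemma more_than_t_large:
  assumes cL: "t < card L" and l: dense
    and c: "c = 2 * (k + 1) + 2 * k * k" and b: "b = (t + k) * c + (2 * k + 1 + k * (2 * k + 2))"
    and n: "card V > (t + k + 1) + (t + k + 1) * c + 2 * k + 6" "card V > (t + k) + 2 * k * k + 2 * (M * b)"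
  shows "card L = t + k \<and> missing V L = 0 \<and> ne (V - L) = 1"
proof -
  note low = dense_imp_weakly_dense[OF l]
  have up: "card L \<le> t + k" using large_upper[OF cL low] n(1) unfolding c by simp
  have "card L = t + k"
  proof (rule ccontr)
    assume ne: "card L \<noteq> t + k"
    define g where "g = t + k - card L"
    have g: "card L = t + k - g" "1 \<le> g" "g < k" using up ne cL by (auto simp: g_def)
    let ?b = "(t + k) * c + (2 * g + 1 + (k - g) * (2 * g + 2))"
    \<comment> \<open>All thresholds that depend on g are dominated by those with k in its
      place.\<close>
    have "(k - g) * (2 * g + 2) \<le> k * (2 * k + 2)" using g by (intro mult_le_mono) auto
    then have "?b \<le> b" using g unfolding b by simp
    then have "M * ?b \<le> M * b" by (rule mult_le_mono2)
    moreover have "2 * g * g \<le> 2 * k * k" using g by (intro mult_le_mono) auto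
    ultimately have "card V > (t + k) + 2 * g * g + 2 * (M * ?b)" using n(2) by linarith
    then show False using large_not_between[OF g low _ refl] l unfolding dense_def c by simp
  qed
  moreover have "card (full L) > 2 * k + 6"
    using card_full[OF cL low order_refl] n(1) \<open>card L = t + k\<close> by (simp add: c)
  ultimately show ?thesis using single_edge_outside l unfolding dense_def by simp
qed

text \<open>If a_t <= 2k, the degrees outside are at most 2k - 1, which falls short of
  \<open>weakly_dense\<close> by a linear amount. If a_t = 2k + 1, the degree bound 2k meets
  \<open>reg\<close> with no slack, and equality forces both the complete join and
  regularity.\<close>

lemma exactly_t_large:
  assumes cL: "card L = t" and l: dense and at: "a t \<le> 2 * k + 1"
    and C: "C = 2 * (k + 1) * (a t + 1) + 2 * k * k"
    and n: "card V > t + 2 * k * k + 2 * (M * (a t + 1 + C)) + (a t + 1 + C) + 2 * k + 2"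
    and reg: "a t = 2 * k + 1 \<Longrightarrow> int (card V) * (int (card V) - 1)
       - (int (card V) - int t) * (int (card V) - int t - 1) + 2 * int k * (int (card V) - int t) \<le> 2 * int (ne V)"
  shows "a t = 2 * k + 1 \<and> missing V L = 0 \<and> (\<forall>x\<in>V - L. dg (V - L) x = 2 * k)"
proof -
  let ?W = "V - L"
  have low: weakly_dense by (rule dense_imp_weakly_dense[OF l])
  have deg: "dg ?W x < a t" if "x \<in> ?W" for x
    by (rule small_degree_outside[OF cL low C n that])
  have finW: "finite ?W" using finV by simp
  note cW = card_Diff_int[OF finV L_subset, unfolded cL]
  have ec: "2 * int (ne V) + 2 * int (missing V L) = int (card V) * (int (card V) - 1)
     - (int (card V) - int t) * (int (card V) - int t - 1) + 2 * int (ne ?W)"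
    using edge_count[OF finV L_subset] unfolding cL .
  have at': "a t = 2 * k + 1"
  proof (rule ccontr)
    assume "a t \<noteq> 2 * k + 1"
    then have "dg ?W x \<le> 2 * k - 1" if "x \<in> ?W" for x using deg[OF that] at by linarith
    then have "2 * ne ?W \<le> (2 * k - 1) * card ?W" using finW by (rule ne_bound_dg[rotated])
    then have "2 * int (ne ?W) \<le> int ((2 * k - 1) * card ?W)" by linarith
    moreover have "int (2 * k - 1) = 2 * int k - 1" using k1 by simp
    ultimately have u: "2 * int (ne ?W) \<le> 2 * int k * int (card ?W) - int (card ?W)"
      by (simp add: algebra_simps)
    have "t + 2 * k * k < card V" using n by linarith
    then have "int (t + 2 * k * k) < int (card V)" by (simp only: of_nat_less_iff)
    then have "2 * int k * int k < int (card ?W)" unfolding cW by simp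
    then show False using u low ec unfolding weakly_dense_def cW[symmetric] by linarith
  qed
  then have d2: "dg ?W x \<le> 2 * k" if "x \<in> ?W" for x using deg[OF that] by simp
  then have "2 * ne ?W \<le> (2 * k) * card ?W" using finW by (rule ne_bound_dg[rotated])
  then have "2 * int (ne ?W) \<le> int (2 * k * card ?W)" by linarith
  then have "2 * int (ne ?W) \<le> 2 * int k * int (card ?W)" by simp
  then have mu: "missing V L = 0" "2 * int (ne ?W) = 2 * int k * int (card ?W)"
    using reg[OF at'] ec unfolding cW[symmetric] by linarith+
  have eq: "(\<Sum>x\<in>?W. dg ?W x) = (\<Sum>x\<in>?W. 2 * k)"
  proof -
    have "int (2 * ne ?W) = int (2 * k * card ?W)" using mu(2) by simp
    then have "2 * ne ?W = 2 * k * card ?W" by (simp only: of_nat_eq_iff)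
    then show ?thesis using handshake[OF finW] by (simp add: mult.commute)
  qed
  have "dg ?W x = 2 * k" if x: "x \<in> ?W" for x
  proof (rule ccontr)
    assume "dg ?W x \<noteq> 2 * k"
    then have "dg ?W x < 2 * k" using d2[OF x] by simp
    then have "(\<Sum>x\<in>?W. dg ?W x) < (\<Sum>x\<in>?W. 2 * k)"
      using finW d2 x by (intro sum_strict_mono_ex1) auto
    then show False using eq by simp
  qed
  then show ?thesis using at' mu(1) by simp
qed

end

section \<open>Induced subgraphs and recognition of joins\<close>

definition induced :: "'a ugraph \<Rightarrow> 'a set \<Rightarrow> 'a ugraph" where
  "induced G W = \<lparr>verts = W, edges = {e \<in> edges G. e \<subseteq> W}\<rparr>"

lemma induced_simps [simp]: "verts (induced G W) = W" "edges (induced G W) = {e \<in> edges G. e \<subseteq> W}"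
  by (simp_all add: induced_def)

lemma simple_induced: "simple_graph G \<Longrightarrow> W \<subseteq> verts G \<Longrightarrow> simple_graph (induced G W)"
  using finite_subset by (auto simp: simple_graph_def all_pairs_def)

lemma isomorphic_refl: "G \<simeq> G"
  unfolding isomorphic_def by (rule exI[of _ id]) auto

lemma all_pairs_image:
  assumes "bij_betw h T S" shows "(\<lambda>e. h ` e) ` all_pairs T = all_pairs S"
proof -
  have inj: "inj_on h T" and im: "h ` T = S" using assms by (auto simp: bij_betw_def)
  show ?thesis
  proof
    show "(\<lambda>e. h ` e) ` all_pairs T \<subseteq> all_pairs S"
    proof
      fix x assume "x \<in> (\<lambda>e. h ` e) ` all_pairs T"
      then obtain e where e: "x = h ` e" "e \<subseteq> T" "card e = 2" by (auto simp: all_pairs_def)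
      then have "card x = 2" using card_image[OF inj_on_subset[OF inj]] by simp
      moreover have "x \<subseteq> S" using e im by blast
      ultimately show "x \<in> all_pairs S" by (simp add: all_pairs_def)
    qed
    show "all_pairs S \<subseteq> (\<lambda>e. h ` e) ` all_pairs T"
    proof
      fix x assume "x \<in> all_pairs S"
      then have x: "x \<subseteq> h ` T" "card x = 2" using im by (auto simp: all_pairs_def)
      then obtain e where e: "e \<subseteq> T" "x = h ` e" by (auto simp: subset_image_iff)
      then have "card e = 2" using x(2) card_image[OF inj_on_subset[OF inj e(1)]] by simp
      then show "x \<in> (\<lambda>e. h ` e) ` all_pairs T" using e by (auto simp: all_pairs_def)
    qed
  qed
qed

text \<open>Serves twice: to split the t hosts from the extremal graph, and the other k large
  vertices from what remains.\<close>

lemma isomorphic_join: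
  assumes G: "simple_graph G" and T: "T \<subseteq> verts G" "card T = t" and m: "cross (verts G) T \<subseteq> edges G"
    and iso: "induced G (verts G - T) \<simeq> H"
  shows "G \<simeq> complete_graph t \<or>\<^sub>G H"
proof -
  let ?V = "verts G" and ?W = "verts G - T"
  have finT: "finite T" using G T finite_subset by (auto simp: simple_graph_def)
  obtain g where g: "bij_betw g ?W (verts H)" "edges H = (\<lambda>e. g ` e) ` {e \<in> edges G. e \<subseteq> ?W}"
    using iso unfolding isomorphic_def by auto
  obtain h where h: "bij_betw h T {..<t}"
    using ex_bij_betw_finite_nat[OF finT] T(2) by (auto simp: atLeast0LessThan)
  define f where "f v = (if v \<in> T then Inl (h v) else Inr (g v))" for v
  have fT: "f v = Inl (h v)" if "v \<in> T" for v using that by (simp add: f_def)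
  have fW: "f v = Inr (g v)" if "v \<in> ?W" for v using that by (simp add: f_def)
  have imT: "f ` e = Inl ` h ` e" if "e \<subseteq> T" for e
    using that fT by (auto simp: image_image intro!: image_cong)
  have imW: "f ` e = Inr ` g ` e" if "e \<subseteq> ?W" for e
    using that fW by (auto simp: image_image intro!: image_cong)
  have "bij_betw f (T \<union> ?W) (Inl ` {..<t} \<union> Inr ` verts H)"
  proof (rule bij_betw_combine)
    show "bij_betw f T (Inl ` {..<t})"
      using h imT[of T] fT by (auto simp: bij_betw_def inj_on_def)
    show "bij_betw f ?W (Inr ` verts H)"
      using g(1) imW[of ?W] fW by (auto simp: bij_betw_def inj_on_def)
  qed auto
  moreover have "T \<union> ?W = ?V" using T by auto
  moreover have "verts (complete_graph t \<or>\<^sub>G H) = Inl ` {..<t} \<union> Inr ` verts H"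
    by (simp add: join_def disj_union_def complete_graph_def)
  ultimately have bij: "bij_betw f ?V (verts (complete_graph t \<or>\<^sub>G H))" by simp
  let ?E3 = "{e \<in> edges G. e \<subseteq> ?W}" and ?E2 = "(\<lambda>(u, v). {u, v}) ` (T \<times> ?W)"
  have E: "edges G = all_pairs T \<union> ?E2 \<union> ?E3"
  proof
    show "edges G \<subseteq> all_pairs T \<union> ?E2 \<union> ?E3"
    proof
      fix e assume e: "e \<in> edges G"
      then have "e \<subseteq> ?V" "card e = 2" using G by (auto simp: simple_graph_def all_pairs_def)
      then obtain p q where pq: "e = {p, q}" "p \<noteq> q" "p \<in> ?V" "q \<in> ?V" by (auto simp: card_2_iff)
      show "e \<in> all_pairs T \<union> ?E2 \<union> ?E3"
      proof (cases "p \<in> T")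
        case True
        then show ?thesis using pq by (cases "q \<in> T") (auto simp: all_pairs_def)
      next
        case False
        then show ?thesis using pq e by (cases "q \<in> T") (auto simp: insert_commute)
      qed
    qed
    have "all_pairs T \<subseteq> cross ?V T" using T by (fastforce simp: cross_def all_pairs_def card_2_iff)
    moreover have "?E2 \<subseteq> cross ?V T" using T by (auto simp: cross_def all_pairs_def card_2_iff)
    ultimately show "all_pairs T \<union> ?E2 \<union> ?E3 \<subseteq> edges G" using m by auto
  qed
  have i1: "(\<lambda>e. f ` e) ` all_pairs T = (\<lambda>e. Inl ` e) ` all_pairs {..<t}"
  proof -
    have "(\<lambda>e. f ` e) ` all_pairs T = (\<lambda>e. Inl ` h ` e) ` all_pairs T"
      using imT by (intro image_cong) (auto simp: all_pairs_def)
    then show ?thesis using all_pairs_image[OF h] by (simp add: image_image flip: all_pairs_image[OF h])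
  qed
  have i2: "(\<lambda>e. f ` e) ` ?E2 = {{Inl u, Inr v} | u v. u \<in> {..<t} \<and> v \<in> verts H}"
  proof -
    have "(\<lambda>e. f ` e) ` ?E2 = (\<lambda>(u, v). {Inl (h u), Inr (g v)}) ` (T \<times> ?W)"
      unfolding image_image by (intro image_cong) (auto simp: f_def)
    also have "\<dots> = (\<lambda>(u, v). {Inl u, Inr v}) ` ((h ` T) \<times> (g ` ?W))" by force
    also have "\<dots> = (\<lambda>(u, v). {Inl u, Inr v}) ` ({..<t} \<times> verts H)"
      using h g(1) by (simp add: bij_betw_def)
    also have "\<dots> = {{Inl u, Inr v} | u v. u \<in> {..<t} \<and> v \<in> verts H}" by auto
    finally show ?thesis .
  qed
  have i3: "(\<lambda>e. f ` e) ` ?E3 = (\<lambda>e. Inr ` e) ` edges H"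
  proof -
    have "(\<lambda>e. f ` e) ` ?E3 = (\<lambda>e. Inr ` g ` e) ` ?E3" using imW by (intro image_cong) auto
    also have "\<dots> = (\<lambda>e. Inr ` e) ` (\<lambda>e. g ` e) ` ?E3" by (rule image_image[symmetric])
    finally show ?thesis unfolding g(2) .
  qed
  have "(\<lambda>e. f ` e) ` edges G = (\<lambda>e. f ` e) ` all_pairs T \<union> (\<lambda>e. f ` e) ` ?E2 \<union> (\<lambda>e. f ` e) ` ?E3"
    by (subst E) (simp only: image_Un)
  then have "edges (complete_graph t \<or>\<^sub>G H) = (\<lambda>e. f ` e) ` edges G"
    unfolding i1 i2 i3 by (auto simp: join_def disj_union_def complete_graph_def)
  then show ?thesis using bij unfolding isomorphic_def by blast
qed

lemma isomorphic_single_edge: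
  assumes G: "simple_graph G" "card (edges G) = 1" "card (verts G) = r + 2"
  shows "G \<simeq> complete_graph 2 \<squnion>\<^sub>G complement (complete_graph r)"
proof -
  obtain e where e: "edges G = {e}" using G(2) by (auto simp: card_1_singleton_iff)
  then have "e \<subseteq> verts G" "card e = 2" using G(1) by (auto simp: simple_graph_def all_pairs_def)
  then obtain p q where pq: "e = {p, q}" "p \<noteq> q" "p \<in> verts G" "q \<in> verts G" by (auto simp: card_2_iff)
  have finV: "finite (verts G)" using G(1) by (simp add: simple_graph_def)
  let ?W = "verts G - {p, q}"
  have "card ?W = r" using pq G(3) by (simp add: card_Diff_subset)
  then obtain h where h: "bij_betw h ?W {..<r}"
    using ex_bij_betw_finite_nat[of ?W] finV by (auto simp: atLeast0LessThan)
  define f :: "'a \<Rightarrow> nat + nat" where "f v = (if v = p then Inl 0 else if v = q then Inl 1 else Inr (h v))" for v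
  have "bij_betw f ({p, q} \<union> ?W) (Inl ` {..<2} \<union> Inr ` {..<r})"
  proof (rule bij_betw_combine)
    have "{..<2} = {0, 1::nat}" by auto
    then show "bij_betw f {p, q} (Inl ` {..<2})" using pq by (auto simp: bij_betw_def f_def)
    have "f ` ?W = Inr ` h ` ?W" unfolding image_image by (intro image_cong) (auto simp: f_def)
    moreover have "inj_on f ?W"
    proof (rule inj_onI)
      fix x y assume x: "x \<in> ?W" and y: "y \<in> ?W" and "f x = f y"
      then have "h x = h y" by (simp add: f_def)
      then show "x = y" using inj_onD[OF bij_betw_imp_inj_on[OF h] _ x y] by simp
    qed
    ultimately show "bij_betw f ?W (Inr ` {..<r})" using h by (simp add: bij_betw_def)
  qed auto
  moreover have "{p, q} \<union> ?W = verts G" using pq by auto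
  moreover have "verts (complete_graph 2 \<squnion>\<^sub>G complement (complete_graph r)) = Inl ` {..<2} \<union> Inr ` {..<r}"
    by (simp add: disj_union_def complete_graph_def complement_def)
  ultimately have bij: "bij_betw f (verts G) (verts (complete_graph 2 \<squnion>\<^sub>G complement (complete_graph r)))" by simp
  have "all_pairs {..<2::nat} = {{0, 1}}"
  proof -
    have two: "{..<2} = {0, 1::nat}" by auto
    have "x = {0, 1::nat}" if "x \<in> all_pairs {0, 1}" for x
      using that unfolding all_pairs_def by (intro card_subset_eq) auto
    moreover have "{0, 1::nat} \<in> all_pairs {0, 1}" by (simp add: all_pairs_def)
    ultimately show ?thesis unfolding two by (intro equalityI subsetI) simp_all
  qed
  then have "edges (complete_graph 2 \<squnion>\<^sub>G complement (complete_graph r)) = {Inl ` {0, 1}}"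
    by (simp add: disj_union_def complete_graph_def complement_def)
  also have "\<dots> = (\<lambda>e. f ` e) ` edges G" using e pq by (simp add: f_def insert_commute)
  finally show ?thesis using bij unfolding isomorphic_def by blast
qed

lemma degree_eq_dg:
  assumes "simple_graph G" "v \<in> verts G" shows "degree G v = two_graph.dg (edges G) (verts G) v"
proof -
  interpret two_graph "edges G" by (rule simple_two_graph[OF assms(1)])
  have "{e \<in> edges G. v \<in> e} = (\<lambda>u. {v, u}) ` nb (verts G) v"
  proof
    show "{e \<in> edges G. v \<in> e} \<subseteq> (\<lambda>u. {v, u}) ` nb (verts G) v"
    proof
      fix e assume "e \<in> {e \<in> edges G. v \<in> e}"
      then have e: "e \<in> edges G" "v \<in> e" "e \<subseteq> verts G" using assms(1) by (auto simp: simple_graph_def all_pairs_def)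
      from edgeE[OF e(1)] obtain p q where pq: "e = {p, q}" "p \<noteq> q" "adj p q" .
      then show "e \<in> (\<lambda>u. {v, u}) ` nb (verts G) v"
        using e adj_sym[of p q] by (cases "p = v") (auto simp: nb_def insert_commute)
    qed
    show "(\<lambda>u. {v, u}) ` nb (verts G) v \<subseteq> {e \<in> edges G. v \<in> e}" by (auto simp: nb_def adj_def)
  qed
  moreover have "inj_on (\<lambda>u. {v, u}) (nb (verts G) v)" by (auto simp: inj_on_def doubleton_eq_iff nb_def)
  ultimately show ?thesis by (simp add: degree_def dg_def card_image)
qed

lemma ne_verts: "simple_graph G \<Longrightarrow> two_graph.ne (edges G) (verts G) = card (edges G)"
proof -
  assume G: "simple_graph G"
  interpret two_graph "edges G" by (rule simple_two_graph[OF G])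
  have "{e \<in> edges G. e \<subseteq> verts G} = edges G" using G by (auto simp: simple_graph_def all_pairs_def)
  then show ?thesis by (simp add: ne_def)
qed

text \<open>Graphs without the star forest form a subclass, and a maximum over the larger class that
  lies in the subclass is a maximum there.\<close>

lemma extremal_star_forest:
  assumes G: "G \<in> extremal n (star_forest t a \<squnion>\<^sub>G path_graph l)" and f: "is_free (star_forest t a) G"
  shows "G \<in> extremal n (star_forest t a)"
proof -
  have "is_free (star_forest t a \<squnion>\<^sub>G path_graph l) G'"
    if "simple_graph G'" "is_free (star_forest t a) G'" for G' :: "nat ugraph"
    using that is_free_disj_union simple_star_forest simple_path_graph simple_disj_union by blast
  then show ?thesis using G f unfolding extremal_def by blast
qed

theorem theorem1p9:
  fixes t k :: nat and a :: "nat \<Rightarrow> nat"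
  assumes "t \<ge> 1" and "k \<ge> 1"
    and "\<And>i j. 1 \<le> i \<Longrightarrow> i \<le> j \<Longrightarrow> j \<le> t \<Longrightarrow> a i \<ge> a j"
    and "a t \<ge> 3"
  shows "\<exists>n0. \<forall>n \<ge> n0. \<forall>G \<in> extremal n (star_forest t a \<squnion>\<^sub>G path_graph (2 * k + 3)).
           G \<in> extremal n (star_forest t a) \<or>
           (\<exists>H :: nat ugraph.
              simple_graph H \<and> card (verts H) = n - t \<and> G \<simeq> complete_graph t \<or>\<^sub>G H \<and>
              (a t \<le> 2 * k \<longrightarrow> H \<simeq> complete_graph k \<or>\<^sub>G (complete_graph 2 \<squnion>\<^sub>G complement (complete_graph (n - t - k - 2)))) \<and>
              (a t = 2 * k + 1 \<longrightarrow>
                 (regular (2 * k) H \<and> is_free (path_graph (2 * k + 3)) H) \<or>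
                 (k = 1 \<and> H \<simeq> complete_graph 1 \<or>\<^sub>G (complete_graph 2 \<squnion>\<^sub>G complement (complete_graph (n - t - 3))))) \<and>
              (a t \<ge> 2 * k + 2 \<longrightarrow> H \<in> extremal (n - t) (path_graph (2 * k + 3))))"
proof -
  have amin: "a t \<le> a i" if "i \<in> {1..t}" for i using assms(3)[of i t] that by simp
  \<comment> \<open>These are the later \<open>star_size\<close> and \<open>M\<close>, written out
    because the threshold has to be fixed before the graph.\<close>
  define s where "s = (\<Sum>i\<in>{1..t}. a i + 1)"
  define m where "m = s + (2 * k + 3)"
  define c where "c = 2 * (k + 1) + 2 * k * k"
  define b where "b = (t + k) * c + (2 * k + 1 + k * (2 * k + 2))"
  define C where "C = 2 * (k + 1) * (a t + 1) + 2 * k * k"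
  \<comment> \<open>The sum of the thresholds of \<open>many_large\<close>,
    \<open>exactly_t_large\<close>, \<open>more_than_t_large\<close> and
    \<open>lower_regular\<close>.\<close>
  define n0 where "n0 = (2 * s * m + (t + k) * (t + k) + (t + k))
    + (t + 2 * k * k + 2 * (m * (a t + 1 + C)) + (a t + 1 + C) + 2 * k + 2)
    + ((t + k + 1) + (t + k + 1) * c + 2 * k + 6) + ((t + k) + 2 * k * k + 2 * (m * b))
    + (t + (2 * k + 1) * (2 * k + 1)) + 1"
  show ?thesis
  proof (intro exI[of _ n0] allI impI ballI)
    fix n G assume n: "n0 \<le> n" and Gex: "G \<in> extremal n (star_forest t a \<squnion>\<^sub>G path_graph (2 * k + 3))"
    let ?R1 = "complete_graph k \<or>\<^sub>G (complete_graph 2 \<squnion>\<^sub>G complement (complete_graph (n - t - k - 2)))"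
    let ?R2 = "complete_graph 1 \<or>\<^sub>G (complete_graph 2 \<squnion>\<^sub>G complement (complete_graph (n - t - 3)))"
    let ?P = "\<lambda>H :: nat ugraph. simple_graph H \<and> card (verts H) = n - t \<and> G \<simeq> complete_graph t \<or>\<^sub>G H \<and>
              (a t \<le> 2 * k \<longrightarrow> H \<simeq> ?R1) \<and>
              (a t = 2 * k + 1 \<longrightarrow>
                 (regular (2 * k) H \<and> is_free (path_graph (2 * k + 3)) H) \<or> (k = 1 \<and> H \<simeq> ?R2)) \<and>
              (a t \<ge> 2 * k + 2 \<longrightarrow> H \<in> extremal (n - t) (path_graph (2 * k + 3)))"
    show "G \<in> extremal n (star_forest t a) \<or> (\<exists>H. ?P H)"
    proof (cases "is_free (star_forest t a) G")
      case True
      then show ?thesis using extremal_star_forest[OF Gex] by blast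
    next
      case False
      let ?V = "verts G" and ?E = "edges G"
      have G: "simple_graph G" and cV: "card ?V = n"
        and fr: "is_free (star_forest t a \<squnion>\<^sub>G path_graph (2 * k + 3)) G"
        using Gex by (auto simp: extremal_def)
      interpret two_graph ?E by (rule simple_two_graph[OF G])
      have noF: "\<not> has_stars_path ?V {1..t} a (2 * k + 3)" using stars_path_not_free[OF G] fr by blast
      interpret host ?E ?V t k a
        using G assms(1,2) noF by unfold_locales (auto simp: simple_graph_def)
      have sm: "star_size = s" "M = m" by (auto simp: star_size_def s_def M_def m_def)
      have neG: "ne ?V = card ?E" by (rule ne_verts[OF G])
      have tn: "t + k + 2 \<le> n" "t + (2 * k + 1) * (2 * k + 1) \<le> n" using n by (simp_all add: n0_def)
      have a3: "a i \<ge> 3" if "i \<in> {1..t}" for i using amin[OF that] assms(4) by linarith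
      have l1: dense unfolding dense_def cV neG by (rule lower_near_independent[OF Gex tn(1) a3])
      obtain sc sA where st: "stars ?V {1..t} a sc sA" using not_free_stars[OF G False] by blast
      have cardL: "t \<le> card L"
        using many_large[OF st l1] n unfolding cV sm n0_def by linarith
      \<comment> \<open>All cases end alike: t large vertices with nothing missing split off as a
        join, and only the shape of the rest depends on the case.\<close>
      have H: "?P (induced G (?V - T))" if T: "T \<subseteq> L" "card T = t" and mis: "missing ?V T = 0"
          and i: "a t \<le> 2 * k \<Longrightarrow> induced G (?V - T) \<simeq> ?R1"
          and ii: "a t = 2 * k + 1 \<Longrightarrow> (\<forall>x\<in>?V - T. dg (?V - T) x = 2 * k) \<or> k = 1 \<and> induced G (?V - T) \<simeq> ?R2"
          and iii: "a t \<ge> 2 * k + 2 \<Longrightarrow> 2 * int (ne (?V - T)) = fs_bound (k + 1) (n - t)" for T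
      proof -
        let ?W = "?V - T" and ?H = "induced G (?V - T)"
        have TV: "T \<subseteq> ?V" using T(1) L_subset by blast
        have sH: "simple_graph ?H" using simple_induced[OF G] by blast
        have fT: "finite T" using TV finV finite_subset by blast
        have cW: "card ?W = n - t" using fT TV T(2) cV by (simp add: card_Diff_subset)
        have "finite (cross ?V T - ?E)" using finV by simp
        then have cr: "cross ?V T \<subseteq> ?E" using mis unfolding missing_def by simp
        have iso: "G \<simeq> complete_graph t \<or>\<^sub>G ?H" by (rule isomorphic_join[OF G TV T(2) cr isomorphic_refl])
        have "{e \<in> ?E. e \<subseteq> ?W} = {e \<in> edges ?H. e \<subseteq> ?W}" by auto
        note se = same_edges[OF simple_two_graph[OF G] simple_two_graph[OF sH] this]
        have free: "is_free (path_graph (2 * k + 3)) ?H"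
          using is_free_path[OF sH] se(2) no_path_outside[OF T] by simp
        have reg: "regular (2 * k) ?H" if "\<forall>x\<in>?W. dg ?W x = 2 * k"
          unfolding regular_def using degree_eq_dg[OF sH] se(1) that by simp
        \<comment> \<open>The rest attains \<open>fs_bound\<close>, which no competitor exceeds by
          \<open>faudree_schelp\<close>.\<close>
        have ext: "?H \<in> extremal (n - t) (path_graph (2 * k + 3))" if "a t \<ge> 2 * k + 2"
        proof -
          have "card (edges G') \<le> card (edges ?H)"
            if G': "simple_graph G'" "card (verts G') = n - t" "is_free (path_graph (2 * k + 3)) G'" for G' :: "nat ugraph"
          proof -
            have "two_graph.no_path (edges G') (2 * (k + 1) + 1) (verts G')"
              using is_free_path[OF G'(1)] G'(3) by (simp add: eval_nat_numeral)
            moreover have "finite (verts G')" using G'(1) by (simp add: simple_graph_def)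
            ultimately have "2 * int (two_graph.ne (edges G') (verts G')) \<le> fs_bound (k + 1) (n - t)"
              using two_graph.faudree_schelp[OF simple_two_graph[OF G'(1)], of "verts G'" "k + 1"] G'(2) by simp
            moreover have "ne ?W = card (edges ?H)" using se(3) ne_verts[OF sH] by simp
            ultimately show ?thesis using iii[OF \<open>a t \<ge> 2 * k + 2\<close>] ne_verts[OF G'(1)] by simp
          qed
          then show ?thesis using sH cW free unfolding extremal_def by simp
        qed
        show ?thesis using sH cW iso i ii reg free ext by auto
      qed
      show ?thesis
      proof (cases "a t \<ge> 2 * k + 2")
        case True
        \<comment> \<open>Any t large vertices will do: \<open>lower_cliques\<close> and
          \<open>faudree_schelp\<close> leave no slack, so nothing is missing at them.\<close>
        obtain T where T: "T \<subseteq> L" "card T = t" using cardL obtain_subset_with_card_n by metis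
        have TV: "T \<subseteq> ?V" using T(1) L_subset by blast
        have cW: "card (?V - T) = n - t" using TV T(2) cV finV finite_subset[OF TV] by (simp add: card_Diff_subset)
        have ai: "a i \<ge> 2 * k + 2" if "i \<in> {1..t}" for i using amin[OF that] True by linarith
        have "t \<le> n" using tn by simp
        then have "2 * int (ne ?V) \<ge> int n * (int n - 1) - (int n - int t) * (int n - int t - 1) + fs_bound (k + 1) (n - t)"
          unfolding neG using ai by (intro lower_cliques[OF Gex])
        moreover have "2 * int (ne (?V - T)) \<le> fs_bound (k + 1) (n - t)"
        proof -
          have "no_path (2 * (k + 1) + 1) (?V - T)" using no_path_outside[OF T] by (simp add: eval_nat_numeral)
          then show ?thesis using faudree_schelp[of "?V - T" "k + 1"] finV cW by simp
        qed
        moreover have "2 * int (ne ?V) + 2 * int (missing ?V T) = int n * (int n - 1)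
           - (int n - int t) * (int n - int t - 1) + 2 * int (ne (?V - T))"
          using edge_count[OF finV TV] unfolding cV T(2) .
        ultimately have "missing ?V T = 0" "2 * int (ne (?V - T)) = fs_bound (k + 1) (n - t)" by linarith+
        then have "?P (induced G (?V - T))" using T True by (intro H) auto
        then show ?thesis by blast
      next
        case False
        then have at: "a t \<le> 2 * k + 1" by simp
        have lreg: "int n * (int n - 1) - (int n - int t) * (int n - int t - 1)
           + 2 * int k * (int n - int t) \<le> 2 * int (ne ?V)" if "a t = 2 * k + 1"
        proof -
          have "a i > 2 * k" if "i \<in> {1..t}" for i using amin[OF that] \<open>a t = 2 * k + 1\<close> by linarith
          then show ?thesis unfolding neG by (rule lower_regular[OF Gex tn(2)])
        qed
        show ?thesis
        proof (cases "card L = t")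
          case True
          have "a t = 2 * k + 1 \<and> missing ?V L = 0 \<and> (\<forall>x\<in>?V - L. dg (?V - L) x = 2 * k)"
          proof (rule exactly_t_large[OF True l1 at C_def])
            show "t + 2 * k * k + 2 * (M * (a t + 1 + C)) + (a t + 1 + C) + 2 * k + 2 < card ?V"
              using n unfolding cV sm n0_def by linarith
          qed (use lreg in \<open>simp add: cV\<close>)
          then have "?P (induced G (?V - L))" using True at by (intro H) auto
          then show ?thesis by blast
        next
          case False
          then have tL: "t < card L" using cardL by simp
          have res: "card L = t + k \<and> missing ?V L = 0 \<and> ne (?V - L) = 1"
          proof (rule more_than_t_large[OF tL l1 c_def b_def])
            show "t + k + 1 + (t + k + 1) * c + 2 * k + 6 < card ?V"
              "t + k + 2 * k * k + 2 * (M * b) < card ?V"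
              using n unfolding cV sm n0_def by linarith+
          qed
          obtain T where T: "T \<subseteq> L" "card T = t" using cardL obtain_subset_with_card_n by metis
          have fT: "finite T" using T(1) finL finite_subset by blast
          have "finite (cross ?V L - ?E)" using finV by simp
          then have crL: "cross ?V L \<subseteq> ?E" using res unfolding missing_def by simp
          have "cross ?V T \<subseteq> cross ?V L" using T(1) by (auto simp: cross_def)
          then have "cross ?V T - ?E = {}" using crL by blast
          then have mis: "missing ?V T = 0" by (simp only: missing_def card.empty)
          let ?H = "induced G (?V - T)" and ?A = "L - T"
          have WA: "?V - T - ?A = ?V - L" using T(1) by auto
          have sH: "simple_graph ?H" using simple_induced[OF G] by blast
          have cA: "card ?A = k" using T res fT by (simp add: card_Diff_subset)
          \<comment> \<open>The k large vertices outside \<open>T\<close> are the clique of the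
            inner join.\<close>
          have iso: "?H \<simeq> ?R1"
          proof (rule isomorphic_join[OF sH _ cA])
            show "?A \<subseteq> verts ?H" using L_subset by auto
            show "cross (verts ?H) ?A \<subseteq> edges ?H" using crL by (auto simp: cross_def all_pairs_def)
            have "induced ?H (?V - L) = induced G (?V - L)" using T(1) by (auto simp: induced_def)
            moreover have "induced G (?V - L) \<simeq> complete_graph 2 \<squnion>\<^sub>G complement (complete_graph (n - t - k - 2))"
            proof (rule isomorphic_single_edge)
              show "simple_graph (induced G (?V - L))" using simple_induced[OF G] by blast
              show "card (edges (induced G (?V - L))) = 1" using res by (simp add: ne_def)
              show "card (verts (induced G (?V - L))) = n - t - k - 2 + 2"
                using L_subset finL res tn(1) cV by (simp add: card_Diff_subset)
            qed
            ultimately show "induced ?H (verts ?H - ?A) \<simeq> complete_graph 2 \<squnion>\<^sub>G complement (complete_graph (n - t - k - 2))"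
              using WA by simp
          qed
          have iso2: "?H \<simeq> ?R2" if "k = 1"
          proof -
            have e: "n - t - k - 2 = n - t - 3" using that by simp
            show ?thesis using iso unfolding e unfolding that .
          qed
          \<comment> \<open>With P = n - t, twice the number of edges outside \<open>T\<close> is
            2kP - k^2 - k + 2 and must reach the 2kP of the regular construction.\<close>
          have k_eq: "k = 1" if "a t = 2 * k + 1"
          proof -
            define P where "P = int n - int t"
            have e: "int n - int (t + k) = P - int k" by (simp add: P_def)
            have r: "card L = t + k" "missing ?V L = 0" "ne (?V - L) = 1" using res by auto
            have "2 * int (ne ?V) = int n * (int n - 1) - (P - int k) * (P - int k - 1) + 2"
              using edge_count[OF finV L_subset] unfolding cV r e by simp
            moreover have "int n * (int n - 1) - P * (P - 1) + 2 * int k * P \<le> 2 * int (ne ?V)"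
              using lreg[OF that] by (simp add: P_def)
            moreover have "P * (P - 1) - (P - int k) * (P - int k - 1) = 2 * int k * P - int k * int k - int k"
              by (simp add: algebra_simps)
            ultimately have "int k * int k + int k \<le> 2" by linarith
            moreover have "2 * int k \<le> int k * int k" if "k \<ge> 2" using that by (intro mult_right_mono) auto
            ultimately show "k = 1" using assms(2) by (cases "k \<ge> 2") linarith+
          qed
          have "?P ?H"
          proof (rule H[OF T mis iso])
            show "(\<forall>x\<in>?V - T. dg (?V - T) x = 2 * k) \<or> k = 1 \<and> ?H \<simeq> ?R2" if "a t = 2 * k + 1"
              using k_eq[OF that] iso2 by blast
          qed (use \<open>\<not> 2 * k + 2 \<le> a t\<close> in simp)
          then show ?thesis by blast
        qed
      qed
    qed
  qed
qed

end
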